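(* Let $D=(\mathscr{T},\mathscr{U},D)$ be a bifold algebra. Then the left dualizer of the dualization adjunction $\mathsf{Dualn}(D)$ is isomorphic to the left face $D_\ell$ of $D$, and the right dualizer of $\mathsf{Dualn}(D)$ is isomorphic to the right face $D_r$ of $D$.
   Context: Setting. $\mathscr{V}=(\mathscr{V},\otimes,I)$ is a symmetric monoidal closed category whose underlying ordinary category has finite limits; $\mathscr{V}$-categories may be large. $\mathscr{J}\hookrightarrow\mathscr{V}$ is a system of arities, i.e. a full sub-$\mathscr{V}$-category closed under $\otimes$ and containing $I$. $\mathscr{J}$-powers in a $\mathscr{V}$-category are powers (cotensors) by objects $J\in\mathscr{J}$. A $\mathscr{J}$-theory is a $\mathscr{V}$-category $\mathscr{T}$ with $\mathrm{ob}\,\mathscr{T}=\mathrm{ob}\,\mathscr{J}$, equipped with an identity-on-objects $\mathscr{V}$-functor $\mathscr{J}^{\mathrm{op}}\to\mathscr{T}$ that preserves $\mathscr{J}$-powers. A $\mathscr{T}$-algebra is a $\mathscr{V}$-functor $\mathscr{T}\to\mathscr{V}$ that preserves $\mathscr{J}$-powers; $\mathscr{T}\text{-}\mathrm{Alg}$ is the full subcategory of $[\mathscr{T},\mathscr{V}]$ on these, and $G^{\mathscr{T}}:\mathscr{T}\text{-}\mathrm{Alg}\to\mathscr{V}$ is evaluation at $I$. Throughout, $\mathscr{J}$ is amenable: for every $\mathscr{J}$-theory $\mathscr{T}$, $\mathscr{T}\text{-}\mathrm{Alg}$ exists as a $\mathscr{V}$-category and $G^{\mathscr{T}}$ has a left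 adjoint $F^{\mathscr{T}}$. Bifold algebras and dualization. A $(\mathscr{T},\mathscr{U})$-algebra is a $\mathscr{V}$-functor $D:\mathscr{T}\otimes\mathscr{U}\to\mathscr{V}$ that preserves $\mathscr{J}$-powers in each variable separately; a bifold algebra is a triple $(\mathscr{T},\mathscr{U},D)$ with $\mathscr{T},\mathscr{U}$ $\mathscr{J}$-theories and $D$ a $(\mathscr{T},\mathscr{U})$-algebra. Its left face is the $\mathscr{T}$-algebra $D_\ell=D(-,I)$ and its right face is the $\mathscr{U}$-algebra $D_r=D(I,-)$. $\mathrm{Hom}_{\mathscr{T}}(-,D):\mathscr{T}\text{-}\mathrm{Alg}^{\mathrm{op}}\to\mathscr{U}\text{-}\mathrm{Alg}$ is given by $(\mathrm{Hom}_{\mathscr{T}}(A,D))K=\mathscr{T}\text{-}\mathrm{Alg}(A,D(-,K))$ and $\mathrm{Hom}_{\mathscr{U}}(-,D):\mathscr{U}\text{-}\mathrm{Alg}\to\mathscr{T}\text{-}\mathrm{Alg}^{\mathrm{op}}$ by $(\mathrm{Hom}_{\mathscr{U}}(B,D))J=\mathscr{U}\text{-}\mathrm{Alg}(B,D(J,-))$. There is a $\mathscr{V}$-adjunction $\mathrm{Hom}_{\mathscr{U}}(-,D)\dashv\mathrm{Hom}_{\mathscr{T}}(-,D)$, given by the canonical isomorphisms $\mathscr{T}\text{-}\mathrm{Alg}(A,\mathrm{Hom}_{\mathscr{U}}(B,D))\cong\mathscr{U}\text{-}\mathrm{Alg}(B,\mathrm{Hom}_{\mathscr{T}}(A,D))$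 (both sides are canonically the end $\int_{J,K}\mathscr{V}(AJ\otimes BK,D(J,K))$); it is called the dualization adjunction induced by $D$ and denoted $\mathsf{Dualn}(D)$. Dualizers. A $\mathscr{V}$-category $(\mathscr{A},G)$ equipped with a $\mathscr{V}$-functor $G:\mathscr{A}\to\mathscr{V}$ is $\mathscr{J}$-algebraic if there is a $\mathscr{J}$-theory $\mathscr{T}$ and an equivalence $P:\mathscr{A}\simeq\mathscr{T}\text{-}\mathrm{Alg}$ with $G^{\mathscr{T}}P\cong G$. A $\mathscr{J}$-algebraic dual adjunction $(\mathscr{A},\mathscr{B},\nabla\dashv\Delta)$ consists of $\mathscr{J}$-algebraic $\mathscr{V}$-categories $(\mathscr{A},G_\ell)$, $(\mathscr{B},G_r)$ and a $\mathscr{V}$-adjunction $\nabla\dashv\Delta:\mathscr{A}^{\mathrm{op}}\to\mathscr{B}$. Writing $F_\ell\dashv G_\ell$ and $F_r\dashv G_r$, its left dualizer is the object $\nabla F_rI$ of $\mathscr{A}$ and its right dualizer is the object $\Delta F_\ell I$ of $\mathscr{B}$. For $\mathsf{Dualn}(D)$ one has $\mathscr{A}=\mathscr{T}\text{-}\mathrm{Alg}$, $\mathscr{B}=\mathscr{U}\text{-}\mathrm{Alg}$ (equipped with $G^{\mathscr{T}},G^{\mathscr{U}}$), $\Delta=\mathrm{Hom}_{\mathscr{T}}(-,D)$, $\nabla=\mathrm{Hom}_{\mathscr{U}}(-,D)$. *)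

theory Defs
  imports Main
begin

section \<open>Ordinary categories and finite limits\<close>

record ('o, 'm) cat =
  Obj :: "'o set"
  Arr :: "'m set"
  Dom :: "'m \<Rightarrow> 'o"
  Cod :: "'m \<Rightarrow> 'o"
  Idn :: "'o \<Rightarrow> 'm"
  Cmp :: "'m \<Rightarrow> 'm \<Rightarrow> 'm" (infixr "\<cdot>\<index>" 55)

definition hom :: "('o, 'm, 'z) cat_scheme \<Rightarrow> 'o \<Rightarrow> 'o \<Rightarrow> 'm set"
  where "hom C a b = {f \<in> Arr C. Dom C f = a \<and> Cod C f = b}"

locale category =
  fixes C :: "('o, 'm, 'z) cat_scheme" (structure)
  assumes dom_obj: "f \<in> Arr C \<Longrightarrow> Dom C f \<in> Obj C"
    and cod_obj: "f \<in> Arr C \<Longrightarrow> Cod C f \<in> Obj C"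
    and idn_hom: "a \<in> Obj C \<Longrightarrow> Idn C a \<in> hom C a a"
    and cmp_hom: "f \<in> hom C a b \<Longrightarrow> g \<in> hom C b c \<Longrightarrow> g \<cdot> f \<in> hom C a c"
    and idn_cmp: "f \<in> hom C a b \<Longrightarrow> Idn C b \<cdot> f = f"
    and cmp_idn: "f \<in> hom C a b \<Longrightarrow> f \<cdot> Idn C a = f"
    and cmp_assoc: "f \<in> hom C a b \<Longrightarrow> g \<in> hom C b c \<Longrightarrow> h \<in> hom C c d
      \<Longrightarrow> (h \<cdot> g) \<cdot> f = h \<cdot> (g \<cdot> f)"

definition inverse_arrows :: "('o, 'm, 'z) cat_scheme \<Rightarrow> 'm \<Rightarrow> 'm \<Rightarrow> bool"
  where "inverse_arrows C f g \<longleftrightarrow> f \<in> Arr C \<and> g \<in> hom C (Cod C f) (Dom C f) \<and>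
    g \<cdot>\<^bsub>C\<^esub> f = Idn C (Dom C f) \<and> f \<cdot>\<^bsub>C\<^esub> g = Idn C (Cod C f)"

definition is_iso :: "('o, 'm, 'z) cat_scheme \<Rightarrow> 'm \<Rightarrow> bool"
  where "is_iso C f \<longleftrightarrow> (\<exists>g. inverse_arrows C f g)"

definition inv_arr :: "('o, 'm, 'z) cat_scheme \<Rightarrow> 'm \<Rightarrow> 'm"
  where "inv_arr C f = (THE g. inverse_arrows C f g)"

definition is_functor ::
  "('k, 'n, 'y) cat_scheme \<Rightarrow> ('o, 'm, 'z) cat_scheme \<Rightarrow> ('k \<Rightarrow> 'o) \<Rightarrow> ('n \<Rightarrow> 'm) \<Rightarrow> bool"
  where "is_functor K C F Fa \<longleftrightarrow>
    (\<forall>k\<in>Obj K. F k \<in> Obj C \<and> Fa (Idn K k) = Idn C (F k)) \<and>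
    (\<forall>k l. \<forall>f\<in>hom K k l. Fa f \<in> hom C (F k) (F l)) \<and>
    (\<forall>k l m. \<forall>f\<in>hom K k l. \<forall>g\<in>hom K l m. Fa (g \<cdot>\<^bsub>K\<^esub> f) = Fa g \<cdot>\<^bsub>C\<^esub> Fa f)"

definition is_cone ::
  "('k, 'n, 'y) cat_scheme \<Rightarrow> ('o, 'm, 'z) cat_scheme \<Rightarrow> ('k \<Rightarrow> 'o) \<Rightarrow> ('n \<Rightarrow> 'm)
    \<Rightarrow> 'o \<Rightarrow> ('k \<Rightarrow> 'm) \<Rightarrow> bool"
  where "is_cone K C F Fa c p \<longleftrightarrow> c \<in> Obj C \<and> (\<forall>k\<in>Obj K. p k \<in> hom C c (F k)) \<and>
    (\<forall>k l. \<forall>f\<in>hom K k l. Fa f \<cdot>\<^bsub>C\<^esub> p k = p l)"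

definition is_limit ::
  "('k, 'n, 'y) cat_scheme \<Rightarrow> ('o, 'm, 'z) cat_scheme \<Rightarrow> ('k \<Rightarrow> 'o) \<Rightarrow> ('n \<Rightarrow> 'm)
    \<Rightarrow> 'o \<Rightarrow> ('k \<Rightarrow> 'm) \<Rightarrow> bool"
  where "is_limit K C F Fa c p \<longleftrightarrow> is_cone K C F Fa c p \<and>
    (\<forall>x q. is_cone K C F Fa x q \<longrightarrow> (\<exists>!h. h \<in> hom C x c \<and> (\<forall>k\<in>Obj K. p k \<cdot>\<^bsub>C\<^esub> h = q k)))"

text \<open>Every finite category is isomorphic to one whose objects and arrows are natural numbers, so
  it is enough to let the shapes range over those.\<close>

definition has_finite_limits :: "('o, 'm, 'z) cat_scheme \<Rightarrow> bool"
  where "has_finite_limits C \<longleftrightarrow>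
    (\<forall>(K :: (nat, nat) cat) F Fa.
      category K \<and> finite (Obj K) \<and> finite (Arr K) \<and> is_functor K C F Fa
        \<longrightarrow> (\<exists>c p. is_limit K C F Fa c p))"


section \<open>Symmetric monoidal closed categories\<close>

text \<open>\<open>Asc a b c : (a \<otimes> b) \<otimes> c \<rightarrow> a \<otimes> (b \<otimes> c)\<close>, \<open>Lun a : I \<otimes> a \<rightarrow> a\<close>, \<open>Run a : a \<otimes> I \<rightarrow> a\<close>,
  \<open>Sym a b : a \<otimes> b \<rightarrow> b \<otimes> a\<close> and \<open>Evl a b : [a, b] \<otimes> a \<rightarrow> b\<close>, where \<open>[a, b]\<close> is \<open>Ihom a b\<close>.
  Tensor of arrows is written \<open>f \<boxtimes> g\<close>.\<close>

record ('o, 'm) smcc = "('o, 'm) cat" +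
  TenO :: "'o \<Rightarrow> 'o \<Rightarrow> 'o" (infixl "\<otimes>\<index>" 70)
  TenA :: "'m \<Rightarrow> 'm \<Rightarrow> 'm" (infixl "\<boxtimes>\<index>" 70)
  Unit :: "'o" ("\<I>\<index>")
  Asc :: "'o \<Rightarrow> 'o \<Rightarrow> 'o \<Rightarrow> 'm"
  Lun :: "'o \<Rightarrow> 'm"
  Run :: "'o \<Rightarrow> 'm"
  Sym :: "'o \<Rightarrow> 'o \<Rightarrow> 'm"
  Ihom :: "'o \<Rightarrow> 'o \<Rightarrow> 'o"
  Evl :: "'o \<Rightarrow> 'o \<Rightarrow> 'm"

locale monoidal_category = category V for V :: "('o, 'm) smcc" (structure) +
  assumes unit_obj: "\<I> \<in> Obj V"
    and ten_obj: "a \<in> Obj V \<Longrightarrow> b \<in> Obj V \<Longrightarrow> a \<otimes> b \<in> Obj V"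
    and ten_hom: "f \<in> hom V a b \<Longrightarrow> g \<in> hom V c d \<Longrightarrow> f \<boxtimes> g \<in> hom V (a \<otimes> c) (b \<otimes> d)"
    and ten_idn: "a \<in> Obj V \<Longrightarrow> b \<in> Obj V \<Longrightarrow> Idn V a \<boxtimes> Idn V b = Idn V (a \<otimes> b)"
    and ten_cmp: "f \<in> hom V a b \<Longrightarrow> g \<in> hom V b c \<Longrightarrow> f' \<in> hom V a' b' \<Longrightarrow> g' \<in> hom V b' c'
      \<Longrightarrow> (g \<cdot> f) \<boxtimes> (g' \<cdot> f') = (g \<boxtimes> g') \<cdot> (f \<boxtimes> f')"
    and asc_hom: "a \<in> Obj V \<Longrightarrow> b \<in> Obj V \<Longrightarrow> c \<in> Obj V
      \<Longrightarrow> Asc V a b c \<in> hom V (a \<otimes> b \<otimes> c) (a \<otimes> (b \<otimes> c))"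
    and asc_iso: "a \<in> Obj V \<Longrightarrow> b \<in> Obj V \<Longrightarrow> c \<in> Obj V \<Longrightarrow> is_iso V (Asc V a b c)"
    and asc_nat: "f \<in> hom V a a' \<Longrightarrow> g \<in> hom V b b' \<Longrightarrow> h \<in> hom V c c'
      \<Longrightarrow> Asc V a' b' c' \<cdot> (f \<boxtimes> g \<boxtimes> h) = (f \<boxtimes> (g \<boxtimes> h)) \<cdot> Asc V a b c"
    and lun_hom: "a \<in> Obj V \<Longrightarrow> Lun V a \<in> hom V (\<I> \<otimes> a) a"
    and lun_iso: "a \<in> Obj V \<Longrightarrow> is_iso V (Lun V a)"
    and lun_nat: "f \<in> hom V a b \<Longrightarrow> Lun V b \<cdot> (Idn V \<I> \<boxtimes> f) = f \<cdot> Lun V a"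
    and run_hom: "a \<in> Obj V \<Longrightarrow> Run V a \<in> hom V (a \<otimes> \<I>) a"
    and run_iso: "a \<in> Obj V \<Longrightarrow> is_iso V (Run V a)"
    and run_nat: "f \<in> hom V a b \<Longrightarrow> Run V b \<cdot> (f \<boxtimes> Idn V \<I>) = f \<cdot> Run V a"
    and pentagon: "a \<in> Obj V \<Longrightarrow> b \<in> Obj V \<Longrightarrow> c \<in> Obj V \<Longrightarrow> d \<in> Obj V
      \<Longrightarrow> Asc V a b (c \<otimes> d) \<cdot> Asc V (a \<otimes> b) c d
        = (Idn V a \<boxtimes> Asc V b c d) \<cdot> Asc V a (b \<otimes> c) d \<cdot> (Asc V a b c \<boxtimes> Idn V d)"
    and triangle: "a \<in> Obj V \<Longrightarrow> b \<in> Obj V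
      \<Longrightarrow> (Idn V a \<boxtimes> Lun V b) \<cdot> Asc V a \<I> b = Run V a \<boxtimes> Idn V b"

locale symmetric_monoidal_category = monoidal_category V for V :: "('o, 'm) smcc" (structure) +
  assumes sym_hom: "a \<in> Obj V \<Longrightarrow> b \<in> Obj V \<Longrightarrow> Sym V a b \<in> hom V (a \<otimes> b) (b \<otimes> a)"
    and sym_nat: "f \<in> hom V a a' \<Longrightarrow> g \<in> hom V b b'
      \<Longrightarrow> Sym V a' b' \<cdot> (f \<boxtimes> g) = (g \<boxtimes> f) \<cdot> Sym V a b"
    and sym_sym: "a \<in> Obj V \<Longrightarrow> b \<in> Obj V \<Longrightarrow> Sym V b a \<cdot> Sym V a b = Idn V (a \<otimes> b)"
    and sym_unit: "a \<in> Obj V \<Longrightarrow> Lun V a \<cdot> Sym V a \<I> = Run V a"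
    and hexagon: "a \<in> Obj V \<Longrightarrow> b \<in> Obj V \<Longrightarrow> c \<in> Obj V
      \<Longrightarrow> Asc V b c a \<cdot> Sym V a (b \<otimes> c) \<cdot> Asc V a b c
        = (Idn V b \<boxtimes> Sym V a c) \<cdot> Asc V b a c \<cdot> (Sym V a b \<boxtimes> Idn V c)"

locale symmetric_monoidal_closed = symmetric_monoidal_category V for V :: "('o, 'm) smcc" (structure) +
  assumes ihom_obj: "a \<in> Obj V \<Longrightarrow> b \<in> Obj V \<Longrightarrow> Ihom V a b \<in> Obj V"
    and evl_hom: "a \<in> Obj V \<Longrightarrow> b \<in> Obj V \<Longrightarrow> Evl V a b \<in> hom V (Ihom V a b \<otimes> a) b"
    and evl_univ: "x \<in> Obj V \<Longrightarrow> a \<in> Obj V \<Longrightarrow> b \<in> Obj V \<Longrightarrow> f \<in> hom V (x \<otimes> a) b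
      \<Longrightarrow> \<exists>!g. g \<in> hom V x (Ihom V a b) \<and> Evl V a b \<cdot> (g \<boxtimes> Idn V a) = f"


section \<open>Enriched categories, functors and adjunctions\<close>

text \<open>\<open>Vid C A : I \<rightarrow> C(A,A)\<close> and \<open>Vcmp C A B B' : C(B,B') \<otimes> C(A,B) \<rightarrow> C(A,B')\<close>. Throughout, the
  values of the components of enriched categories and functors at arguments that are not objects
  carry no meaning.\<close>

record ('a, 'o, 'm) vcat =
  Vobj :: "'a set"
  Vhom :: "'a \<Rightarrow> 'a \<Rightarrow> 'o"
  Vid :: "'a \<Rightarrow> 'm"
  Vcmp :: "'a \<Rightarrow> 'a \<Rightarrow> 'a \<Rightarrow> 'm"

text \<open>\<open>Fhom F A B : C(A,B) \<rightarrow> D(F A, F B)\<close>.\<close>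

record ('a, 'b, 'm) vfun =
  Fobj :: "'a \<Rightarrow> 'b"
  Fhom :: "'a \<Rightarrow> 'a \<Rightarrow> 'm"

definition full_sub :: "('a, 'o, 'm) vcat \<Rightarrow> 'a set \<Rightarrow> ('a, 'o, 'm) vcat"
  where "full_sub C S = C\<lparr>Vobj := S\<rparr>"

definition vfun_id :: "('o, 'm) smcc \<Rightarrow> ('a, 'o, 'm) vcat \<Rightarrow> ('a, 'a, 'm) vfun"
  where "vfun_id V C = \<lparr>Fobj = (\<lambda>A. A), Fhom = (\<lambda>A B. Idn V (Vhom C A B))\<rparr>"

definition vfun_comp ::
  "('o, 'm) smcc \<Rightarrow> ('b, 'c, 'm) vfun \<Rightarrow> ('a, 'b, 'm) vfun \<Rightarrow> ('a, 'c, 'm) vfun"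
  where "vfun_comp V G F = \<lparr>Fobj = (\<lambda>A. Fobj G (Fobj F A)),
    Fhom = (\<lambda>A B. Fhom G (Fobj F A) (Fobj F B) \<cdot>\<^bsub>V\<^esub> Fhom F A B)\<rparr>"

definition vfun_op :: "('a, 'b, 'm) vfun \<Rightarrow> ('a, 'b, 'm) vfun"
  where "vfun_op F = \<lparr>Fobj = Fobj F, Fhom = (\<lambda>A B. Fhom F B A)\<rparr>"

context symmetric_monoidal_closed
begin

definition curry_arr :: "'o \<Rightarrow> 'o \<Rightarrow> 'o \<Rightarrow> 'm \<Rightarrow> 'm"
  where "curry_arr x a b f =
    (THE g. g \<in> hom V x (Ihom V a b) \<and> Evl V a b \<cdot> (g \<boxtimes> Idn V a) = f)"

definition uncurry_arr :: "'o \<Rightarrow> 'o \<Rightarrow> 'm \<Rightarrow> 'm"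
  where "uncurry_arr a b g = Evl V a b \<cdot> (g \<boxtimes> Idn V a)"

text \<open>The symmetry \<open>(a \<otimes> b) \<otimes> c \<rightarrow> (a \<otimes> c) \<otimes> b\<close>.\<close>

definition swap_right :: "'o \<Rightarrow> 'o \<Rightarrow> 'o \<Rightarrow> 'm"
  where "swap_right a b c =
    inv_arr V (Asc V a c b) \<cdot> (Idn V a \<boxtimes> Sym V b c) \<cdot> Asc V a b c"

text \<open>The symmetry \<open>(a \<otimes> b) \<otimes> (c \<otimes> d) \<rightarrow> (a \<otimes> c) \<otimes> (b \<otimes> d)\<close>.\<close>

definition interchange :: "'o \<Rightarrow> 'o \<Rightarrow> 'o \<Rightarrow> 'o \<Rightarrow> 'm"
  where "interchange a b c d =
    Asc V (a \<otimes> c) b d \<cdot> (swap_right a b c \<boxtimes> Idn V d) \<cdot> inv_arr V (Asc V (a \<otimes> b) c d)"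

definition is_vcat :: "('a, 'o, 'm) vcat \<Rightarrow> bool"
  where "is_vcat C \<longleftrightarrow>
    (\<forall>A\<in>Vobj C. \<forall>B\<in>Vobj C. Vhom C A B \<in> Obj V) \<and>
    (\<forall>A\<in>Vobj C. Vid C A \<in> hom V \<I> (Vhom C A A)) \<and>
    (\<forall>A\<in>Vobj C. \<forall>B\<in>Vobj C. \<forall>B'\<in>Vobj C.
      Vcmp C A B B' \<in> hom V (Vhom C B B' \<otimes> Vhom C A B) (Vhom C A B')) \<and>
    (\<forall>A\<in>Vobj C. \<forall>B\<in>Vobj C.
      Vcmp C A B B \<cdot> (Vid C B \<boxtimes> Idn V (Vhom C A B)) = Lun V (Vhom C A B) \<and>
      Vcmp C A A B \<cdot> (Idn V (Vhom C A B) \<boxtimes> Vid C A) = Run V (Vhom C A B)) \<and>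
    (\<forall>A\<in>Vobj C. \<forall>B\<in>Vobj C. \<forall>B'\<in>Vobj C. \<forall>B''\<in>Vobj C.
      Vcmp C A B B'' \<cdot> (Vcmp C B B' B'' \<boxtimes> Idn V (Vhom C A B))
        = Vcmp C A B' B'' \<cdot> (Idn V (Vhom C B' B'') \<boxtimes> Vcmp C A B B')
            \<cdot> Asc V (Vhom C B' B'') (Vhom C B B') (Vhom C A B))"

definition is_vfunctor ::
  "('a, 'o, 'm) vcat \<Rightarrow> ('b, 'o, 'm) vcat \<Rightarrow> ('a, 'b, 'm) vfun \<Rightarrow> bool"
  where "is_vfunctor C D F \<longleftrightarrow>
    (\<forall>A\<in>Vobj C. Fobj F A \<in> Vobj D) \<and>
    (\<forall>A\<in>Vobj C. \<forall>B\<in>Vobj C. Fhom F A B \<in> hom V (Vhom C A B) (Vhom D (Fobj F A) (Fobj F B))) \<and>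
    (\<forall>A\<in>Vobj C. Fhom F A A \<cdot> Vid C A = Vid D (Fobj F A)) \<and>
    (\<forall>A\<in>Vobj C. \<forall>B\<in>Vobj C. \<forall>B'\<in>Vobj C.
      Fhom F A B' \<cdot> Vcmp C A B B'
        = Vcmp D (Fobj F A) (Fobj F B) (Fobj F B') \<cdot> (Fhom F B B' \<boxtimes> Fhom F A B))"

text \<open>\<open>V\<close> as a category enriched in itself.\<close>

definition self :: "('o, 'o, 'm) vcat"
  where "self = \<lparr>Vobj = Obj V, Vhom = Ihom V,
    Vid = (\<lambda>a. curry_arr \<I> a a (Lun V a)),
    Vcmp = (\<lambda>a b c. curry_arr (Ihom V b c \<otimes> Ihom V a b) a c
      (Evl V b c \<cdot> (Idn V (Ihom V b c) \<boxtimes> Evl V a b) \<cdot> Asc V (Ihom V b c) (Ihom V a b) a))\<rparr>"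

definition vop :: "('a, 'o, 'm) vcat \<Rightarrow> ('a, 'o, 'm) vcat"
  where "vop C = \<lparr>Vobj = Vobj C, Vhom = (\<lambda>A B. Vhom C B A), Vid = Vid C,
    Vcmp = (\<lambda>A B B'. Vcmp C B' B A \<cdot> Sym V (Vhom C B' B) (Vhom C B A))\<rparr>"

definition vtensor ::
  "('a, 'o, 'm) vcat \<Rightarrow> ('b, 'o, 'm) vcat \<Rightarrow> ('a \<times> 'b, 'o, 'm) vcat"
  where "vtensor C D = \<lparr>Vobj = Vobj C \<times> Vobj D,
    Vhom = (\<lambda>X Y. Vhom C (fst X) (fst Y) \<otimes> Vhom D (snd X) (snd Y)),
    Vid = (\<lambda>X. (Vid C (fst X) \<boxtimes> Vid D (snd X)) \<cdot> inv_arr V (Lun V \<I>)),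
    Vcmp = (\<lambda>X Y Z. (Vcmp C (fst X) (fst Y) (fst Z) \<boxtimes> Vcmp D (snd X) (snd Y) (snd Z))
      \<cdot> interchange (Vhom C (fst Y) (fst Z)) (Vhom D (snd Y) (snd Z))
          (Vhom C (fst X) (fst Y)) (Vhom D (snd X) (snd Y)))\<rparr>"

text \<open>The enriched representable \<open>C(A,-) : C \<rightarrow> V\<close>.\<close>

definition representable :: "('a, 'o, 'm) vcat \<Rightarrow> 'a \<Rightarrow> ('a, 'o, 'm) vfun"
  where "representable C A = \<lparr>Fobj = Vhom C A,
    Fhom = (\<lambda>B B'. curry_arr (Vhom C B B') (Vhom C A B) (Vhom C A B') (Vcmp C A B B'))\<rparr>"

text \<open>Composition and isomorphism in the underlying ordinary category of \<open>C\<close>, whose arrows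
  \<open>A \<rightarrow> B\<close> are the arrows \<open>I \<rightarrow> C(A,B)\<close> of \<open>V\<close>.\<close>

definition el_comp :: "('a, 'o, 'm) vcat \<Rightarrow> 'a \<Rightarrow> 'a \<Rightarrow> 'a \<Rightarrow> 'm \<Rightarrow> 'm \<Rightarrow> 'm"
  where "el_comp C A B B' g f = Vcmp C A B B' \<cdot> (g \<boxtimes> f) \<cdot> inv_arr V (Lun V \<I>)"

definition is_iso_el :: "('a, 'o, 'm) vcat \<Rightarrow> 'a \<Rightarrow> 'a \<Rightarrow> 'm \<Rightarrow> bool"
  where "is_iso_el C A B f \<longleftrightarrow> f \<in> hom V \<I> (Vhom C A B) \<and>
    (\<exists>g\<in>hom V \<I> (Vhom C B A).
      el_comp C A B A g f = Vid C A \<and> el_comp C B A B f g = Vid C B)"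

definition isomorphic :: "('a, 'o, 'm) vcat \<Rightarrow> 'a \<Rightarrow> 'a \<Rightarrow> bool"
  where "isomorphic C A B \<longleftrightarrow> A \<in> Vobj C \<and> B \<in> Vobj C \<and> (\<exists>f. is_iso_el C A B f)"

text \<open>A family \<open>p A : x \<rightarrow> D(F A, G A)\<close> that is extraordinarily natural in \<open>A\<close>. A family with
  \<open>x = I\<close> is an enriched natural transformation; a universal one is the end of \<open>D(F A, G A)\<close> over
  \<open>A\<close>, that is, the hom-object from \<open>F\<close> to \<open>G\<close> of the enriched functor category.\<close>

definition nat_family ::
  "('a, 'o, 'm) vcat \<Rightarrow> ('b, 'o, 'm) vcat \<Rightarrow> ('a, 'b, 'm) vfun \<Rightarrow> ('a, 'b, 'm) vfun
    \<Rightarrow> 'o \<Rightarrow> ('a \<Rightarrow> 'm) \<Rightarrow> bool"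
  where "nat_family C D F G x p \<longleftrightarrow> x \<in> Obj V \<and>
    (\<forall>A\<in>Vobj C. p A \<in> hom V x (Vhom D (Fobj F A) (Fobj G A))) \<and>
    (\<forall>A\<in>Vobj C. \<forall>B\<in>Vobj C.
      Vcmp D (Fobj F A) (Fobj G A) (Fobj G B) \<cdot> (Fhom G A B \<boxtimes> p A)
        = Vcmp D (Fobj F A) (Fobj F B) (Fobj G B) \<cdot> (p B \<boxtimes> Fhom F A B) \<cdot> Sym V (Vhom C A B) x)"

definition is_nat_object ::
  "('a, 'o, 'm) vcat \<Rightarrow> ('b, 'o, 'm) vcat \<Rightarrow> ('a, 'b, 'm) vfun \<Rightarrow> ('a, 'b, 'm) vfun
    \<Rightarrow> 'o \<times> ('a \<Rightarrow> 'm) \<Rightarrow> bool"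
  where "is_nat_object C D F G e \<longleftrightarrow> nat_family C D F G (fst e) (snd e) \<and>
    (\<forall>x q. nat_family C D F G x q \<longrightarrow>
      (\<exists>!h. h \<in> hom V x (fst e) \<and> (\<forall>A\<in>Vobj C. snd e A \<cdot> h = q A)))"

definition nat_ob ::
  "('a, 'o, 'm) vcat \<Rightarrow> ('b, 'o, 'm) vcat \<Rightarrow> ('a, 'b, 'm) vfun \<Rightarrow> ('a, 'b, 'm) vfun \<Rightarrow> 'o"
  where "nat_ob C D F G = fst (SOME e. is_nat_object C D F G e)"

definition nat_proj ::
  "('a, 'o, 'm) vcat \<Rightarrow> ('b, 'o, 'm) vcat \<Rightarrow> ('a, 'b, 'm) vfun \<Rightarrow> ('a, 'b, 'm) vfun
    \<Rightarrow> 'a \<Rightarrow> 'm"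
  where "nat_proj C D F G = snd (SOME e. is_nat_object C D F G e)"

text \<open>The arrow \<open>x \<rightarrow> nat_ob C D F G\<close> induced by a natural family \<open>q A : x \<rightarrow> D(F A, G A)\<close>.\<close>

definition nat_lift ::
  "('a, 'o, 'm) vcat \<Rightarrow> ('b, 'o, 'm) vcat \<Rightarrow> ('a, 'b, 'm) vfun \<Rightarrow> ('a, 'b, 'm) vfun
    \<Rightarrow> 'o \<Rightarrow> ('a \<Rightarrow> 'm) \<Rightarrow> 'm"
  where "nat_lift C D F G x q = (THE h. h \<in> hom V x (nat_ob C D F G) \<and>
    (\<forall>A\<in>Vobj C. nat_proj C D F G A \<cdot> h = q A))"

text \<open>The data of the functor category \<open>[C,D]\<close>; the hom-objects are meaningful for those pairs of
  functors for which the end exists.\<close>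

definition functor_cat ::
  "('a, 'o, 'm) vcat \<Rightarrow> ('b, 'o, 'm) vcat \<Rightarrow> (('a, 'b, 'm) vfun, 'o, 'm) vcat"
  where "functor_cat C D = \<lparr>Vobj = {F. is_vfunctor C D F}, Vhom = nat_ob C D,
    Vid = (\<lambda>F. nat_lift C D F F \<I> (\<lambda>A. Vid D (Fobj F A))),
    Vcmp = (\<lambda>F G H. nat_lift C D F H (nat_ob C D G H \<otimes> nat_ob C D F G)
      (\<lambda>A. Vcmp D (Fobj F A) (Fobj G A) (Fobj H A)
        \<cdot> (nat_proj C D G H A \<boxtimes> nat_proj C D F G A)))\<rparr>"

definition nat_isomorphic ::
  "('a, 'o, 'm) vcat \<Rightarrow> ('b, 'o, 'm) vcat \<Rightarrow> ('a, 'b, 'm) vfun \<Rightarrow> ('a, 'b, 'm) vfun \<Rightarrow> bool"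
  where "nat_isomorphic C D F G \<longleftrightarrow> (\<exists>p. nat_family C D F G \<I> p \<and>
    (\<forall>A\<in>Vobj C. is_iso_el D (Fobj F A) (Fobj G A) (p A)))"

definition is_equivalence ::
  "('a, 'o, 'm) vcat \<Rightarrow> ('b, 'o, 'm) vcat \<Rightarrow> ('a, 'b, 'm) vfun \<Rightarrow> bool"
  where "is_equivalence C D P \<longleftrightarrow> is_vfunctor C D P \<and>
    (\<exists>Q. is_vfunctor D C Q \<and> nat_isomorphic C C (vfun_comp V Q P) (vfun_id V C) \<and>
      nat_isomorphic D D (vfun_comp V P Q) (vfun_id V D))"

text \<open>\<open>F \<stileturn> G : D \<rightarrow> C\<close> given by isomorphisms \<open>\<phi> A B : D(F A, B) \<rightarrow> C(A, G B)\<close> in \<open>V\<close>; the last two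
  conjuncts are enriched naturality in \<open>B\<close> and in \<open>A\<close>.\<close>

definition is_vadjunction ::
  "('a, 'o, 'm) vcat \<Rightarrow> ('b, 'o, 'm) vcat \<Rightarrow> ('a, 'b, 'm) vfun \<Rightarrow> ('b, 'a, 'm) vfun
    \<Rightarrow> ('a \<Rightarrow> 'b \<Rightarrow> 'm) \<Rightarrow> bool"
  where "is_vadjunction C D F G \<phi> \<longleftrightarrow> is_vfunctor C D F \<and> is_vfunctor D C G \<and>
    (\<forall>A\<in>Vobj C. \<forall>B\<in>Vobj D.
      \<phi> A B \<in> hom V (Vhom D (Fobj F A) B) (Vhom C A (Fobj G B)) \<and> is_iso V (\<phi> A B)) \<and>
    (\<forall>A\<in>Vobj C. \<forall>B\<in>Vobj D. \<forall>B'\<in>Vobj D.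
      \<phi> A B' \<cdot> Vcmp D (Fobj F A) B B'
        = Vcmp C A (Fobj G B) (Fobj G B') \<cdot> (Fhom G B B' \<boxtimes> \<phi> A B)) \<and>
    (\<forall>A\<in>Vobj C. \<forall>A'\<in>Vobj C. \<forall>B\<in>Vobj D.
      \<phi> A B \<cdot> Vcmp D (Fobj F A) (Fobj F A') B \<cdot> (Idn V (Vhom D (Fobj F A') B) \<boxtimes> Fhom F A A')
        = Vcmp C A A' (Fobj G B) \<cdot> (\<phi> A' B \<boxtimes> Idn V (Vhom C A A')))"

definition is_left_adjoint ::
  "('a, 'o, 'm) vcat \<Rightarrow> ('b, 'o, 'm) vcat \<Rightarrow> ('a, 'b, 'm) vfun \<Rightarrow> ('b, 'a, 'm) vfun \<Rightarrow> bool"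
  where "is_left_adjoint C D F G \<longleftrightarrow> (\<exists>\<phi>. is_vadjunction C D F G \<phi>)"

text \<open>\<open>p\<close> is a power (cotensor) of \<open>c\<close> by \<open>x\<close> with counit \<open>k : x \<rightarrow> C(p,c)\<close>: the comparisons
  \<open>C(A,p) \<rightarrow> [x, C(A,c)]\<close> induced by \<open>k\<close> and composition are isomorphisms in \<open>V\<close>.\<close>

definition is_power ::
  "('a, 'o, 'm) vcat \<Rightarrow> 'o \<Rightarrow> 'a \<Rightarrow> 'a \<Rightarrow> 'm \<Rightarrow> bool"
  where "is_power C x c p k \<longleftrightarrow> x \<in> Obj V \<and> c \<in> Vobj C \<and> p \<in> Vobj C \<and> k \<in> hom V x (Vhom C p c) \<and>
    (\<forall>A\<in>Vobj C. is_iso V (curry_arr (Vhom C A p) x (Vhom C A c)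
      (Vcmp C A p c \<cdot> Sym V (Vhom C A p) (Vhom C p c) \<cdot> (Idn V (Vhom C A p) \<boxtimes> k))))"

definition preserves_powers ::
  "'o set \<Rightarrow> ('a, 'o, 'm) vcat \<Rightarrow> ('b, 'o, 'm) vcat \<Rightarrow> ('a, 'b, 'm) vfun \<Rightarrow> bool"
  where "preserves_powers \<J> C D F \<longleftrightarrow>
    (\<forall>x\<in>\<J>. \<forall>c p k. is_power C x c p k \<longrightarrow>
      is_power D x (Fobj F c) (Fobj F p) (Fhom F p c \<cdot> k))"


section \<open>Theories, algebras and bifold algebras\<close>

definition system_of_arities :: "'o set \<Rightarrow> bool"
  where "system_of_arities \<J> \<longleftrightarrow> \<J> \<subseteq> Obj V \<and> \<I> \<in> \<J> \<and> (\<forall>a\<in>\<J>. \<forall>b\<in>\<J>. a \<otimes> b \<in> \<J>)"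

definition is_theory :: "'o set \<Rightarrow> ('o, 'o, 'm) vcat \<Rightarrow> ('o, 'o, 'm) vfun \<Rightarrow> bool"
  where "is_theory \<J> T \<tau> \<longleftrightarrow> is_vcat T \<and> Vobj T = \<J> \<and>
    is_vfunctor (vop (full_sub self \<J>)) T \<tau> \<and> (\<forall>a\<in>\<J>. Fobj \<tau> a = a) \<and>
    preserves_powers \<J> (vop (full_sub self \<J>)) T \<tau>"

definition is_algebra :: "'o set \<Rightarrow> ('o, 'o, 'm) vcat \<Rightarrow> ('o, 'o, 'm) vfun \<Rightarrow> bool"
  where "is_algebra \<J> T A \<longleftrightarrow> is_vfunctor T self A \<and> preserves_powers \<J> T self A"

definition Alg :: "'o set \<Rightarrow> ('o, 'o, 'm) vcat \<Rightarrow> (('o, 'o, 'm) vfun, 'o, 'm) vcat"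
  where "Alg \<J> T = full_sub (functor_cat T self) {A. is_algebra \<J> T A}"

definition forget :: "'o set \<Rightarrow> ('o, 'o, 'm) vcat \<Rightarrow> (('o, 'o, 'm) vfun, 'o, 'm) vfun"
  where "forget \<J> T =
    \<lparr>Fobj = (\<lambda>A. Fobj A \<I>), Fhom = (\<lambda>A B. nat_proj T self A B \<I>)\<rparr>"

text \<open>\<open>T-Alg\<close> exists as an enriched category if all the ends defining its hom-objects exist in \<open>V\<close>.\<close>

definition amenable :: "'o set \<Rightarrow> bool"
  where "amenable \<J> \<longleftrightarrow> (\<forall>T \<tau>. is_theory \<J> T \<tau> \<longrightarrow>
    (\<forall>A B. is_algebra \<J> T A \<and> is_algebra \<J> T B \<longrightarrow> (\<exists>e. is_nat_object T self A B e)) \<and>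
    (\<exists>F. is_left_adjoint self (Alg \<J> T) F (forget \<J> T)))"

text \<open>\<open>D(-,K) : T \<rightarrow> V\<close> and \<open>D(J,-) : U \<rightarrow> V\<close> for \<open>D : T \<otimes> U \<rightarrow> V\<close>.\<close>

definition fix_right ::
  "('a, 'o, 'm) vcat \<Rightarrow> ('b, 'o, 'm) vcat \<Rightarrow> ('a \<times> 'b, 'o, 'm) vfun \<Rightarrow> 'b \<Rightarrow> ('a, 'o, 'm) vfun"
  where "fix_right T U D K = \<lparr>Fobj = (\<lambda>J. Fobj D (J, K)),
    Fhom = (\<lambda>J J'. Fhom D (J, K) (J', K)
      \<cdot> (Idn V (Vhom T J J') \<boxtimes> Vid U K) \<cdot> inv_arr V (Run V (Vhom T J J')))\<rparr>"

definition fix_left ::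
  "('a, 'o, 'm) vcat \<Rightarrow> ('b, 'o, 'm) vcat \<Rightarrow> ('a \<times> 'b, 'o, 'm) vfun \<Rightarrow> 'a \<Rightarrow> ('b, 'o, 'm) vfun"
  where "fix_left T U D J = \<lparr>Fobj = (\<lambda>K. Fobj D (J, K)),
    Fhom = (\<lambda>K K'. Fhom D (J, K) (J, K')
      \<cdot> (Vid T J \<boxtimes> Idn V (Vhom U K K')) \<cdot> inv_arr V (Lun V (Vhom U K K')))\<rparr>"

definition is_bialgebra ::
  "'o set \<Rightarrow> ('o, 'o, 'm) vcat \<Rightarrow> ('o, 'o, 'm) vcat \<Rightarrow> ('o \<times> 'o, 'o, 'm) vfun \<Rightarrow> bool"
  where "is_bialgebra \<J> T U D \<longleftrightarrow> is_vfunctor (vtensor T U) self D \<and>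
    (\<forall>K\<in>Vobj U. preserves_powers \<J> T self (fix_right T U D K)) \<and>
    (\<forall>J\<in>Vobj T. preserves_powers \<J> U self (fix_left T U D J))"

definition is_bifold_algebra ::
  "'o set \<Rightarrow> ('o, 'o, 'm) vcat \<Rightarrow> ('o, 'o, 'm) vfun \<Rightarrow> ('o, 'o, 'm) vcat \<Rightarrow> ('o, 'o, 'm) vfun
    \<Rightarrow> ('o \<times> 'o, 'o, 'm) vfun \<Rightarrow> bool"
  where "is_bifold_algebra \<J> T \<tau> U \<upsilon> D \<longleftrightarrow>
    is_theory \<J> T \<tau> \<and> is_theory \<J> U \<upsilon> \<and> is_bialgebra \<J> T U D"

definition left_face ::
  "('o, 'o, 'm) vcat \<Rightarrow> ('o, 'o, 'm) vcat \<Rightarrow> ('o \<times> 'o, 'o, 'm) vfun \<Rightarrow> ('o, 'o, 'm) vfun"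
  where "left_face T U D = fix_right T U D \<I>"

definition right_face ::
  "('o, 'o, 'm) vcat \<Rightarrow> ('o, 'o, 'm) vcat \<Rightarrow> ('o \<times> 'o, 'o, 'm) vfun \<Rightarrow> ('o, 'o, 'm) vfun"
  where "right_face T U D = fix_left T U D \<I>"


section \<open>The dualization adjunction\<close>

text \<open>The transposes \<open>K \<mapsto> D(-,K) : U \<rightarrow> T-Alg\<close> and \<open>J \<mapsto> D(J,-) : T \<rightarrow> U-Alg\<close> of \<open>D\<close>.\<close>

definition right_transpose ::
  "('o, 'o, 'm) vcat \<Rightarrow> ('o, 'o, 'm) vcat \<Rightarrow> ('o \<times> 'o, 'o, 'm) vfun
    \<Rightarrow> ('o, ('o, 'o, 'm) vfun, 'm) vfun"
  where "right_transpose T U D = \<lparr>Fobj = fix_right T U D,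
    Fhom = (\<lambda>K K'. nat_lift T self (fix_right T U D K) (fix_right T U D K') (Vhom U K K')
      (\<lambda>J. Fhom (fix_left T U D J) K K'))\<rparr>"

definition left_transpose ::
  "('o, 'o, 'm) vcat \<Rightarrow> ('o, 'o, 'm) vcat \<Rightarrow> ('o \<times> 'o, 'o, 'm) vfun
    \<Rightarrow> ('o, ('o, 'o, 'm) vfun, 'm) vfun"
  where "left_transpose T U D = \<lparr>Fobj = fix_left T U D,
    Fhom = (\<lambda>J J'. nat_lift U self (fix_left T U D J) (fix_left T U D J') (Vhom T J J')
      (\<lambda>K. Fhom (fix_right T U D K) J J'))\<rparr>"

text \<open>For \<open>Y : U \<rightarrow> T-Alg\<close>, the functor \<open>T-Alg\<^sup>o\<^sup>p \<rightarrow> U-Alg\<close> given by \<open>A \<mapsto> T-Alg(A, Y -)\<close>. Its action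
  \<open>T-Alg(A',A) \<rightarrow> U-Alg(T-Alg(A, Y -), T-Alg(A', Y -))\<close> is induced by that of the contravariant
  representables \<open>T-Alg(-, Y K)\<close>.\<close>

definition hom_into ::
  "'o set \<Rightarrow> ('o, 'o, 'm) vcat \<Rightarrow> ('o, 'o, 'm) vcat \<Rightarrow> ('o, ('o, 'o, 'm) vfun, 'm) vfun
    \<Rightarrow> (('o, 'o, 'm) vfun, ('o, 'o, 'm) vfun, 'm) vfun"
  where "hom_into \<J> T U Y = \<lparr>Fobj = (\<lambda>A. vfun_comp V (representable (Alg \<J> T) A) Y),
    Fhom = (\<lambda>A A'. nat_lift U self (vfun_comp V (representable (Alg \<J> T) A) Y)
      (vfun_comp V (representable (Alg \<J> T) A') Y) (Vhom (Alg \<J> T) A' A)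
      (\<lambda>K. Fhom (representable (vop (Alg \<J> T)) (Fobj Y K)) A A'))\<rparr>"

text \<open>\<open>Hom\<^sub>T(-,D) : T-Alg\<^sup>o\<^sup>p \<rightarrow> U-Alg\<close> and \<open>Hom\<^sub>U(-,D) : U-Alg \<rightarrow> T-Alg\<^sup>o\<^sup>p\<close>.\<close>

definition Hom_left ::
  "'o set \<Rightarrow> ('o, 'o, 'm) vcat \<Rightarrow> ('o, 'o, 'm) vcat \<Rightarrow> ('o \<times> 'o, 'o, 'm) vfun
    \<Rightarrow> (('o, 'o, 'm) vfun, ('o, 'o, 'm) vfun, 'm) vfun"
  where "Hom_left \<J> T U D = hom_into \<J> T U (right_transpose T U D)"

definition Hom_right ::
  "'o set \<Rightarrow> ('o, 'o, 'm) vcat \<Rightarrow> ('o, 'o, 'm) vcat \<Rightarrow> ('o \<times> 'o, 'o, 'm) vfun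
    \<Rightarrow> (('o, 'o, 'm) vfun, ('o, 'o, 'm) vfun, 'm) vfun"
  where "Hom_right \<J> T U D = vfun_op (hom_into \<J> U T (left_transpose T U D))"

text \<open>The canonical isomorphism \<open>T-Alg(A, Hom\<^sub>U(B,D)) \<rightarrow> U-Alg(B, Hom\<^sub>T(A,D))\<close>: the unique arrow
  compatible with the two families of projections \<open>e \<otimes> A J \<otimes> B K \<rightarrow> D(J,K)\<close> that exhibit both sides as
  the end of \<open>V(A J \<otimes> B K, D(J,K))\<close> over \<open>J\<close> and \<open>K\<close>.\<close>

definition dualization_iso ::
  "'o set \<Rightarrow> ('o, 'o, 'm) vcat \<Rightarrow> ('o, 'o, 'm) vcat \<Rightarrow> ('o \<times> 'o, 'o, 'm) vfun
    \<Rightarrow> ('o, 'o, 'm) vfun \<Rightarrow> ('o, 'o, 'm) vfun \<Rightarrow> 'm"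
  where "dualization_iso \<J> T U D B A =
    (let A_dual = Fobj (Hom_left \<J> T U D) A;
         B_dual = Fobj (Hom_right \<J> T U D) B;
         e = Vhom (Alg \<J> T) A B_dual
     in THE h. h \<in> hom V e (Vhom (Alg \<J> U) B A_dual) \<and>
       (\<forall>J\<in>Vobj T. \<forall>K\<in>Vobj U.
         uncurry_arr (Fobj B K) (Fobj D (J, K))
           (nat_proj U self B (fix_left T U D J) K
             \<cdot> uncurry_arr (Fobj A J) (Fobj B_dual J) (nat_proj T self A B_dual J))
         = uncurry_arr (Fobj A J) (Fobj D (J, K))
             (nat_proj T self A (fix_right T U D K) J
               \<cdot> uncurry_arr (Fobj B K) (Fobj A_dual K) (nat_proj U self B A_dual K \<cdot> h))
           \<cdot> swap_right e (Fobj A J) (Fobj B K)))"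

end

text \<open>The data of a dual adjunction \<open>\<nabla> \<stileturn> \<Delta> : A\<^sup>o\<^sup>p \<rightarrow> B\<close> between enriched categories over \<open>V\<close>, with
  isomorphisms \<open>Dadj Y X : A(X, \<nabla> Y) \<rightarrow> B(Y, \<Delta> X)\<close>.\<close>

record ('a, 'b, 'o, 'm) dual_adj =
  Lcat :: "('a, 'o, 'm) vcat"
  Lfun :: "('a, 'o, 'm) vfun"
  Rcat :: "('b, 'o, 'm) vcat"
  Rfun :: "('b, 'o, 'm) vfun"
  Nabla :: "('b, 'a, 'm) vfun"
  Delta :: "('a, 'b, 'm) vfun"
  Dadj :: "'b \<Rightarrow> 'a \<Rightarrow> 'm"

context symmetric_monoidal_closed
begin

definition is_algebraic :: "'o set \<Rightarrow> ('a, 'o, 'm) vcat \<Rightarrow> ('a, 'o, 'm) vfun \<Rightarrow> bool"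
  where "is_algebraic \<J> A G \<longleftrightarrow> is_vcat A \<and> is_vfunctor A self G \<and>
    (\<exists>T \<tau> P. is_theory \<J> T \<tau> \<and> is_equivalence A (Alg \<J> T) P \<and>
      nat_isomorphic A self (vfun_comp V (forget \<J> T) P) G)"

definition is_algebraic_dual_adjunction :: "'o set \<Rightarrow> ('a, 'b, 'o, 'm) dual_adj \<Rightarrow> bool"
  where "is_algebraic_dual_adjunction \<J> \<D> \<longleftrightarrow>
    is_algebraic \<J> (Lcat \<D>) (Lfun \<D>) \<and> is_algebraic \<J> (Rcat \<D>) (Rfun \<D>) \<and>
    is_vadjunction (Rcat \<D>) (vop (Lcat \<D>)) (Nabla \<D>) (Delta \<D>) (Dadj \<D>)"

text \<open>The dualizers, relative to a choice of left adjoints \<open>F\<^sub>r\<close> of \<open>Rfun \<D>\<close> and \<open>F\<^sub>l\<close> of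
  \<open>Lfun \<D>\<close>.\<close>

definition left_dualizer :: "('a, 'b, 'o, 'm) dual_adj \<Rightarrow> ('o, 'b, 'm) vfun \<Rightarrow> 'a"
  where "left_dualizer \<D> Fr = Fobj (Nabla \<D>) (Fobj Fr \<I>)"

definition right_dualizer :: "('a, 'b, 'o, 'm) dual_adj \<Rightarrow> ('o, 'a, 'm) vfun \<Rightarrow> 'b"
  where "right_dualizer \<D> Fl = Fobj (Delta \<D>) (Fobj Fl \<I>)"

definition Dualn ::
  "'o set \<Rightarrow> ('o, 'o, 'm) vcat \<Rightarrow> ('o, 'o, 'm) vcat \<Rightarrow> ('o \<times> 'o, 'o, 'm) vfun
    \<Rightarrow> (('o, 'o, 'm) vfun, ('o, 'o, 'm) vfun, 'o, 'm) dual_adj"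
  where "Dualn \<J> T U D = \<lparr>Lcat = Alg \<J> T, Lfun = forget \<J> T,
    Rcat = Alg \<J> U, Rfun = forget \<J> U,
    Nabla = Hom_right \<J> T U D, Delta = Hom_left \<J> T U D,
    Dadj = dualization_iso \<J> T U D\<rparr>"

end

end

theory Submission
  imports Defs
begin

text \<open>The free \<open>U\<close>-algebra \<open>F I\<close> on the unit represents the forgetful functor:
  \<open>U-Alg(F I, B) \<cong> [I, B I] \<cong> B I\<close>, \<open>V\<close>-naturally in \<open>B\<close>. Applied to \<open>B = D(J,-)\<close> this gives isomorphisms
  \<open>U-Alg(F I, D(J,-)) \<cong> D(J,I)\<close> from the left dualizer to the left face, natural in \<open>J\<close>; the right hand
  side is symmetric. Rather than proving that \<open>U-Alg\<close> is a \<open>V\<close>-category and the dualizer a composite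
  \<open>V\<close>-functor, we use these isomorphisms to transport functoriality and preservation of powers from the
  face to the dualizer. Naturality is checked on the transposed actions \<open>C(A,B) \<otimes> F A \<rightarrow> F B\<close>.\<close>

text \<open>Being isomorphic in \<open>Alg \<J> T\<close> includes being an object of it, while the
  dualizer is at first only a record assembled with choice operators: its values are chosen ends and
  its actions go through lifts into such ends. These are accessible only through the projections, so
  each lift must first be shown to come from a natural family. About the free algebra on the unit
  nothing is known beyond its adjunction, since any left adjoint is allowed; the isomorphism is
  therefore built from the components of the adjunction at the unit. A single statement about an
  abstract family of algebras yields both dualizers, with the two theories exchanged. The coherence
  lemmas serve the partial functors D(-,K) and D(J,-). An arrow in one variable becomes an arrow of
  the tensor product only after an identity is inserted through a unit constraint, and composing
  such arrows produces the middle-four interchange with units in two of its four places. Collapsing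
  it takes consequences of the pentagon, triangle and hexagon that the axioms do not state
  directly.\<close>

section \<open>Coherence in monoidal categories\<close>

context category
begin

lemma hom_iff: "f \<in> hom C a b \<longleftrightarrow> f \<in> Arr C \<and> Dom C f = a \<and> Cod C f = b"
  by (simp add: hom_def)

lemma Dom_in_Obj [simp]: "f \<in> Arr C \<Longrightarrow> Dom C f \<in> Obj C"
  by (rule dom_obj)

lemma Cod_in_Obj [simp]: "f \<in> Arr C \<Longrightarrow> Cod C f \<in> Obj C"
  by (rule cod_obj)

lemma Idn_typing [simp]:
  assumes "a \<in> Obj C"
  shows "Idn C a \<in> Arr C" "Dom C (Idn C a) = a" "Cod C (Idn C a) = a"
  using idn_hom[OF assms] by (simp_all add: hom_iff)

lemma cmp_typing [simp]:
  assumes "f \<in> Arr C" "g \<in> Arr C" "Dom C g = Cod C f"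
  shows "g \<cdot> f \<in> Arr C" "Dom C (g \<cdot> f) = Dom C f" "Cod C (g \<cdot> f) = Cod C g"
  using cmp_hom[of f "Dom C f" "Cod C f" g "Cod C g"] assms by (simp_all add: hom_iff)

lemma Idn_cmp [simp]: "f \<in> Arr C \<Longrightarrow> Cod C f = b \<Longrightarrow> Idn C b \<cdot> f = f"
  using idn_cmp[of f "Dom C f" b] by (simp add: hom_iff)

lemma cmp_Idn [simp]: "f \<in> Arr C \<Longrightarrow> Dom C f = a \<Longrightarrow> f \<cdot> Idn C a = f"
  using cmp_idn[of f a "Cod C f"] by (simp add: hom_iff)

lemma assoc [simp]:
  "f \<in> Arr C \<Longrightarrow> g \<in> Arr C \<Longrightarrow> h \<in> Arr C \<Longrightarrow> Dom C g = Cod C f \<Longrightarrow> Dom C h = Cod C g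
    \<Longrightarrow> (h \<cdot> g) \<cdot> f = h \<cdot> g \<cdot> f"
  using cmp_assoc[of f "Dom C f" "Cod C f" g "Cod C g" h "Cod C h"] by (simp add: hom_iff)

lemma reassoc:
  assumes "h \<cdot> g = k"
    and "f \<in> Arr C" "g \<in> Arr C" "h \<in> Arr C" "Dom C g = Cod C f" "Dom C h = Cod C g"
  shows "h \<cdot> g \<cdot> f = k \<cdot> f"
  using assms by auto

lemma inverse_arrows_unique:
  assumes "inverse_arrows C f g" "inverse_arrows C f h"
  shows "g = h"
proof -
  have "g = g \<cdot> f \<cdot> h"
    using assms by (simp add: inverse_arrows_def hom_iff)
  also have "\<dots> = (g \<cdot> f) \<cdot> h"
    using assms by (intro assoc[symmetric]) (simp_all add: inverse_arrows_def hom_iff)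
  also have "\<dots> = h"
    using assms by (simp add: inverse_arrows_def hom_iff)
  finally show ?thesis .
qed

lemma inverse_arrows_inv_arr: "is_iso C f \<Longrightarrow> inverse_arrows C f (inv_arr C f)"
  unfolding inv_arr_def is_iso_def by (metis inverse_arrows_unique theI)

lemma iso_typing: "is_iso C f \<Longrightarrow> f \<in> Arr C"
  by (simp add: is_iso_def inverse_arrows_def)

lemma inv_arr_simps [simp]:
  assumes "is_iso C f"
  shows "inv_arr C f \<in> Arr C" "Dom C (inv_arr C f) = Cod C f" "Cod C (inv_arr C f) = Dom C f"
    "inv_arr C f \<cdot> f = Idn C (Dom C f)" "f \<cdot> inv_arr C f = Idn C (Cod C f)"
  using inverse_arrows_inv_arr[OF assms] by (simp_all add: inverse_arrows_def hom_iff)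

lemma inv_arr_cancel [simp]:
  assumes "is_iso C f" "g \<in> Arr C"
  shows "Cod C g = Dom C f \<Longrightarrow> inv_arr C f \<cdot> f \<cdot> g = g"
    "Cod C g = Cod C f \<Longrightarrow> f \<cdot> inv_arr C f \<cdot> g = g"
  using assms iso_typing[OF assms(1)] by (simp_all add: assoc[symmetric] del: assoc)

lemma is_isoI:
  "f \<in> hom C a b \<Longrightarrow> g \<in> hom C b a \<Longrightarrow> g \<cdot> f = Idn C a \<Longrightarrow> f \<cdot> g = Idn C b \<Longrightarrow> is_iso C f"
  by (auto simp: is_iso_def inverse_arrows_def hom_iff)

lemma is_iso_inv_arr [simp]: "is_iso C f \<Longrightarrow> is_iso C (inv_arr C f)"
  using iso_typing[of f]
  by (intro is_isoI[where g = f and a = "Cod C f" and b = "Dom C f"]) (simp_all add: hom_iff)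

lemma is_iso_cmp:
  assumes "is_iso C f" "is_iso C g" "Dom C g = Cod C f"
  shows "is_iso C (g \<cdot> f)"
  using assms iso_typing[of f] iso_typing[of g]
  by (intro is_isoI[where g = "inv_arr C f \<cdot> inv_arr C g" and a = "Dom C f" and b = "Cod C g"])
    (simp_all add: hom_iff)

lemma iso_left_cancel:
  assumes "f \<cdot> g = f \<cdot> h" "is_iso C f" "g \<in> Arr C" "h \<in> Arr C" "Cod C g = Dom C f" "Cod C h = Dom C f"
  shows "g = h"
  using assms inv_arr_cancel(1)[of f] by metis

lemma iso_right_cancel:
  assumes "g \<cdot> f = h \<cdot> f" "is_iso C f" "g \<in> Arr C" "h \<in> Arr C" "Dom C g = Cod C f" "Dom C h = Cod C f"
  shows "g = h"
proof -
  have "(g \<cdot> f) \<cdot> inv_arr C f = (h \<cdot> f) \<cdot> inv_arr C f"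
    using assms(1) by simp
  then show ?thesis
    using assms(2-) iso_typing[of f] by simp
qed

end

section \<open>Unit constraints against the associator\<close>

context monoidal_category
begin

lemma Unit_in_Obj [simp]: "\<I> \<in> Obj V"
  by (rule unit_obj)

lemma ten_in_Obj [simp]: "a \<in> Obj V \<Longrightarrow> b \<in> Obj V \<Longrightarrow> a \<otimes> b \<in> Obj V"
  by (rule ten_obj)

lemma ten_typing [simp]:
  assumes "f \<in> Arr V" "g \<in> Arr V"
  shows "f \<boxtimes> g \<in> Arr V" "Dom V (f \<boxtimes> g) = Dom V f \<otimes> Dom V g"
    "Cod V (f \<boxtimes> g) = Cod V f \<otimes> Cod V g"
  using ten_hom[of f "Dom V f" "Cod V f" g "Dom V g" "Cod V g"] assms by (simp_all add: hom_iff)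

lemma ten_Idn [simp]: "a \<in> Obj V \<Longrightarrow> b \<in> Obj V \<Longrightarrow> Idn V a \<boxtimes> Idn V b = Idn V (a \<otimes> b)"
  by (rule ten_idn)

lemma cmp_ten [simp]:
  assumes "f \<in> Arr V" "g \<in> Arr V" "f' \<in> Arr V" "g' \<in> Arr V" "Dom V g = Cod V f" "Dom V g' = Cod V f'"
  shows "(g \<boxtimes> g') \<cdot> (f \<boxtimes> f') = (g \<cdot> f) \<boxtimes> (g' \<cdot> f')"
  using ten_cmp[of f "Dom V f" "Cod V f" g "Cod V g" f' "Dom V f'" "Cod V f'" g' "Cod V g'"] assms
  by (simp add: hom_iff)

lemma cmp_ten_reassoc [simp]:
  assumes "f \<in> Arr V" "g \<in> Arr V" "f' \<in> Arr V" "g' \<in> Arr V" "Dom V g = Cod V f" "Dom V g' = Cod V f'"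
    "h \<in> Arr V" "Cod V h = Dom V f \<otimes> Dom V f'"
  shows "(g \<boxtimes> g') \<cdot> (f \<boxtimes> f') \<cdot> h = ((g \<cdot> f) \<boxtimes> (g' \<cdot> f')) \<cdot> h"
  using assms by (intro reassoc) simp_all

lemma is_iso_ten [simp]:
  assumes "is_iso V f" "is_iso V g"
  shows "is_iso V (f \<boxtimes> g)"
  using assms iso_typing[of f] iso_typing[of g]
  by (intro is_isoI[where g = "inv_arr V f \<boxtimes> inv_arr V g" and a = "Dom V f \<otimes> Dom V g"
        and b = "Cod V f \<otimes> Cod V g"]) (simp_all add: hom_iff)

lemma is_iso_Idn [simp]: "a \<in> Obj V \<Longrightarrow> is_iso V (Idn V a)"
  by (intro is_isoI[where g = "Idn V a" and a = a and b = a]) (simp_all add: hom_iff)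

lemma Asc_typing [simp]:
  assumes "a \<in> Obj V" "b \<in> Obj V" "c \<in> Obj V"
  shows "Asc V a b c \<in> Arr V" "Dom V (Asc V a b c) = a \<otimes> b \<otimes> c" "Cod V (Asc V a b c) = a \<otimes> (b \<otimes> c)"
    "is_iso V (Asc V a b c)"
  using asc_hom[OF assms] asc_iso[OF assms] by (simp_all add: hom_iff)

lemma Lun_typing [simp]:
  assumes "a \<in> Obj V"
  shows "Lun V a \<in> Arr V" "Dom V (Lun V a) = \<I> \<otimes> a" "Cod V (Lun V a) = a" "is_iso V (Lun V a)"
  using lun_hom[OF assms] lun_iso[OF assms] by (simp_all add: hom_iff)

lemma Run_typing [simp]:
  assumes "a \<in> Obj V"
  shows "Run V a \<in> Arr V" "Dom V (Run V a) = a \<otimes> \<I>" "Cod V (Run V a) = a" "is_iso V (Run V a)"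
  using run_hom[OF assms] run_iso[OF assms] by (simp_all add: hom_iff)

lemma Asc_nat:
  assumes "f \<in> hom V a a'" "g \<in> hom V b b'" "h \<in> hom V c c'"
  shows "Asc V a' b' c' \<cdot> (f \<boxtimes> g \<boxtimes> h) = (f \<boxtimes> (g \<boxtimes> h)) \<cdot> Asc V a b c"
    "k \<in> Arr V \<Longrightarrow> Cod V k = a \<otimes> b \<otimes> c \<Longrightarrow>
      Asc V a' b' c' \<cdot> (f \<boxtimes> g \<boxtimes> h) \<cdot> k = (f \<boxtimes> (g \<boxtimes> h)) \<cdot> Asc V a b c \<cdot> k"
proof -
  show *: "Asc V a' b' c' \<cdot> (f \<boxtimes> g \<boxtimes> h) = (f \<boxtimes> (g \<boxtimes> h)) \<cdot> Asc V a b c"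
    using asc_nat[OF assms] .
  have "a \<in> Obj V" "b \<in> Obj V" "c \<in> Obj V" "a' \<in> Obj V" "b' \<in> Obj V" "c' \<in> Obj V"
    using assms Dom_in_Obj Cod_in_Obj unfolding hom_iff by blast+
  then show "Asc V a' b' c' \<cdot> (f \<boxtimes> g \<boxtimes> h) \<cdot> k = (f \<boxtimes> (g \<boxtimes> h)) \<cdot> Asc V a b c \<cdot> k"
    if "k \<in> Arr V" "Cod V k = a \<otimes> b \<otimes> c"
    using reassoc[OF *, of k] assms that by (simp add: hom_iff)
qed

lemma inv_Asc_nat:
  assumes "f \<in> hom V a a'" "g \<in> hom V b b'" "h \<in> hom V c c'"
  shows "inv_arr V (Asc V a' b' c') \<cdot> (f \<boxtimes> (g \<boxtimes> h)) = (f \<boxtimes> g \<boxtimes> h) \<cdot> inv_arr V (Asc V a b c)"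
proof -
  have o: "a \<in> Obj V" "b \<in> Obj V" "c \<in> Obj V" "a' \<in> Obj V" "b' \<in> Obj V" "c' \<in> Obj V"
    using assms Dom_in_Obj Cod_in_Obj unfolding hom_iff by blast+
  show ?thesis
    by (rule iso_left_cancel[of "Asc V a' b' c'"])
      (use assms o in \<open>simp_all add: hom_iff Asc_nat(2)[OF assms]\<close>)
qed

text \<open>Naturality of \<open>Run\<close> exhibits f tensored with I as a conjugate of f by
  isomorphisms. Tensoring with I is thus faithful, so a coherence equation may be checked after
  adding a factor I, which gives the pentagon room to act.\<close>

lemma ten_Unit_inject:
  assumes "f \<boxtimes> Idn V \<I> = g \<boxtimes> Idn V \<I>" "f \<in> hom V a b" "g \<in> hom V a b"
  shows "f = g"
proof -
  have "a \<in> Obj V" "b \<in> Obj V"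
    using assms Dom_in_Obj Cod_in_Obj unfolding hom_iff by blast+
  moreover have "f \<cdot> Run V a = g \<cdot> Run V a"
    using run_nat[OF assms(2)] run_nat[OF assms(3)] assms(1) by simp
  ultimately show ?thesis
    using assms by (intro iso_right_cancel[of f "Run V a" g]) (simp_all add: hom_iff)
qed

lemma Unit_ten_inject:
  assumes "Idn V \<I> \<boxtimes> f = Idn V \<I> \<boxtimes> g" "f \<in> hom V a b" "g \<in> hom V a b"
  shows "f = g"
proof -
  have "a \<in> Obj V" "b \<in> Obj V"
    using assms Dom_in_Obj Cod_in_Obj unfolding hom_iff by blast+
  moreover have "f \<cdot> Lun V a = g \<cdot> Lun V a"
    using lun_nat[OF assms(2)] lun_nat[OF assms(3)] assms(1) by simp
  ultimately show ?thesis
    using assms by (intro iso_right_cancel[of f "Lun V a" g]) (simp_all add: hom_iff)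
qed

text \<open>Kelly's derivation: after tensoring with I on the left, the pentagon at I, I, a, b and
  the triangle axiom, used once with a tensor b and once with a, identify the two sides up to an
  invertible arrow.\<close>

lemma Lun_ten:
  assumes [simp]: "a \<in> Obj V" "b \<in> Obj V"
  shows "Lun V (a \<otimes> b) \<cdot> Asc V \<I> a b = Lun V a \<boxtimes> Idn V b"
proof (rule Unit_ten_inject)
  \<comment> \<open>The part of the three-step side of the pentagon that precedes the associator in
    the claim; it is invertible and is cancelled at the end.\<close>
  let ?P = "Asc V \<I> (\<I> \<otimes> a) b \<cdot> (Asc V \<I> \<I> a \<boxtimes> Idn V b)"
  have "(Idn V \<I> \<boxtimes> (Lun V (a \<otimes> b) \<cdot> Asc V \<I> a b)) \<cdot> ?P
      = (Idn V \<I> \<boxtimes> Lun V (a \<otimes> b)) \<cdot> (Idn V \<I> \<boxtimes> Asc V \<I> a b) \<cdot> ?P"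
    by simp
  also have "\<dots> = (Idn V \<I> \<boxtimes> Lun V (a \<otimes> b)) \<cdot> Asc V \<I> \<I> (a \<otimes> b) \<cdot> Asc V (\<I> \<otimes> \<I>) a b"
    by (simp add: pentagon)
  also have "\<dots> = (Run V \<I> \<boxtimes> (Idn V a \<boxtimes> Idn V b)) \<cdot> Asc V (\<I> \<otimes> \<I>) a b"
    using reassoc[OF triangle[of \<I> "a \<otimes> b"]] by simp
  also have "\<dots> = Asc V \<I> a b \<cdot> (Run V \<I> \<boxtimes> Idn V a \<boxtimes> Idn V b)"
    by (rule Asc_nat(1)[symmetric]) (simp_all add: hom_iff)
  also have "\<dots> = Asc V \<I> a b \<cdot> (Idn V \<I> \<boxtimes> Lun V a \<boxtimes> Idn V b) \<cdot> (Asc V \<I> \<I> a \<boxtimes> Idn V b)"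
    by (simp add: triangle)
  also have "\<dots> = (Idn V \<I> \<boxtimes> (Lun V a \<boxtimes> Idn V b)) \<cdot> ?P"
    by (rule Asc_nat(2)) (simp_all add: hom_iff)
  finally show "Idn V \<I> \<boxtimes> (Lun V (a \<otimes> b) \<cdot> Asc V \<I> a b) = Idn V \<I> \<boxtimes> (Lun V a \<boxtimes> Idn V b)"
    by (rule iso_right_cancel) (simp_all add: is_iso_cmp)
qed (simp_all add: hom_iff)

text \<open>Mirror image of \<open>Lun_ten\<close>: the extra factor I is on the right, the pentagon
  is taken at a, b, I, I, and the arrow to be cancelled is an associator on the left.\<close>

lemma Run_ten:
  assumes [simp]: "a \<in> Obj V" "b \<in> Obj V"
  shows "(Idn V a \<boxtimes> Run V b) \<cdot> Asc V a b \<I> = Run V (a \<otimes> b)"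
proof (rule ten_Unit_inject)
  have "Asc V a b \<I> \<cdot> (((Idn V a \<boxtimes> Run V b) \<cdot> Asc V a b \<I>) \<boxtimes> Idn V \<I>)
      = Asc V a b \<I> \<cdot> (Idn V a \<boxtimes> Run V b \<boxtimes> Idn V \<I>) \<cdot> (Asc V a b \<I> \<boxtimes> Idn V \<I>)"
    by simp
  also have "\<dots> = (Idn V a \<boxtimes> (Run V b \<boxtimes> Idn V \<I>)) \<cdot> Asc V a (b \<otimes> \<I>) \<I> \<cdot> (Asc V a b \<I> \<boxtimes> Idn V \<I>)"
    by (rule Asc_nat(2)) (simp_all add: hom_iff)
  also have "\<dots> = (Idn V a \<boxtimes> (Idn V b \<boxtimes> Lun V \<I>)) \<cdot> (Idn V a \<boxtimes> Asc V b \<I> \<I>)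
      \<cdot> Asc V a (b \<otimes> \<I>) \<I> \<cdot> (Asc V a b \<I> \<boxtimes> Idn V \<I>)"
    by (simp add: triangle)
  also have "\<dots> = (Idn V a \<boxtimes> (Idn V b \<boxtimes> Lun V \<I>)) \<cdot> Asc V a b (\<I> \<otimes> \<I>) \<cdot> Asc V (a \<otimes> b) \<I> \<I>"
    by (simp only: pentagon assms Unit_in_Obj)
  also have "\<dots> = Asc V a b \<I> \<cdot> (Idn V a \<boxtimes> Idn V b \<boxtimes> Lun V \<I>) \<cdot> Asc V (a \<otimes> b) \<I> \<I>"
    by (rule Asc_nat(2)[symmetric]) (simp_all add: hom_iff)
  also have "\<dots> = Asc V a b \<I> \<cdot> (Run V (a \<otimes> b) \<boxtimes> Idn V \<I>)"
    by (simp add: triangle)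
  finally show "((Idn V a \<boxtimes> Run V b) \<cdot> Asc V a b \<I>) \<boxtimes> Idn V \<I> = Run V (a \<otimes> b) \<boxtimes> Idn V \<I>"
    by (rule iso_left_cancel) simp_all
qed (simp_all add: hom_iff)

text \<open>Naturality of \<open>Lun\<close> at the arrow \<open>Lun V \<I>\<close> identifies the
  left constraint of I tensor I with I tensored with \<open>Lun V \<I>\<close>. Then
  \<open>Lun_ten\<close> and the triangle at I, I have equal left-hand sides.\<close>

lemma Lun_Unit: "Lun V \<I> = Run V \<I>"
proof (rule ten_Unit_inject)
  have "Lun V \<I> \<cdot> (Idn V \<I> \<boxtimes> Lun V \<I>) = Lun V \<I> \<cdot> Lun V (\<I> \<otimes> \<I>)"
    by (rule lun_nat) (simp add: hom_iff)
  then have "Idn V \<I> \<boxtimes> Lun V \<I> = Lun V (\<I> \<otimes> \<I>)"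
    by (rule iso_left_cancel) simp_all
  then show "Lun V \<I> \<boxtimes> Idn V \<I> = Run V \<I> \<boxtimes> Idn V \<I>"
    using Lun_ten[of \<I> \<I>] triangle[of \<I> \<I>] by simp
qed (simp_all add: hom_iff)

lemma inv_Lun_nat:
  assumes "f \<in> hom V a b"
  shows "(Idn V \<I> \<boxtimes> f) \<cdot> inv_arr V (Lun V a) = inv_arr V (Lun V b) \<cdot> f"
proof -
  have o: "a \<in> Obj V" "b \<in> Obj V"
    using assms Dom_in_Obj Cod_in_Obj unfolding hom_iff by blast+
  show ?thesis
    by (rule iso_left_cancel[of "Lun V b"])
      (use assms o reassoc[OF lun_nat[OF assms]] in \<open>simp_all add: hom_iff\<close>)
qed

lemma inv_Run_nat:
  assumes "f \<in> hom V a b"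
  shows "(f \<boxtimes> Idn V \<I>) \<cdot> inv_arr V (Run V a) = inv_arr V (Run V b) \<cdot> f"
proof -
  have o: "a \<in> Obj V" "b \<in> Obj V"
    using assms Dom_in_Obj Cod_in_Obj unfolding hom_iff by blast+
  show ?thesis
    by (rule iso_left_cancel[of "Run V b"])
      (use assms o reassoc[OF run_nat[OF assms]] in \<open>simp_all add: hom_iff\<close>)
qed

end

context symmetric_monoidal_category
begin

lemma Sym_typing [simp]:
  assumes "a \<in> Obj V" "b \<in> Obj V"
  shows "Sym V a b \<in> Arr V" "Dom V (Sym V a b) = a \<otimes> b" "Cod V (Sym V a b) = b \<otimes> a"
    "Sym V b a \<cdot> Sym V a b = Idn V (a \<otimes> b)" "is_iso V (Sym V a b)"
proof -
  show "is_iso V (Sym V a b)"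
    by (rule is_isoI[OF sym_hom sym_hom]) (use assms in \<open>simp_all add: sym_sym\<close>)
qed (use sym_hom[OF assms] sym_sym[OF assms] in \<open>simp_all add: hom_iff\<close>)

lemma Run_Sym:
  assumes [simp]: "a \<in> Obj V"
  shows "Run V a \<cdot> Sym V \<I> a = Lun V a"
proof -
  have "Run V a \<cdot> Sym V \<I> a = (Lun V a \<cdot> Sym V a \<I>) \<cdot> Sym V \<I> a"
    by (simp only: sym_unit assms)
  also have "\<dots> = Lun V a"
    by simp
  finally show ?thesis .
qed

end

section \<open>Middle-four interchange at unit objects\<close>

context symmetric_monoidal_closed
begin

lemma swap_right_typing [simp]:
  assumes "a \<in> Obj V" "b \<in> Obj V" "c \<in> Obj V"
  shows "swap_right a b c \<in> Arr V" "Dom V (swap_right a b c) = a \<otimes> b \<otimes> c"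
    "Cod V (swap_right a b c) = a \<otimes> c \<otimes> b"
  using assms by (simp_all add: swap_right_def)

lemma interchange_typing [simp]:
  assumes "a \<in> Obj V" "b \<in> Obj V" "c \<in> Obj V" "d \<in> Obj V"
  shows "interchange a b c d \<in> Arr V" "Dom V (interchange a b c d) = (a \<otimes> b) \<otimes> (c \<otimes> d)"
    "Cod V (interchange a b c d) = (a \<otimes> c) \<otimes> (b \<otimes> d)"
  using assms by (simp_all add: interchange_def)

lemma swap_right_nat:
  assumes "f \<in> hom V a a'" "g \<in> hom V b b'" "h \<in> hom V c c'"
  shows "swap_right a' b' c' \<cdot> (f \<boxtimes> g \<boxtimes> h) = (f \<boxtimes> h \<boxtimes> g) \<cdot> swap_right a b c"
proof -
  have o [simp]: "a \<in> Obj V" "b \<in> Obj V" "c \<in> Obj V" "a' \<in> Obj V" "b' \<in> Obj V" "c' \<in> Obj V"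
    using assms Dom_in_Obj Cod_in_Obj unfolding hom_iff by blast+
  have t [simp]: "f \<in> Arr V" "Dom V f = a" "Cod V f = a'" "g \<in> Arr V" "Dom V g = b" "Cod V g = b'"
    "h \<in> Arr V" "Dom V h = c" "Cod V h = c'"
    using assms by (simp_all add: hom_iff)
  have "swap_right a' b' c' \<cdot> (f \<boxtimes> g \<boxtimes> h)
      = inv_arr V (Asc V a' c' b') \<cdot> (f \<boxtimes> (Sym V b' c' \<cdot> (g \<boxtimes> h))) \<cdot> Asc V a b c"
    by (simp add: swap_right_def Asc_nat[OF assms])
  also have "\<dots> = inv_arr V (Asc V a' c' b') \<cdot> (f \<boxtimes> (h \<boxtimes> g)) \<cdot> (Idn V a \<boxtimes> Sym V b c) \<cdot> Asc V a b c"
    by (simp add: sym_nat[OF assms(2,3)])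
  also have "\<dots> = (f \<boxtimes> h \<boxtimes> g) \<cdot> swap_right a b c"
    by (subst reassoc[OF inv_Asc_nat[OF assms(1,3,2)]]) (simp_all add: swap_right_def)
  finally show ?thesis .
qed

lemma interchange_nat:
  assumes "f \<in> hom V a a'" "g \<in> hom V b b'" "h \<in> hom V c c'" "k \<in> hom V d d'"
  shows "interchange a' b' c' d' \<cdot> ((f \<boxtimes> g) \<boxtimes> (h \<boxtimes> k))
    = ((f \<boxtimes> h) \<boxtimes> (g \<boxtimes> k)) \<cdot> interchange a b c d"
proof -
  have o [simp]: "a \<in> Obj V" "b \<in> Obj V" "c \<in> Obj V" "a' \<in> Obj V" "b' \<in> Obj V" "c' \<in> Obj V"
    "d \<in> Obj V" "d' \<in> Obj V"
    using assms Dom_in_Obj Cod_in_Obj unfolding hom_iff by blast+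
  have t [simp]: "f \<in> Arr V" "Dom V f = a" "Cod V f = a'" "g \<in> Arr V" "Dom V g = b" "Cod V g = b'"
    "h \<in> Arr V" "Dom V h = c" "Cod V h = c'" "k \<in> Arr V" "Dom V k = d" "Cod V k = d'"
    using assms by (simp_all add: hom_iff)
  have "interchange a' b' c' d' \<cdot> ((f \<boxtimes> g) \<boxtimes> (h \<boxtimes> k))
      = Asc V (a' \<otimes> c') b' d' \<cdot> (swap_right a' b' c' \<boxtimes> Idn V d')
        \<cdot> (f \<boxtimes> g \<boxtimes> h \<boxtimes> k) \<cdot> inv_arr V (Asc V (a \<otimes> b) c d)"
    using inv_Asc_nat[of "f \<boxtimes> g" "a \<otimes> b" "a' \<otimes> b'" h c c' k d d']
    by (simp add: interchange_def hom_iff)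
  also have "\<dots> = Asc V (a' \<otimes> c') b' d' \<cdot> (f \<boxtimes> h \<boxtimes> g \<boxtimes> k)
      \<cdot> (swap_right a b c \<boxtimes> Idn V d) \<cdot> inv_arr V (Asc V (a \<otimes> b) c d)"
    by (simp add: swap_right_nat[OF assms(1-3)])
  also have "\<dots> = ((f \<boxtimes> h) \<boxtimes> (g \<boxtimes> k)) \<cdot> interchange a b c d"
    by (subst Asc_nat(2)) (simp_all add: interchange_def hom_iff)
  finally show ?thesis .
qed

text \<open>By \<open>Run_ten\<close> the right constraint acts on c tensor I alone, where it
  absorbs the symmetry by \<open>Run_Sym\<close>; the triangle finishes.\<close>

lemma Run_swap_right:
  assumes [simp]: "a \<in> Obj V" "c \<in> Obj V"
  shows "Run V (a \<otimes> c) \<cdot> swap_right a \<I> c = Run V a \<boxtimes> Idn V c"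
proof -
  have "Run V (a \<otimes> c) \<cdot> swap_right a \<I> c
      = (Idn V a \<boxtimes> Run V c) \<cdot> (Idn V a \<boxtimes> Sym V \<I> c) \<cdot> Asc V a \<I> c"
    by (simp add: swap_right_def Run_ten[symmetric])
  also have "\<dots> = Run V a \<boxtimes> Idn V c"
    by (simp add: Run_Sym triangle)
  finally show ?thesis .
qed

lemma Lun_swap_right:
  assumes [simp]: "b \<in> Obj V" "c \<in> Obj V"
  shows "(Lun V c \<boxtimes> Idn V b) \<cdot> swap_right \<I> b c = Sym V b c \<cdot> (Lun V b \<boxtimes> Idn V c)"
proof -
  have "(Lun V c \<boxtimes> Idn V b) \<cdot> swap_right \<I> b c
      = Lun V (c \<otimes> b) \<cdot> (Idn V \<I> \<boxtimes> Sym V b c) \<cdot> Asc V \<I> b c"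
    by (simp add: swap_right_def Lun_ten[symmetric])
  also have "\<dots> = Sym V b c \<cdot> Lun V (b \<otimes> c) \<cdot> Asc V \<I> b c"
    by (subst reassoc[OF lun_nat[OF sym_hom]]) simp_all
  finally show ?thesis
    by (simp add: Lun_ten)
qed

text \<open>The triangle turns the left constraint at d into a right constraint at a tensor c, which
  absorbs the inner swap by \<open>Run_swap_right\<close>. Only a reassociation remains.\<close>

lemma Lun_right_interchange:
  assumes [simp]: "a \<in> Obj V" "c \<in> Obj V" "d \<in> Obj V"
  shows "(Idn V (a \<otimes> c) \<boxtimes> Lun V d) \<cdot> interchange a \<I> c d
    = inv_arr V (Asc V a c d) \<cdot> (Run V a \<boxtimes> Idn V (c \<otimes> d))"
proof -
  have "(Idn V (a \<otimes> c) \<boxtimes> Lun V d) \<cdot> interchange a \<I> c d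
      = ((Run V (a \<otimes> c) \<boxtimes> Idn V d) \<cdot> (swap_right a \<I> c \<boxtimes> Idn V d))
        \<cdot> inv_arr V (Asc V (a \<otimes> \<I>) c d)"
    by (simp add: interchange_def reassoc[OF triangle[of "a \<otimes> c" d]] del: ten_Idn)
  also have "\<dots> = (Run V a \<boxtimes> Idn V c \<boxtimes> Idn V d) \<cdot> inv_arr V (Asc V (a \<otimes> \<I>) c d)"
    by (simp add: Run_swap_right)
  also have "\<dots> = inv_arr V (Asc V a c d) \<cdot> (Run V a \<boxtimes> (Idn V c \<boxtimes> Idn V d))"
    by (rule inv_Asc_nat[symmetric]) (simp_all add: hom_iff)
  finally show ?thesis
    by simp
qed

text \<open>Here the unit is in front, so removing it does not undo the swap: b still has to pass c,
  and \<open>Sym V b c\<close> survives from \<open>Lun_swap_right\<close>.\<close>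

lemma Lun_left_interchange:
  assumes [simp]: "b \<in> Obj V" "c \<in> Obj V" "d \<in> Obj V"
  shows "(Lun V c \<boxtimes> Idn V (b \<otimes> d)) \<cdot> interchange \<I> b c d
    = Asc V c b d \<cdot> (Sym V b c \<boxtimes> Idn V d) \<cdot> inv_arr V (Asc V b c d) \<cdot> (Lun V b \<boxtimes> Idn V (c \<otimes> d))"
proof -
  have "(Lun V c \<boxtimes> Idn V (b \<otimes> d)) \<cdot> interchange \<I> b c d
      = (Lun V c \<boxtimes> (Idn V b \<boxtimes> Idn V d)) \<cdot> Asc V (\<I> \<otimes> c) b d \<cdot> (swap_right \<I> b c \<boxtimes> Idn V d)
        \<cdot> inv_arr V (Asc V (\<I> \<otimes> b) c d)"
    by (simp add: interchange_def)
  also have "\<dots> = Asc V c b d \<cdot> (Lun V c \<boxtimes> Idn V b \<boxtimes> Idn V d) \<cdot> (swap_right \<I> b c \<boxtimes> Idn V d)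
        \<cdot> inv_arr V (Asc V (\<I> \<otimes> b) c d)"
    by (rule Asc_nat(2)[symmetric]) (simp_all add: hom_iff)
  also have "\<dots> = Asc V c b d \<cdot> (Sym V b c \<boxtimes> Idn V d) \<cdot> (Lun V b \<boxtimes> Idn V c \<boxtimes> Idn V d)
        \<cdot> inv_arr V (Asc V (\<I> \<otimes> b) c d)"
    by (simp add: Lun_swap_right)
  also have "(Lun V b \<boxtimes> Idn V c \<boxtimes> Idn V d) \<cdot> inv_arr V (Asc V (\<I> \<otimes> b) c d)
      = inv_arr V (Asc V b c d) \<cdot> (Lun V b \<boxtimes> (Idn V c \<boxtimes> Idn V d))"
    by (rule inv_Asc_nat[symmetric]) (simp_all add: hom_iff)
  finally show ?thesis
    by simp
qed

lemma Run_inv_Asc: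
  assumes [simp]: "a \<in> Obj V" "b \<in> Obj V"
  shows "Run V (a \<otimes> b) \<cdot> inv_arr V (Asc V a b \<I>) = Idn V a \<boxtimes> Run V b"
    "(Run V a \<boxtimes> Idn V b) \<cdot> inv_arr V (Asc V a \<I> b) = Idn V a \<boxtimes> Lun V b"
  by (simp_all flip: Run_ten triangle)

text \<open>First of four cases with two units among the arguments. They arise from composing two
  arrows in the first variable of a bifunctor, two in the second, one in the first after one in the
  second, and the reverse. Only the last case leaves a symmetry.\<close>

lemma interchange_Run_Run:
  assumes [simp]: "a \<in> Obj V" "c \<in> Obj V"
  shows "Run V (a \<otimes> c) \<cdot> (Idn V (a \<otimes> c) \<boxtimes> Lun V \<I>) \<cdot> interchange a \<I> c \<I> = Run V a \<boxtimes> Run V c"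
  by (simp add: Lun_right_interchange reassoc[OF Run_inv_Asc(1)])

lemma interchange_Lun_Lun:
  assumes [simp]: "b \<in> Obj V" "d \<in> Obj V"
  shows "Lun V (b \<otimes> d) \<cdot> (Lun V \<I> \<boxtimes> Idn V (b \<otimes> d)) \<cdot> interchange \<I> b \<I> d = Lun V b \<boxtimes> Lun V d"
  by (simp add: Lun_left_interchange reassoc[OF Lun_ten] sym_unit reassoc[OF Run_inv_Asc(2)])

lemma interchange_Run_Lun:
  assumes [simp]: "a \<in> Obj V" "d \<in> Obj V"
  shows "(Run V a \<boxtimes> Lun V d) \<cdot> interchange a \<I> \<I> d = Run V a \<boxtimes> Lun V d"
proof -
  have "(Run V a \<boxtimes> Lun V d) \<cdot> interchange a \<I> \<I> d
      = (Run V a \<boxtimes> Idn V d) \<cdot> (Idn V (a \<otimes> \<I>) \<boxtimes> Lun V d) \<cdot> interchange a \<I> \<I> d"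
    by simp
  also have "\<dots> = (Run V a \<boxtimes> Idn V d) \<cdot> inv_arr V (Asc V a \<I> d) \<cdot> (Run V a \<boxtimes> Idn V (\<I> \<otimes> d))"
    by (simp only: Lun_right_interchange assms Unit_in_Obj)
  also have "\<dots> = Run V a \<boxtimes> Lun V d"
    by (simp add: reassoc[OF Run_inv_Asc(2)])
  finally show ?thesis .
qed

lemma interchange_Lun_Run:
  assumes [simp]: "b \<in> Obj V" "c \<in> Obj V"
  shows "(Lun V c \<boxtimes> Run V b) \<cdot> interchange \<I> b c \<I> = Sym V b c \<cdot> (Lun V b \<boxtimes> Run V c)"
proof -
  have "(Lun V c \<boxtimes> Run V b) \<cdot> interchange \<I> b c \<I>
      = (Idn V c \<boxtimes> Run V b) \<cdot> (Lun V c \<boxtimes> Idn V (b \<otimes> \<I>)) \<cdot> interchange \<I> b c \<I>"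
    by simp
  also have "\<dots> = Run V (c \<otimes> b) \<cdot> (Sym V b c \<boxtimes> Idn V \<I>) \<cdot> inv_arr V (Asc V b c \<I>)
      \<cdot> (Lun V b \<boxtimes> Idn V (c \<otimes> \<I>))"
    by (simp only: Lun_left_interchange assms Unit_in_Obj) (simp add: reassoc[OF Run_ten])
  also have "\<dots> = Sym V b c \<cdot> Run V (b \<otimes> c) \<cdot> inv_arr V (Asc V b c \<I>) \<cdot> (Lun V b \<boxtimes> Idn V (c \<otimes> \<I>))"
    by (subst reassoc[OF run_nat[OF sym_hom]]) simp_all
  also have "\<dots> = Sym V b c \<cdot> (Lun V b \<boxtimes> Run V c)"
    by (simp add: reassoc[OF Run_inv_Asc(1)])
  finally show ?thesis .
qed

end


section \<open>Functors into the base and their natural families\<close>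

context symmetric_monoidal_closed
begin

lemma Ihom_in_Obj [simp]: "a \<in> Obj V \<Longrightarrow> b \<in> Obj V \<Longrightarrow> Ihom V a b \<in> Obj V"
  by (rule ihom_obj)

lemma Evl_typing [simp]:
  assumes "a \<in> Obj V" "b \<in> Obj V"
  shows "Evl V a b \<in> Arr V" "Dom V (Evl V a b) = Ihom V a b \<otimes> a" "Cod V (Evl V a b) = b"
  using evl_hom[OF assms] by (simp_all add: hom_iff)

lemma uncurry_arr_typing [simp]:
  assumes "a \<in> Obj V" "b \<in> Obj V" "g \<in> Arr V" "Cod V g = Ihom V a b"
  shows "uncurry_arr a b g \<in> Arr V" "Dom V (uncurry_arr a b g) = Dom V g \<otimes> a"
    "Cod V (uncurry_arr a b g) = b"
  using assms by (simp_all add: uncurry_arr_def)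

lemma curry_arr_props:
  assumes "x \<in> Obj V" "a \<in> Obj V" "b \<in> Obj V" "f \<in> hom V (x \<otimes> a) b"
  shows "curry_arr x a b f \<in> hom V x (Ihom V a b) \<and> uncurry_arr a b (curry_arr x a b f) = f"
  unfolding curry_arr_def uncurry_arr_def by (rule theI') (rule evl_univ[OF assms])

lemma curry_arr_simps [simp]:
  assumes "f \<in> Arr V" "Dom V f = x \<otimes> a" "Cod V f = b" "x \<in> Obj V" "a \<in> Obj V"
  shows "curry_arr x a b f \<in> Arr V" "Dom V (curry_arr x a b f) = x"
    "Cod V (curry_arr x a b f) = Ihom V a b" "uncurry_arr a b (curry_arr x a b f) = f"
  using curry_arr_props[of x a b f] assms Cod_in_Obj[of f] by (simp_all add: hom_iff)

lemma uncurry_arr_inject: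
  assumes "uncurry_arr a b f = uncurry_arr a b g" "f \<in> hom V x (Ihom V a b)" "g \<in> hom V x (Ihom V a b)"
    "a \<in> Obj V" "b \<in> Obj V"
  shows "f = g"
proof -
  have "x \<in> Obj V"
    using assms(2) Dom_in_Obj unfolding hom_iff by blast
  then have "uncurry_arr a b f \<in> hom V (x \<otimes> a) b"
    using assms by (simp add: hom_iff)
  then show ?thesis
    using evl_univ[of x a b "uncurry_arr a b f"] assms \<open>x \<in> Obj V\<close>
    unfolding uncurry_arr_def by metis
qed

lemma uncurry_arr_eq_iff:
  assumes "f \<in> hom V x (Ihom V a b)" "g \<in> hom V x (Ihom V a b)" "a \<in> Obj V" "b \<in> Obj V"
  shows "f = g \<longleftrightarrow> uncurry_arr a b f = uncurry_arr a b g"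
  using uncurry_arr_inject[OF _ assms] by blast

lemma uncurry_arr_cmp:
  assumes "a \<in> Obj V" "b \<in> Obj V" "g \<in> Arr V" "Cod V g = Ihom V a b" "h \<in> Arr V" "Cod V h = Dom V g"
  shows "uncurry_arr a b (g \<cdot> h) = uncurry_arr a b g \<cdot> (h \<boxtimes> Idn V a)"
  using assms by (simp add: uncurry_arr_def)

lemma self_simps [simp]:
  "Vobj self = Obj V" "Vhom self = Ihom V"
  by (simp_all add: self_def)

lemma Vid_self_typing [simp]:
  assumes "a \<in> Obj V"
  shows "Vid self a \<in> Arr V" "Dom V (Vid self a) = \<I>" "Cod V (Vid self a) = Ihom V a a"
    "uncurry_arr a a (Vid self a) = Lun V a"
  using assms by (simp_all add: self_def)

lemma Vcmp_self_typing [simp]: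
  assumes "a \<in> Obj V" "b \<in> Obj V" "c \<in> Obj V"
  shows "Vcmp self a b c \<in> Arr V" "Dom V (Vcmp self a b c) = Ihom V b c \<otimes> Ihom V a b"
    "Cod V (Vcmp self a b c) = Ihom V a c"
    "uncurry_arr a c (Vcmp self a b c)
      = Evl V b c \<cdot> (Idn V (Ihom V b c) \<boxtimes> Evl V a b) \<cdot> Asc V (Ihom V b c) (Ihom V a b) a"
  using assms by (simp_all add: self_def)

text \<open>Under transposition, composition in \<open>self\<close> becomes composition of the
  ordinary arrows y \<otimes> b -> c and x \<otimes> a -> b, up to an associator. Checks about
  internal homs thereby reduce to equations between arrows of V.\<close>

lemma uncurry_Vcmp_self:
  assumes "a \<in> Obj V" "b \<in> Obj V" "c \<in> Obj V" "g \<in> hom V y (Ihom V b c)" "f \<in> hom V x (Ihom V a b)"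
  shows "uncurry_arr a c (Vcmp self a b c \<cdot> (g \<boxtimes> f))
    = uncurry_arr b c g \<cdot> (Idn V y \<boxtimes> uncurry_arr a b f) \<cdot> Asc V y x a"
proof -
  have o [simp]: "y \<in> Obj V" "x \<in> Obj V"
    using assms Dom_in_Obj unfolding hom_iff by blast+
  have "uncurry_arr a c (Vcmp self a b c \<cdot> (g \<boxtimes> f))
      = Evl V b c \<cdot> (Idn V (Ihom V b c) \<boxtimes> Evl V a b) \<cdot> Asc V (Ihom V b c) (Ihom V a b) a
        \<cdot> (g \<boxtimes> f \<boxtimes> Idn V a)"
    using assms by (simp add: uncurry_arr_cmp hom_iff)
  also have "Asc V (Ihom V b c) (Ihom V a b) a \<cdot> (g \<boxtimes> f \<boxtimes> Idn V a)
      = (g \<boxtimes> (f \<boxtimes> Idn V a)) \<cdot> Asc V y x a"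
    using assms by (intro Asc_nat(1)) (simp_all add: hom_iff)
  finally show ?thesis
    using assms by (simp add: uncurry_arr_def hom_iff)
qed

lemma is_vcat_typing [simp]:
  assumes "is_vcat C" "A \<in> Vobj C"
  shows "Vid C A \<in> Arr V" "Dom V (Vid C A) = \<I>" "Cod V (Vid C A) = Vhom C A A"
    "B \<in> Vobj C \<Longrightarrow> Vhom C A B \<in> Obj V"
    "B \<in> Vobj C \<Longrightarrow> B' \<in> Vobj C \<Longrightarrow> Vcmp C A B B' \<in> Arr V"
    "B \<in> Vobj C \<Longrightarrow> B' \<in> Vobj C \<Longrightarrow> Dom V (Vcmp C A B B') = Vhom C B B' \<otimes> Vhom C A B"
    "B \<in> Vobj C \<Longrightarrow> B' \<in> Vobj C \<Longrightarrow> Cod V (Vcmp C A B B') = Vhom C A B'"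
  using assms unfolding is_vcat_def hom_iff by blast+

lemma is_vfunctor_typing:
  assumes "is_vfunctor C D F" "A \<in> Vobj C"
  shows "Fobj F A \<in> Vobj D"
    "B \<in> Vobj C \<Longrightarrow> Fhom F A B \<in> Arr V" "B \<in> Vobj C \<Longrightarrow> Dom V (Fhom F A B) = Vhom C A B"
    "B \<in> Vobj C \<Longrightarrow> Cod V (Fhom F A B) = Vhom D (Fobj F A) (Fobj F B)"
  using assms unfolding is_vfunctor_def hom_iff by blast+

text \<open>Both transposes apply f, then g, then h; they differ in bracketing only, and the
  pentagon at z, y, x, a reconciles them. Stating it for generalized elements f, g, h avoids
  expanding composites of hom-arrows later.\<close>

lemma Vcmp_self_assoc:
  assumes "a \<in> Obj V" "b \<in> Obj V" "c \<in> Obj V" "d \<in> Obj V"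
    and "h \<in> hom V z (Ihom V c d)" "g \<in> hom V y (Ihom V b c)" "f \<in> hom V x (Ihom V a b)"
  shows "Vcmp self a b d \<cdot> ((Vcmp self b c d \<cdot> (h \<boxtimes> g)) \<boxtimes> f)
    = Vcmp self a c d \<cdot> (h \<boxtimes> (Vcmp self a b c \<cdot> (g \<boxtimes> f))) \<cdot> Asc V z y x"
    (is "?L = ?R")
proof (rule uncurry_arr_inject)
  have [simp]: "x \<in> Obj V" "y \<in> Obj V" "z \<in> Obj V"
    using assms Dom_in_Obj unfolding hom_iff by blast+
  note [simp] = assms(1-4)
  have [simp]: "h \<in> Arr V" "Dom V h = z" "Cod V h = Ihom V c d" "g \<in> Arr V" "Dom V g = y"
    "Cod V g = Ihom V b c" "f \<in> Arr V" "Dom V f = x" "Cod V f = Ihom V a b"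
    using assms by (simp_all add: hom_iff)
  let ?h = "uncurry_arr c d h" and ?g = "uncurry_arr b c g" and ?f = "uncurry_arr a b f"
  have "uncurry_arr a d ?L = uncurry_arr b d (Vcmp self b c d \<cdot> (h \<boxtimes> g))
      \<cdot> (Idn V (z \<otimes> y) \<boxtimes> ?f) \<cdot> Asc V (z \<otimes> y) x a"
    by (rule uncurry_Vcmp_self) (simp_all add: hom_iff)
  also have "uncurry_arr b d (Vcmp self b c d \<cdot> (h \<boxtimes> g)) = ?h \<cdot> (Idn V z \<boxtimes> ?g) \<cdot> Asc V z y b"
    by (rule uncurry_Vcmp_self) (simp_all add: hom_iff)
  also have "(?h \<cdot> (Idn V z \<boxtimes> ?g) \<cdot> Asc V z y b) \<cdot> (Idn V (z \<otimes> y) \<boxtimes> ?f) \<cdot> Asc V (z \<otimes> y) x a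
      = ?h \<cdot> (Idn V z \<boxtimes> ?g) \<cdot> Asc V z y b \<cdot> (Idn V z \<boxtimes> Idn V y \<boxtimes> ?f) \<cdot> Asc V (z \<otimes> y) x a"
    by simp
  also have "\<dots> = ?h \<cdot> (Idn V z \<boxtimes> ?g) \<cdot> (Idn V z \<boxtimes> (Idn V y \<boxtimes> ?f)) \<cdot> Asc V z y (x \<otimes> a) \<cdot> Asc V (z \<otimes> y) x a"
    by (subst Asc_nat(2)[of "Idn V z" z z "Idn V y" y y ?f "x \<otimes> a" b]) (simp_all add: hom_iff)
  also have "\<dots> = (?h \<cdot> (Idn V z \<boxtimes> (?g \<cdot> (Idn V y \<boxtimes> ?f) \<cdot> Asc V y x a)) \<cdot> Asc V z (y \<otimes> x) a)
      \<cdot> (Asc V z y x \<boxtimes> Idn V a)"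
    by (simp add: pentagon)
  also have "?g \<cdot> (Idn V y \<boxtimes> ?f) \<cdot> Asc V y x a = uncurry_arr a c (Vcmp self a b c \<cdot> (g \<boxtimes> f))"
    by (rule uncurry_Vcmp_self[symmetric]) (simp_all add: hom_iff)
  also have "?h \<cdot> (Idn V z \<boxtimes> uncurry_arr a c (Vcmp self a b c \<cdot> (g \<boxtimes> f))) \<cdot> Asc V z (y \<otimes> x) a
      = uncurry_arr a d (Vcmp self a c d \<cdot> (h \<boxtimes> (Vcmp self a b c \<cdot> (g \<boxtimes> f))))"
    by (rule uncurry_Vcmp_self[symmetric]) (simp_all add: hom_iff)
  also have "\<dots> \<cdot> (Asc V z y x \<boxtimes> Idn V a) = uncurry_arr a d ?R"
    by (subst uncurry_arr_cmp[symmetric]) simp_all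
  finally show "uncurry_arr a d ?L = uncurry_arr a d ?R" .
  show "?L \<in> hom V ((z \<otimes> y) \<otimes> x) (Ihom V a d)" "?R \<in> hom V ((z \<otimes> y) \<otimes> x) (Ihom V a d)"
    by (simp_all add: hom_iff)
qed (use assms in simp_all)

abbreviation action :: "('a, 'o, 'm) vfun \<Rightarrow> 'a \<Rightarrow> 'a \<Rightarrow> 'm"
  where "action F A B \<equiv> uncurry_arr (Fobj F A) (Fobj F B) (Fhom F A B)"

text \<open>The transposed laws are the unit and associativity axioms of a left action of C. Only
  typing of F is assumed, so the criterion can both extract the laws of a known functor and
  establish those of a record not yet known to be one.\<close>

lemma vfunctor_self_iff:
  assumes C: "is_vcat C"
    and o: "\<And>A. A \<in> Vobj C \<Longrightarrow> Fobj F A \<in> Obj V"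
    and h: "\<And>A B. A \<in> Vobj C \<Longrightarrow> B \<in> Vobj C \<Longrightarrow> Fhom F A B \<in> hom V (Vhom C A B) (Ihom V (Fobj F A) (Fobj F B))"
  shows "is_vfunctor C self F \<longleftrightarrow>
    (\<forall>A\<in>Vobj C. action F A A \<cdot> (Vid C A \<boxtimes> Idn V (Fobj F A)) = Lun V (Fobj F A)) \<and>
    (\<forall>A\<in>Vobj C. \<forall>B\<in>Vobj C. \<forall>B'\<in>Vobj C.
      action F A B' \<cdot> (Vcmp C A B B' \<boxtimes> Idn V (Fobj F A))
        = action F B B' \<cdot> (Idn V (Vhom C B B') \<boxtimes> action F A B)
          \<cdot> Asc V (Vhom C B B') (Vhom C A B) (Fobj F A))"
proof -
  have h' [simp]: "Fhom F A B \<in> Arr V" "Dom V (Fhom F A B) = Vhom C A B"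
    "Cod V (Fhom F A B) = Ihom V (Fobj F A) (Fobj F B)" if "A \<in> Vobj C" "B \<in> Vobj C" for A B
    using h[OF that] by (simp_all add: hom_iff)
  note [simp] = o C
  have "Fhom F A A \<cdot> Vid C A = Vid self (Fobj F A) \<longleftrightarrow>
      action F A A \<cdot> (Vid C A \<boxtimes> Idn V (Fobj F A)) = Lun V (Fobj F A)"
    if [simp]: "A \<in> Vobj C" for A
  proof -
    have eq: "action F A A \<cdot> (Vid C A \<boxtimes> Idn V (Fobj F A)) = uncurry_arr (Fobj F A) (Fobj F A) (Fhom F A A \<cdot> Vid C A)"
      by (subst uncurry_arr_cmp) simp_all
    have Lun: "Lun V (Fobj F A) = uncurry_arr (Fobj F A) (Fobj F A) (Vid self (Fobj F A))"
      by simp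
    show ?thesis
      unfolding eq Lun by (rule uncurry_arr_eq_iff[where x = \<I>]) (simp_all add: hom_iff)
  qed
  moreover have "(Fhom F A B' \<cdot> Vcmp C A B B'
        = Vcmp self (Fobj F A) (Fobj F B) (Fobj F B') \<cdot> (Fhom F B B' \<boxtimes> Fhom F A B)) \<longleftrightarrow>
      action F A B' \<cdot> (Vcmp C A B B' \<boxtimes> Idn V (Fobj F A))
        = action F B B' \<cdot> (Idn V (Vhom C B B') \<boxtimes> action F A B)
          \<cdot> Asc V (Vhom C B B') (Vhom C A B) (Fobj F A)" (is "?l = ?r \<longleftrightarrow> ?ul = ?ur")
    if [simp]: "A \<in> Vobj C" "B \<in> Vobj C" "B' \<in> Vobj C" for A B B'
  proof -
    have ul: "?ul = uncurry_arr (Fobj F A) (Fobj F B') ?l"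
      by (subst uncurry_arr_cmp) simp_all
    have ur: "?ur = uncurry_arr (Fobj F A) (Fobj F B') ?r"
      by (rule uncurry_Vcmp_self[symmetric]) (simp_all add: h)
    show ?thesis
      unfolding ul ur by (rule uncurry_arr_eq_iff) (simp_all add: hom_iff)
  qed
  ultimately show ?thesis
    unfolding is_vfunctor_def using h by simp
qed

text \<open>Transposed, extraordinary naturality says that the arrows x \<otimes> F A -> G A commute
  with the two actions; the symmetry moves C(A,B) past the parameter x.\<close>

lemma nat_family_self_iff:
  assumes C: "is_vcat C" and F: "is_vfunctor C self F" and G: "is_vfunctor C self G"
    and x: "x \<in> Obj V" and p: "\<And>A. A \<in> Vobj C \<Longrightarrow> p A \<in> hom V x (Ihom V (Fobj F A) (Fobj G A))"
  shows "nat_family C self F G x p \<longleftrightarrow> (\<forall>A\<in>Vobj C. \<forall>B\<in>Vobj C.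
    action G A B \<cdot> (Idn V (Vhom C A B) \<boxtimes> uncurry_arr (Fobj F A) (Fobj G A) (p A))
        \<cdot> Asc V (Vhom C A B) x (Fobj F A)
      = uncurry_arr (Fobj F B) (Fobj G B) (p B) \<cdot> (Idn V x \<boxtimes> action F A B)
        \<cdot> Asc V x (Vhom C A B) (Fobj F A) \<cdot> (Sym V (Vhom C A B) x \<boxtimes> Idn V (Fobj F A)))"
proof -
  have p' [simp]: "p A \<in> Arr V" "Dom V (p A) = x" "Cod V (p A) = Ihom V (Fobj F A) (Fobj G A)"
    if "A \<in> Vobj C" for A
    using p[OF that] by (simp_all add: hom_iff)
  note [simp] = is_vfunctor_typing[OF F, simplified] is_vfunctor_typing[OF G, simplified] C x
  have "(Vcmp self (Fobj F A) (Fobj G A) (Fobj G B) \<cdot> (Fhom G A B \<boxtimes> p A)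
        = Vcmp self (Fobj F A) (Fobj F B) (Fobj G B) \<cdot> (p B \<boxtimes> Fhom F A B) \<cdot> Sym V (Vhom C A B) x)
    \<longleftrightarrow> action G A B \<cdot> (Idn V (Vhom C A B) \<boxtimes> uncurry_arr (Fobj F A) (Fobj G A) (p A))
        \<cdot> Asc V (Vhom C A B) x (Fobj F A)
      = uncurry_arr (Fobj F B) (Fobj G B) (p B) \<cdot> (Idn V x \<boxtimes> action F A B)
        \<cdot> Asc V x (Vhom C A B) (Fobj F A) \<cdot> (Sym V (Vhom C A B) x \<boxtimes> Idn V (Fobj F A))"
    (is "?l = ?r \<longleftrightarrow> ?ul = ?ur")
    if [simp]: "A \<in> Vobj C" "B \<in> Vobj C" for A B
  proof -
    have ul: "?ul = uncurry_arr (Fobj F A) (Fobj G B) ?l"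
      by (rule uncurry_Vcmp_self[symmetric]) (simp_all add: hom_iff)
    have "?ur = uncurry_arr (Fobj F A) (Fobj G B)
        (Vcmp self (Fobj F A) (Fobj F B) (Fobj G B) \<cdot> (p B \<boxtimes> Fhom F A B))
        \<cdot> (Sym V (Vhom C A B) x \<boxtimes> Idn V (Fobj F A))"
      by (subst uncurry_Vcmp_self[where y = x and x = "Vhom C A B"]) (simp_all add: hom_iff)
    also have "\<dots> = uncurry_arr (Fobj F A) (Fobj G B) ?r"
      by (subst uncurry_arr_cmp[symmetric]) simp_all
    finally have ur: "?ur = uncurry_arr (Fobj F A) (Fobj G B) ?r" .
    show ?thesis
      unfolding ul ur by (rule uncurry_arr_eq_iff) (simp_all add: hom_iff)
  qed
  then show ?thesis
    unfolding nat_family_def using p by simp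
qed

text \<open>This makes the composition of \<open>functor_cat\<close> meaningful, being a lift along
  such composite families. The hom-object C(A,B) is moved first past y by naturality of q, then past
  x by naturality of p.\<close>

lemma nat_family_cmp:
  assumes C: "is_vcat C" and F: "is_vfunctor C self F" and G: "is_vfunctor C self G"
    and H: "is_vfunctor C self H"
    and p: "nat_family C self F G x p" and q: "nat_family C self G H y q"
  shows "nat_family C self F H (y \<otimes> x)
    (\<lambda>A. Vcmp self (Fobj F A) (Fobj G A) (Fobj H A) \<cdot> (q A \<boxtimes> p A))"
proof -
  note [simp] = is_vfunctor_typing[OF F, simplified] is_vfunctor_typing[OF G, simplified]
    is_vfunctor_typing[OF H, simplified] C
  have [simp]: "x \<in> Obj V" "y \<in> Obj V"
    using p q by (simp_all add: nat_family_def)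
  have [simp]: "p A \<in> Arr V" "Dom V (p A) = x" "Cod V (p A) = Ihom V (Fobj F A) (Fobj G A)"
    "q A \<in> Arr V" "Dom V (q A) = y" "Cod V (q A) = Ihom V (Fobj G A) (Fobj H A)"
    if "A \<in> Vobj C" for A
    using p q that by (simp_all add: nat_family_def hom_iff)
  have "Vcmp self (Fobj F A) (Fobj H A) (Fobj H B)
        \<cdot> (Fhom H A B \<boxtimes> (Vcmp self (Fobj F A) (Fobj G A) (Fobj H A) \<cdot> (q A \<boxtimes> p A)))
      = Vcmp self (Fobj F A) (Fobj F B) (Fobj H B)
        \<cdot> ((Vcmp self (Fobj F B) (Fobj G B) (Fobj H B) \<cdot> (q B \<boxtimes> p B)) \<boxtimes> Fhom F A B)
        \<cdot> Sym V (Vhom C A B) (y \<otimes> x)"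
    (is "?l = _") if AB [simp]: "A \<in> Vobj C" "B \<in> Vobj C" for A B
  proof -
    let ?c = "Vhom C A B" and ?M = "\<lambda>a b c. Vcmp self a b c"
    let ?r = "?M (Fobj F A) (Fobj F B) (Fobj H B)
      \<cdot> ((?M (Fobj F B) (Fobj G B) (Fobj H B) \<cdot> (q B \<boxtimes> p B)) \<boxtimes> Fhom F A B)"
    \<comment> \<open>An associator is put in front so that associativity of composition in
      \<open>self\<close> applies from right to left; it is cancelled at the end.\<close>
    have "(?M (Fobj F A) (Fobj H A) (Fobj H B)
          \<cdot> (Fhom H A B \<boxtimes> (?M (Fobj F A) (Fobj G A) (Fobj H A) \<cdot> (q A \<boxtimes> p A)))) \<cdot> Asc V ?c y x
        = ?M (Fobj F A) (Fobj H A) (Fobj H B)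
          \<cdot> (Fhom H A B \<boxtimes> (?M (Fobj F A) (Fobj G A) (Fobj H A) \<cdot> (q A \<boxtimes> p A))) \<cdot> Asc V ?c y x"
      by simp
    also have "\<dots> = ?M (Fobj F A) (Fobj G A) (Fobj H B)
        \<cdot> ((?M (Fobj G A) (Fobj H A) (Fobj H B) \<cdot> (Fhom H A B \<boxtimes> q A)) \<boxtimes> p A)"
      by (rule Vcmp_self_assoc[symmetric]) (simp_all add: hom_iff)
    also have "?M (Fobj G A) (Fobj H A) (Fobj H B) \<cdot> (Fhom H A B \<boxtimes> q A)
        = ?M (Fobj G A) (Fobj G B) (Fobj H B) \<cdot> (q B \<boxtimes> Fhom G A B) \<cdot> Sym V ?c y"
      using q AB unfolding nat_family_def by blast
    also have "?M (Fobj F A) (Fobj G A) (Fobj H B)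
          \<cdot> ((?M (Fobj G A) (Fobj G B) (Fobj H B) \<cdot> (q B \<boxtimes> Fhom G A B) \<cdot> Sym V ?c y) \<boxtimes> p A)
        = (?M (Fobj F A) (Fobj G A) (Fobj H B)
          \<cdot> ((?M (Fobj G A) (Fobj G B) (Fobj H B) \<cdot> (q B \<boxtimes> Fhom G A B)) \<boxtimes> p A))
          \<cdot> (Sym V ?c y \<boxtimes> Idn V x)"
      by simp
    also have "?M (Fobj F A) (Fobj G A) (Fobj H B)
          \<cdot> ((?M (Fobj G A) (Fobj G B) (Fobj H B) \<cdot> (q B \<boxtimes> Fhom G A B)) \<boxtimes> p A)
        = ?M (Fobj F A) (Fobj G B) (Fobj H B)
          \<cdot> (q B \<boxtimes> (?M (Fobj F A) (Fobj G A) (Fobj G B) \<cdot> (Fhom G A B \<boxtimes> p A))) \<cdot> Asc V y ?c x"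
      by (rule Vcmp_self_assoc) (simp_all add: hom_iff)
    also have "?M (Fobj F A) (Fobj G A) (Fobj G B) \<cdot> (Fhom G A B \<boxtimes> p A)
        = ?M (Fobj F A) (Fobj F B) (Fobj G B) \<cdot> (p B \<boxtimes> Fhom F A B) \<cdot> Sym V ?c x"
      using p AB unfolding nat_family_def by blast
    also have "(?M (Fobj F A) (Fobj G B) (Fobj H B)
          \<cdot> (q B \<boxtimes> (?M (Fobj F A) (Fobj F B) (Fobj G B) \<cdot> (p B \<boxtimes> Fhom F A B) \<cdot> Sym V ?c x)) \<cdot> Asc V y ?c x)
          \<cdot> (Sym V ?c y \<boxtimes> Idn V x)
        = ?M (Fobj F A) (Fobj G B) (Fobj H B)
          \<cdot> (q B \<boxtimes> (?M (Fobj F A) (Fobj F B) (Fobj G B) \<cdot> (p B \<boxtimes> Fhom F A B)))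
          \<cdot> (Idn V y \<boxtimes> Sym V ?c x) \<cdot> Asc V y ?c x \<cdot> (Sym V ?c y \<boxtimes> Idn V x)"
      by simp
    \<comment> \<open>The two separate symmetries, past y and past x, combine into one symmetry past
      y \<otimes> x by the hexagon.\<close>
    also have "\<dots> = (?M (Fobj F A) (Fobj G B) (Fobj H B)
          \<cdot> (q B \<boxtimes> (?M (Fobj F A) (Fobj F B) (Fobj G B) \<cdot> (p B \<boxtimes> Fhom F A B))) \<cdot> Asc V y x ?c)
          \<cdot> Sym V ?c (y \<otimes> x) \<cdot> Asc V ?c y x"
      by (subst hexagon[symmetric]) simp_all
    also have "?M (Fobj F A) (Fobj G B) (Fobj H B)
          \<cdot> (q B \<boxtimes> (?M (Fobj F A) (Fobj F B) (Fobj G B) \<cdot> (p B \<boxtimes> Fhom F A B))) \<cdot> Asc V y x ?c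
        = ?r"
      by (rule Vcmp_self_assoc[symmetric]) (simp_all add: hom_iff)
    also have "?r \<cdot> Sym V ?c (y \<otimes> x) \<cdot> Asc V ?c y x = (?r \<cdot> Sym V ?c (y \<otimes> x)) \<cdot> Asc V ?c y x"
      by simp
    finally have "?l = ?r \<cdot> Sym V ?c (y \<otimes> x)"
      by (rule iso_right_cancel) simp_all
    then show ?thesis
      by simp
  qed
  then show ?thesis
    by (simp add: nat_family_def hom_iff)
qed

section \<open>Chosen ends and the composition of algebra categories\<close>

lemma is_nat_object_chosen:
  assumes "\<exists>e. is_nat_object C D F G e"
  shows "is_nat_object C D F G (nat_ob C D F G, nat_proj C D F G)"
  using someI_ex[OF assms] by (simp add: nat_ob_def nat_proj_def)

lemma nat_proj_family:
  assumes "\<exists>e. is_nat_object C D F G e"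
  shows "nat_family C D F G (nat_ob C D F G) (nat_proj C D F G)"
  using is_nat_object_chosen[OF assms] by (simp add: is_nat_object_def)

lemma nat_lift_props:
  assumes "\<exists>e. is_nat_object C D F G e" "nat_family C D F G x q"
  shows "nat_lift C D F G x q \<in> hom V x (nat_ob C D F G)"
    "A \<in> Vobj C \<Longrightarrow> nat_proj C D F G A \<cdot> nat_lift C D F G x q = q A"
proof -
  have "\<exists>!h. h \<in> hom V x (nat_ob C D F G) \<and> (\<forall>A\<in>Vobj C. nat_proj C D F G A \<cdot> h = q A)"
    using is_nat_object_chosen[OF assms(1)] assms(2) by (simp add: is_nat_object_def)
  from theI'[OF this]
  show "nat_lift C D F G x q \<in> hom V x (nat_ob C D F G)"
    "A \<in> Vobj C \<Longrightarrow> nat_proj C D F G A \<cdot> nat_lift C D F G x q = q A"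
    by (simp_all add: nat_lift_def)
qed

lemma nat_lift_unique:
  assumes "\<exists>e. is_nat_object C D F G e" "nat_family C D F G x q"
    and "h \<in> hom V x (nat_ob C D F G)" "\<And>A. A \<in> Vobj C \<Longrightarrow> nat_proj C D F G A \<cdot> h = q A"
  shows "h = nat_lift C D F G x q"
proof -
  have "\<exists>!h. h \<in> hom V x (nat_ob C D F G) \<and> (\<forall>A\<in>Vobj C. nat_proj C D F G A \<cdot> h = q A)"
    using is_nat_object_chosen[OF assms(1)] assms(2) by (simp add: is_nat_object_def)
  then show ?thesis
    using assms nat_lift_props[OF assms(1,2)] by blast
qed

lemma Alg_simps [simp]:
  "Vobj (Alg \<J> T) = {A. is_algebra \<J> T A}" "Vhom (Alg \<J> T) = nat_ob T self"
  "Vid (Alg \<J> T) A = nat_lift T self A A \<I> (\<lambda>J. Vid self (Fobj A J))"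
  "Vcmp (Alg \<J> T) A B B' = nat_lift T self A B' (nat_ob T self B B' \<otimes> nat_ob T self A B)
    (\<lambda>J. Vcmp self (Fobj A J) (Fobj B J) (Fobj B' J) \<cdot> (nat_proj T self B B' J \<boxtimes> nat_proj T self A B J))"
  by (simp_all add: Alg_def full_sub_def functor_cat_def)

text \<open>Composition in \<open>Alg\<close> is a definite description; naturality of the composed
  projections is what gives it a value. Afterwards only its projections are used.\<close>

lemma Vcmp_Alg_props:
  assumes T: "is_vcat T"
    and ends: "\<forall>A B. is_algebra \<J> T A \<and> is_algebra \<J> T B \<longrightarrow> (\<exists>e. is_nat_object T self A B e)"
    and "is_algebra \<J> T A" "is_algebra \<J> T B" "is_algebra \<J> T B'"
  shows "Vcmp (Alg \<J> T) A B B' \<in> hom V (nat_ob T self B B' \<otimes> nat_ob T self A B) (nat_ob T self A B')"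
    "J \<in> Vobj T \<Longrightarrow> nat_proj T self A B' J \<cdot> Vcmp (Alg \<J> T) A B B'
      = Vcmp self (Fobj A J) (Fobj B J) (Fobj B' J) \<cdot> (nat_proj T self B B' J \<boxtimes> nat_proj T self A B J)"
proof -
  note ends = ends[rule_format, OF conjI]
  have "nat_family T self A B' (nat_ob T self B B' \<otimes> nat_ob T self A B)
    (\<lambda>J. Vcmp self (Fobj A J) (Fobj B J) (Fobj B' J) \<cdot> (nat_proj T self B B' J \<boxtimes> nat_proj T self A B J))"
    using assms by (intro nat_family_cmp nat_proj_family ends) (simp_all add: is_algebra_def)
  from nat_lift_props[OF ends this]
  show "Vcmp (Alg \<J> T) A B B' \<in> hom V (nat_ob T self B B' \<otimes> nat_ob T self A B) (nat_ob T self A B')"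
    "J \<in> Vobj T \<Longrightarrow> nat_proj T self A B' J \<cdot> Vcmp (Alg \<J> T) A B B'
      = Vcmp self (Fobj A J) (Fobj B J) (Fobj B' J) \<cdot> (nat_proj T self B B' J \<boxtimes> nat_proj T self A B J)"
    using assms by simp_all
qed

end


section \<open>Transport along natural isomorphisms\<close>

context symmetric_monoidal_closed
begin

text \<open>\<open>L\<close> is not assumed to be functorial: functoriality and preservation of powers are transported
  from \<open>E\<close> along \<open>\<theta>\<close>.\<close>

definition action_iso ::
  "('a, 'o, 'm) vcat \<Rightarrow> ('a, 'o, 'm) vfun \<Rightarrow> ('a, 'o, 'm) vfun \<Rightarrow> ('a \<Rightarrow> 'm) \<Rightarrow> bool"
  where "action_iso C L E \<theta> \<longleftrightarrow>
    (\<forall>A\<in>Vobj C. \<theta> A \<in> hom V (Fobj L A) (Fobj E A) \<and> is_iso V (\<theta> A)) \<and>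
    (\<forall>A\<in>Vobj C. \<forall>B\<in>Vobj C. Fhom L A B \<in> hom V (Vhom C A B) (Ihom V (Fobj L A) (Fobj L B))) \<and>
    (\<forall>A\<in>Vobj C. \<forall>B\<in>Vobj C. \<theta> B \<cdot> action L A B = action E A B \<cdot> (Idn V (Vhom C A B) \<boxtimes> \<theta> A))"

lemma action_iso_typing:
  assumes "action_iso C L E \<theta>" "A \<in> Vobj C"
  shows "\<theta> A \<in> Arr V" "Dom V (\<theta> A) = Fobj L A" "Cod V (\<theta> A) = Fobj E A" "is_iso V (\<theta> A)"
    "Fobj L A \<in> Obj V" "Fobj E A \<in> Obj V"
    "B \<in> Vobj C \<Longrightarrow> Fhom L A B \<in> Arr V" "B \<in> Vobj C \<Longrightarrow> Dom V (Fhom L A B) = Vhom C A B"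
    "B \<in> Vobj C \<Longrightarrow> Cod V (Fhom L A B) = Ihom V (Fobj L A) (Fobj L B)"
  using assms Dom_in_Obj[of "\<theta> A"] Cod_in_Obj[of "\<theta> A"] by (simp_all add: action_iso_def hom_iff)

lemma action_iso_nat:
  assumes "action_iso C L E \<theta>" "A \<in> Vobj C" "B \<in> Vobj C"
  shows "\<theta> B \<cdot> action L A B = action E A B \<cdot> (Idn V (Vhom C A B) \<boxtimes> \<theta> A)"
  using assms by (simp add: action_iso_def)

text \<open>Composing a law for L with the invertible \<theta> and sliding \<theta> through the
  actions gives the corresponding law for E precomposed with \<theta>; then \<theta> is cancelled on
  the left.\<close>

lemma action_iso_vfunctor:
  assumes C: "is_vcat C" and E: "is_vfunctor C self E" and \<theta>: "action_iso C L E \<theta>"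
  shows "is_vfunctor C self L"
proof (subst vfunctor_self_iff[OF C])
  note [simp] = action_iso_typing[OF \<theta>] is_vfunctor_typing[OF E, simplified] C
  note nat = action_iso_nat[OF \<theta>]
  have "action E A A \<cdot> (Vid C A \<boxtimes> Idn V (Fobj E A)) = Lun V (Fobj E A)"
    and Ecmp: "B \<in> Vobj C \<Longrightarrow> B' \<in> Vobj C \<Longrightarrow> action E A B' \<cdot> (Vcmp C A B B' \<boxtimes> Idn V (Fobj E A))
        = action E B B' \<cdot> (Idn V (Vhom C B B') \<boxtimes> action E A B)
          \<cdot> Asc V (Vhom C B B') (Vhom C A B) (Fobj E A)" if "A \<in> Vobj C" for A B B'
    using vfunctor_self_iff[OF C, of E] E that by (simp_all add: hom_iff)
  note Eid = this(1)
  have "action L A A \<cdot> (Vid C A \<boxtimes> Idn V (Fobj L A)) = Lun V (Fobj L A)" if [simp]: "A \<in> Vobj C" for A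
  proof (rule iso_left_cancel[of "\<theta> A"])
    have "\<theta> A \<cdot> action L A A \<cdot> (Vid C A \<boxtimes> Idn V (Fobj L A))
        = (action E A A \<cdot> (Vid C A \<boxtimes> Idn V (Fobj E A))) \<cdot> (Idn V \<I> \<boxtimes> \<theta> A)"
      by (simp add: reassoc[OF nat])
    also have "\<dots> = \<theta> A \<cdot> Lun V (Fobj L A)"
      unfolding Eid[OF that] by (rule lun_nat) (simp add: hom_iff)
    finally show "\<theta> A \<cdot> action L A A \<cdot> (Vid C A \<boxtimes> Idn V (Fobj L A)) = \<theta> A \<cdot> Lun V (Fobj L A)" .
  qed simp_all
  moreover have "action L A B' \<cdot> (Vcmp C A B B' \<boxtimes> Idn V (Fobj L A))
        = action L B B' \<cdot> (Idn V (Vhom C B B') \<boxtimes> action L A B)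
          \<cdot> Asc V (Vhom C B B') (Vhom C A B) (Fobj L A)"
    if [simp]: "A \<in> Vobj C" "B \<in> Vobj C" "B' \<in> Vobj C" for A B B'
  proof (rule iso_left_cancel[of "\<theta> B'"])
    have "\<theta> B' \<cdot> action L A B' \<cdot> (Vcmp C A B B' \<boxtimes> Idn V (Fobj L A))
        = (action E A B' \<cdot> (Vcmp C A B B' \<boxtimes> Idn V (Fobj E A)))
          \<cdot> (Idn V (Vhom C B B') \<boxtimes> Idn V (Vhom C A B) \<boxtimes> \<theta> A)"
      by (simp add: reassoc[OF nat])
    also have "\<dots> = action E B B' \<cdot> (Idn V (Vhom C B B') \<boxtimes> action E A B)
          \<cdot> Asc V (Vhom C B B') (Vhom C A B) (Fobj E A)
          \<cdot> (Idn V (Vhom C B B') \<boxtimes> Idn V (Vhom C A B) \<boxtimes> \<theta> A)"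
      unfolding Ecmp[OF that] by simp
    also have "Asc V (Vhom C B B') (Vhom C A B) (Fobj E A)
          \<cdot> (Idn V (Vhom C B B') \<boxtimes> Idn V (Vhom C A B) \<boxtimes> \<theta> A)
        = (Idn V (Vhom C B B') \<boxtimes> (Idn V (Vhom C A B) \<boxtimes> \<theta> A)) \<cdot> Asc V (Vhom C B B') (Vhom C A B) (Fobj L A)"
      by (rule Asc_nat(1)) (simp_all add: hom_iff)
    also have "action E B B' \<cdot> (Idn V (Vhom C B B') \<boxtimes> action E A B)
          \<cdot> (Idn V (Vhom C B B') \<boxtimes> (Idn V (Vhom C A B) \<boxtimes> \<theta> A)) \<cdot> Asc V (Vhom C B B') (Vhom C A B) (Fobj L A)
        = (action E B B' \<cdot> (Idn V (Vhom C B B') \<boxtimes> \<theta> B)) \<cdot> (Idn V (Vhom C B B') \<boxtimes> action L A B)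
          \<cdot> Asc V (Vhom C B B') (Vhom C A B) (Fobj L A)"
      by (simp add: nat)
    also have "\<dots> = \<theta> B' \<cdot> action L B B' \<cdot> (Idn V (Vhom C B B') \<boxtimes> action L A B)
          \<cdot> Asc V (Vhom C B B') (Vhom C A B) (Fobj L A)"
      by (subst nat[symmetric]) simp_all
    finally show "\<theta> B' \<cdot> action L A B' \<cdot> (Vcmp C A B B' \<boxtimes> Idn V (Fobj L A))
        = \<theta> B' \<cdot> action L B B' \<cdot> (Idn V (Vhom C B B') \<boxtimes> action L A B)
          \<cdot> Asc V (Vhom C B B') (Vhom C A B) (Fobj L A)" .
  qed simp_all
  ultimately show "(\<forall>A\<in>Vobj C. action L A A \<cdot> (Vid C A \<boxtimes> Idn V (Fobj L A)) = Lun V (Fobj L A)) \<and>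
    (\<forall>A\<in>Vobj C. \<forall>B\<in>Vobj C. \<forall>B'\<in>Vobj C.
      action L A B' \<cdot> (Vcmp C A B B' \<boxtimes> Idn V (Fobj L A))
        = action L B B' \<cdot> (Idn V (Vhom C B B') \<boxtimes> action L A B)
          \<cdot> Asc V (Vhom C B B') (Vhom C A B) (Fobj L A))"
    by blast
qed (use action_iso_typing[OF \<theta>] in \<open>simp_all add: hom_iff\<close>)

lemma action_iso_inverse:
  assumes C: "is_vcat C" and E: "is_vfunctor C self E" and \<theta>: "action_iso C L E \<theta>"
  shows "action_iso C E L (\<lambda>A. inv_arr V (\<theta> A))"
proof -
  note [simp] = action_iso_typing[OF \<theta>] is_vfunctor_typing[OF E, simplified] C
  have "inv_arr V (\<theta> B) \<cdot> action E A B = action L A B \<cdot> (Idn V (Vhom C A B) \<boxtimes> inv_arr V (\<theta> A))"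
    if [simp]: "A \<in> Vobj C" "B \<in> Vobj C" for A B
    by (rule iso_left_cancel[of "\<theta> B"]) (simp_all add: reassoc[OF action_iso_nat[OF \<theta>]])
  then show ?thesis
    by (simp add: action_iso_def hom_iff)
qed

text \<open>With this instance, naturality of the identity family comes out as a special case of
  \<open>action_iso_nat_family\<close>.\<close>

lemma action_iso_refl:
  assumes C: "is_vcat C" and F: "is_vfunctor C self F"
  shows "action_iso C F F (\<lambda>A. Idn V (Fobj F A))"
proof -
  note [simp] = is_vfunctor_typing[OF F, simplified] C
  show ?thesis
    by (simp add: action_iso_def hom_iff)
qed

text \<open>An enriched transformation consists of arrows from I, so each \<theta> A is replaced by
  its name I -> [L A, E A]. Beyond compatibility of \<theta> with the actions, it remains to move I
  past C(A,B), by the triangle, \<open>sym_unit\<close> and \<open>Lun_ten\<close>.\<close>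

lemma action_iso_nat_family:
  assumes C: "is_vcat C" and E: "is_vfunctor C self E" and \<theta>: "action_iso C L E \<theta>"
  shows "nat_family C self L E \<I> (\<lambda>A. curry_arr \<I> (Fobj L A) (Fobj E A) (\<theta> A \<cdot> Lun V (Fobj L A)))"
proof (subst nat_family_self_iff[OF C action_iso_vfunctor[OF C E \<theta>] E])
  note [simp] = action_iso_typing[OF \<theta>] is_vfunctor_typing[OF E, simplified] C
  have "action E A B \<cdot> (Idn V (Vhom C A B) \<boxtimes> (\<theta> A \<cdot> Lun V (Fobj L A))) \<cdot> Asc V (Vhom C A B) \<I> (Fobj L A)
      = (\<theta> B \<cdot> Lun V (Fobj L B)) \<cdot> (Idn V \<I> \<boxtimes> action L A B) \<cdot> Asc V \<I> (Vhom C A B) (Fobj L A)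
        \<cdot> (Sym V (Vhom C A B) \<I> \<boxtimes> Idn V (Fobj L A))"
    if [simp]: "A \<in> Vobj C" "B \<in> Vobj C" for A B
  proof -
    have "action E A B \<cdot> (Idn V (Vhom C A B) \<boxtimes> (\<theta> A \<cdot> Lun V (Fobj L A))) \<cdot> Asc V (Vhom C A B) \<I> (Fobj L A)
        = (action E A B \<cdot> (Idn V (Vhom C A B) \<boxtimes> \<theta> A))
          \<cdot> (Idn V (Vhom C A B) \<boxtimes> Lun V (Fobj L A)) \<cdot> Asc V (Vhom C A B) \<I> (Fobj L A)"
      by simp
    also have "\<dots> = (\<theta> B \<cdot> action L A B) \<cdot> (Run V (Vhom C A B) \<boxtimes> Idn V (Fobj L A))"
      by (simp only: action_iso_nat[OF \<theta> that]) (simp add: triangle)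
    also have "\<dots> = \<theta> B \<cdot> action L A B \<cdot> (Lun V (Vhom C A B) \<boxtimes> Idn V (Fobj L A))
        \<cdot> (Sym V (Vhom C A B) \<I> \<boxtimes> Idn V (Fobj L A))"
      by (simp add: sym_unit)
    also have "\<dots> = \<theta> B \<cdot> action L A B \<cdot> Lun V (Vhom C A B \<otimes> Fobj L A) \<cdot> Asc V \<I> (Vhom C A B) (Fobj L A)
        \<cdot> (Sym V (Vhom C A B) \<I> \<boxtimes> Idn V (Fobj L A))"
      by (simp add: reassoc[OF Lun_ten])
    also have "\<dots> = (\<theta> B \<cdot> Lun V (Fobj L B)) \<cdot> (Idn V \<I> \<boxtimes> action L A B) \<cdot> Asc V \<I> (Vhom C A B) (Fobj L A)
        \<cdot> (Sym V (Vhom C A B) \<I> \<boxtimes> Idn V (Fobj L A))"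
      by (simp add: reassoc[OF lun_nat[of _ "Vhom C A B \<otimes> Fobj L A" "Fobj L B"]] hom_iff)
    finally show ?thesis .
  qed
  then show "\<forall>A\<in>Vobj C. \<forall>B\<in>Vobj C.
    action E A B \<cdot> (Idn V (Vhom C A B) \<boxtimes> uncurry_arr (Fobj L A) (Fobj E A)
        (curry_arr \<I> (Fobj L A) (Fobj E A) (\<theta> A \<cdot> Lun V (Fobj L A)))) \<cdot> Asc V (Vhom C A B) \<I> (Fobj L A)
      = uncurry_arr (Fobj L B) (Fobj E B) (curry_arr \<I> (Fobj L B) (Fobj E B) (\<theta> B \<cdot> Lun V (Fobj L B)))
        \<cdot> (Idn V \<I> \<boxtimes> action L A B)
        \<cdot> Asc V \<I> (Vhom C A B) (Fobj L A) \<cdot> (Sym V (Vhom C A B) \<I> \<boxtimes> Idn V (Fobj L A))"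
    by simp
qed (use action_iso_typing[OF \<theta>] in \<open>simp_all add: hom_iff\<close>)

section \<open>From natural isomorphisms to isomorphisms of algebras\<close>

lemma Vid_self_curry: "Vid self a = curry_arr \<I> a a (Lun V a)"
  by (simp add: self_def)

text \<open>The names of the identities form a natural family, so the lift defining the identity of
  \<open>Alg\<close> has a value and is determined by its projections.\<close>

lemma Vid_Alg_props:
  assumes T: "is_vcat T" and e: "\<exists>e. is_nat_object T self A A e" and A: "is_algebra \<J> T A"
  shows "nat_family T self A A \<I> (\<lambda>J. Vid self (Fobj A J))"
    "Vid (Alg \<J> T) A \<in> hom V \<I> (nat_ob T self A A)"
    "J \<in> Vobj T \<Longrightarrow> nat_proj T self A A J \<cdot> Vid (Alg \<J> T) A = Vid self (Fobj A J)"
proof -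
  have A': "is_vfunctor T self A"
    using A by (simp add: is_algebra_def)
  have "nat_family T self A A \<I>
      (\<lambda>J. curry_arr \<I> (Fobj A J) (Fobj A J) (Idn V (Fobj A J) \<cdot> Lun V (Fobj A J)))"
    by (rule action_iso_nat_family[OF T A' action_iso_refl[OF T A']])
  then show *: "nat_family T self A A \<I> (\<lambda>J. Vid self (Fobj A J))"
    using is_vfunctor_typing[OF A', simplified] by (simp add: nat_family_def Vid_self_curry)
  show "Vid (Alg \<J> T) A \<in> hom V \<I> (nat_ob T self A A)"
    "J \<in> Vobj T \<Longrightarrow> nat_proj T self A A J \<cdot> Vid (Alg \<J> T) A = Vid self (Fobj A J)"
    using nat_lift_props[OF e *] by simp_all
qed

text \<open>In the underlying category of \<open>self\<close>, the name of t followed by the name of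
  its inverse is the identity. After transposition t cancels, and the leftover unit constraints
  agree by the triangle and \<open>Lun_Unit\<close>.\<close>

lemma Vcmp_self_inverse:
  assumes [simp]: "is_iso V t" "Dom V t = a" "Cod V t = b"
  shows "Vcmp self a b a \<cdot> (curry_arr \<I> b a (inv_arr V t \<cdot> Lun V b) \<boxtimes> curry_arr \<I> a b (t \<cdot> Lun V a))
      \<cdot> inv_arr V (Lun V \<I>) = Vid self a"
proof (rule uncurry_arr_inject)
  have [simp]: "t \<in> Arr V" "a \<in> Obj V" "b \<in> Obj V"
    using assms iso_typing[of t] Dom_in_Obj[of t] Cod_in_Obj[of t] by simp_all
  let ?p = "curry_arr \<I> a b (t \<cdot> Lun V a)" and ?q = "curry_arr \<I> b a (inv_arr V t \<cdot> Lun V b)"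
  have "uncurry_arr a a (Vcmp self a b a \<cdot> (?q \<boxtimes> ?p) \<cdot> inv_arr V (Lun V \<I>))
      = uncurry_arr a a (Vcmp self a b a \<cdot> (?q \<boxtimes> ?p)) \<cdot> (inv_arr V (Lun V \<I>) \<boxtimes> Idn V a)"
    by (simp add: uncurry_arr_cmp flip: assoc)
  also have "uncurry_arr a a (Vcmp self a b a \<cdot> (?q \<boxtimes> ?p))
      = (inv_arr V t \<cdot> Lun V b) \<cdot> (Idn V \<I> \<boxtimes> (t \<cdot> Lun V a)) \<cdot> Asc V \<I> \<I> a"
    by (subst uncurry_Vcmp_self[where y = \<I> and x = \<I>]) (simp_all add: hom_iff)
  also have "\<dots> = inv_arr V t \<cdot> Lun V b \<cdot> (Idn V \<I> \<boxtimes> t) \<cdot> (Idn V \<I> \<boxtimes> Lun V a) \<cdot> Asc V \<I> \<I> a"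
    by simp
  also have "\<dots> = Lun V a \<cdot> (Run V \<I> \<boxtimes> Idn V a)"
    by (subst reassoc[OF lun_nat[of t a b]]) (simp_all add: hom_iff triangle)
  also have "\<dots> \<cdot> (inv_arr V (Lun V \<I>) \<boxtimes> Idn V a) = uncurry_arr a a (Vid self a)"
    by (simp add: Lun_Unit)
  finally show "uncurry_arr a a (Vcmp self a b a \<cdot> (?q \<boxtimes> ?p) \<cdot> inv_arr V (Lun V \<I>))
      = uncurry_arr a a (Vid self a)" .
  show "Vcmp self a b a \<cdot> (?q \<boxtimes> ?p) \<cdot> inv_arr V (Lun V \<I>) \<in> hom V \<I> (Ihom V a a)"
    "Vid self a \<in> hom V \<I> (Ihom V a a)" "a \<in> Obj V" "a \<in> Obj V"
    by (simp_all add: hom_iff)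
qed

text \<open>Arrows into an end agree once their projections do, which reduces the claim to
  \<open>Vcmp_self_inverse\<close> at each J. Only one composite is treated; the other one follows
  by exchanging A with B and \<theta> with its inverse.\<close>

lemma el_comp_Alg_inverse:
  assumes T: "is_vcat T"
    and ends: "\<forall>A B. is_algebra \<J> T A \<and> is_algebra \<J> T B \<longrightarrow> (\<exists>e. is_nat_object T self A B e)"
    and A: "is_algebra \<J> T A" and B: "is_algebra \<J> T B"
    and f: "f \<in> hom V \<I> (nat_ob T self A B)" and g: "g \<in> hom V \<I> (nat_ob T self B A)"
    and iso: "\<And>J. J \<in> Vobj T \<Longrightarrow> is_iso V (\<theta> J) \<and> \<theta> J \<in> hom V (Fobj A J) (Fobj B J)"
    and pf: "\<And>J. J \<in> Vobj T \<Longrightarrow>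
      nat_proj T self A B J \<cdot> f = curry_arr \<I> (Fobj A J) (Fobj B J) (\<theta> J \<cdot> Lun V (Fobj A J))"
    and pg: "\<And>J. J \<in> Vobj T \<Longrightarrow>
      nat_proj T self B A J \<cdot> g = curry_arr \<I> (Fobj B J) (Fobj A J) (inv_arr V (\<theta> J) \<cdot> Lun V (Fobj B J))"
  shows "el_comp (Alg \<J> T) A B A g f = Vid (Alg \<J> T) A"
proof -
  have A': "is_vfunctor T self A" and B': "is_vfunctor T self B"
    using A B by (simp_all add: is_algebra_def)
  let ?M = "Vcmp (Alg \<J> T) A B A"
  note ends' = ends[rule_format, OF conjI]
  note M = Vcmp_Alg_props[OF T ends A B A]
  have proj: "nat_proj T self X Y J \<in> hom V (nat_ob T self X Y) (Ihom V (Fobj X J) (Fobj Y J))"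
    if "is_algebra \<J> T X" "is_algebra \<J> T Y" "J \<in> Vobj T" for X Y J
    using nat_proj_family[OF ends'[OF that(1,2)]] that by (simp add: nat_family_def)
  note [simp] = is_vfunctor_typing[OF A', simplified] is_vfunctor_typing[OF B', simplified]
  have h: "el_comp (Alg \<J> T) A B A g f \<in> hom V \<I> (nat_ob T self A A)"
    using f g M(1) by (simp add: el_comp_def hom_iff del: Alg_simps)
  have "nat_proj T self A A J \<cdot> el_comp (Alg \<J> T) A B A g f = Vid self (Fobj A J)"
    if J: "J \<in> Vobj T" for J
  proof -
    have "nat_proj T self A A J \<cdot> el_comp (Alg \<J> T) A B A g f
        = (nat_proj T self A A J \<cdot> ?M) \<cdot> (g \<boxtimes> f) \<cdot> inv_arr V (Lun V \<I>)"
      using f g M(1) proj[OF A A J] by (simp add: el_comp_def hom_iff del: Alg_simps)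
    also have "\<dots> = Vcmp self (Fobj A J) (Fobj B J) (Fobj A J)
        \<cdot> ((nat_proj T self B A J \<cdot> g) \<boxtimes> (nat_proj T self A B J \<cdot> f)) \<cdot> inv_arr V (Lun V \<I>)"
      using f g J proj[OF A B J] proj[OF B A J] by (simp add: M(2)[OF J] hom_iff del: Alg_simps)
    also have "\<dots> = Vid self (Fobj A J)"
      unfolding pf[OF J] pg[OF J] by (rule Vcmp_self_inverse) (use iso[OF J] in \<open>simp_all add: hom_iff\<close>)
    finally show ?thesis .
  qed
  with h show ?thesis
    using nat_lift_unique[OF ends'[OF A A] Vid_Alg_props(1)[OF T ends'[OF A A] A]] by simp
qed

lemma action_iso_isomorphic:
  assumes T: "is_vcat T"
    and ends: "\<forall>A B. is_algebra \<J> T A \<and> is_algebra \<J> T B \<longrightarrow> (\<exists>e. is_nat_object T self A B e)"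
    and L: "is_algebra \<J> T L" and E: "is_algebra \<J> T E" and \<theta>: "action_iso T L E \<theta>"
  shows "isomorphic (Alg \<J> T) L E"
proof -
  have L': "is_vfunctor T self L" and E': "is_vfunctor T self E"
    using L E by (simp_all add: is_algebra_def)
  note t = action_iso_typing[OF \<theta>] and ends' = ends[rule_format, OF conjI]
  note \<theta>' = action_iso_inverse[OF T E' \<theta>]
  note f = nat_lift_props[OF ends'[OF L E] action_iso_nat_family[OF T E' \<theta>]]
  note g = nat_lift_props[OF ends'[OF E L] action_iso_nat_family[OF T L' \<theta>']]
  \<comment> \<open>The second use of \<open>el_comp_Alg_inverse\<close> takes the inverses as its
    \<theta>, so its hypothesis on g mentions their inverses.\<close>
  have inv: "inv_arr V (inv_arr V (\<theta> J)) = \<theta> J" if "J \<in> Vobj T" for J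
    by (rule iso_left_cancel[of "inv_arr V (\<theta> J)"]) (use t that in simp_all)
  let ?f = "nat_lift T self L E \<I> (\<lambda>J. curry_arr \<I> (Fobj L J) (Fobj E J) (\<theta> J \<cdot> Lun V (Fobj L J)))"
  let ?g = "nat_lift T self E L \<I>
    (\<lambda>J. curry_arr \<I> (Fobj E J) (Fobj L J) (inv_arr V (\<theta> J) \<cdot> Lun V (Fobj E J)))"
  have "el_comp (Alg \<J> T) L E L ?g ?f = Vid (Alg \<J> T) L"
    by (rule el_comp_Alg_inverse[OF T ends L E f(1) g(1), where \<theta> = \<theta>])
      (use t f(2) g(2) in \<open>simp_all add: hom_iff\<close>)
  moreover have "el_comp (Alg \<J> T) E L E ?f ?g = Vid (Alg \<J> T) E"
    by (rule el_comp_Alg_inverse[OF T ends E L g(1) f(1), where \<theta> = "\<lambda>J. inv_arr V (\<theta> J)"])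
      (use t f(2) g(2) inv in \<open>simp_all add: hom_iff\<close>)
  ultimately show ?thesis
    unfolding isomorphic_def is_iso_el_def using L E f(1) g(1) by auto
qed

text \<open>The covariant action [a, f] of the internal hom. It carries the comparison arrows of
  powers along an isomorphism.\<close>

definition ihom_post :: "'o \<Rightarrow> 'm \<Rightarrow> 'm"
  where "ihom_post a f = curry_arr (Ihom V a (Dom V f)) a (Cod V f) (f \<cdot> Evl V a (Dom V f))"

lemma ihom_post_typing [simp]:
  assumes "a \<in> Obj V" "f \<in> Arr V"
  shows "ihom_post a f \<in> Arr V" "Dom V (ihom_post a f) = Ihom V a (Dom V f)"
    "Cod V (ihom_post a f) = Ihom V a (Cod V f)"
  using assms by (simp_all add: ihom_post_def)

lemma uncurry_ihom_post:
  assumes "a \<in> Obj V" "f \<in> hom V b c" "g \<in> hom V x (Ihom V a b)"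
  shows "uncurry_arr a c (ihom_post a f \<cdot> g) = f \<cdot> uncurry_arr a b g"
proof -
  have "b \<in> Obj V" "c \<in> Obj V"
    using assms Dom_in_Obj Cod_in_Obj unfolding hom_iff by blast+
  then show ?thesis
    using assms by (simp add: uncurry_arr_cmp ihom_post_def hom_iff) (simp add: uncurry_arr_def)
qed

lemma is_iso_ihom_post:
  assumes "a \<in> Obj V" "is_iso V f"
  shows "is_iso V (ihom_post a f)"
proof -
  have inverse: "ihom_post a (inv_arr V g) \<cdot> ihom_post a g = Idn V (Ihom V a (Dom V g))"
    if "is_iso V g" for g
  proof (rule uncurry_arr_inject)
    have "uncurry_arr a (Dom V g) (ihom_post a (inv_arr V g) \<cdot> ihom_post a g)
        = inv_arr V g \<cdot> uncurry_arr a (Cod V g) (ihom_post a g)"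
      using assms(1) that iso_typing[OF that] by (intro uncurry_ihom_post) (auto simp: hom_iff)
    also have "\<dots> = uncurry_arr a (Dom V g) (Idn V (Ihom V a (Dom V g)))"
      using assms(1) that iso_typing[OF that] by (simp add: ihom_post_def uncurry_arr_def[of _ _ "Idn V _"])
    finally show "uncurry_arr a (Dom V g) (ihom_post a (inv_arr V g) \<cdot> ihom_post a g)
        = uncurry_arr a (Dom V g) (Idn V (Ihom V a (Dom V g)))" .
  qed (use assms(1) that iso_typing[OF that] in \<open>simp_all add: hom_iff\<close>)
  have "inv_arr V (inv_arr V f) = f"
    by (rule iso_left_cancel[of "inv_arr V f"]) (use assms iso_typing in simp_all)
  then show ?thesis
    using inverse[OF assms(2)] inverse[OF is_iso_inv_arr[OF assms(2)]] assms iso_typing[OF assms(2)]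
    by (intro is_isoI[where g = "ihom_post a (inv_arr V f)"
          and a = "Ihom V a (Dom V f)" and b = "Ihom V a (Cod V f)"])
      (simp_all add: hom_iff)
qed

abbreviation power_comparison :: "'o \<Rightarrow> 'o \<Rightarrow> 'o \<Rightarrow> 'm \<Rightarrow> 'o \<Rightarrow> 'm"
  where "power_comparison x c p k a \<equiv> curry_arr (Ihom V a p) x (Ihom V a c)
    (Vcmp self a p c \<cdot> Sym V (Ihom V a p) (Ihom V p c) \<cdot> (Idn V (Ihom V a p) \<boxtimes> k))"

text \<open>The assumption \<open>nat\<close> says that (t, s) is a morphism between the counits k'
  and k. The comparisons are built from the counits by composition, hence they form a commuting
  square with the arrows induced by s and t.\<close>

lemma power_comparison_nat:
  assumes x: "x \<in> Obj V" and a: "a \<in> Obj V"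
    and k: "k \<in> hom V x (Ihom V p c)" and k': "k' \<in> hom V x (Ihom V p' c')"
    and s: "s \<in> hom V c' c" and t: "t \<in> hom V p' p"
    and nat: "s \<cdot> uncurry_arr p' c' k' = uncurry_arr p c k \<cdot> (Idn V x \<boxtimes> t)"
  shows "ihom_post x (ihom_post a s) \<cdot> power_comparison x c' p' k' a
    = power_comparison x c p k a \<cdot> ihom_post a t"
    (is "?l = ?r")
proof (rule uncurry_arr_inject)
  have [simp]: "c \<in> Obj V" "c' \<in> Obj V" "p \<in> Obj V" "p' \<in> Obj V"
    using s t Dom_in_Obj Cod_in_Obj unfolding hom_iff by blast+
  have [simp]: "k \<in> Arr V" "Dom V k = x" "Cod V k = Ihom V p c" "k' \<in> Arr V" "Dom V k' = x"
    "Cod V k' = Ihom V p' c'" "s \<in> Arr V" "Dom V s = c'" "Cod V s = c" "t \<in> Arr V" "Dom V t = p'"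
    "Cod V t = p"
    using k k' s t by (simp_all add: hom_iff)
  note [simp] = x a
  \<comment> \<open>The square before transposition in x, with the counit on the left so that no
    symmetry occurs; naturality of the symmetry restores the form used in
    \<open>is_power\<close>.\<close>
  have *: "ihom_post a s \<cdot> Vcmp self a p' c' \<cdot> (k' \<boxtimes> Idn V (Ihom V a p'))
      = Vcmp self a p c \<cdot> (k \<boxtimes> ihom_post a t)" (is "?l' = ?r'")
  proof (rule uncurry_arr_inject)
    have "uncurry_arr a c ?l' = s \<cdot> uncurry_arr a c' (Vcmp self a p' c' \<cdot> (k' \<boxtimes> Idn V (Ihom V a p')))"
      by (rule uncurry_ihom_post) (simp_all add: hom_iff)
    also have "uncurry_arr a c' (Vcmp self a p' c' \<cdot> (k' \<boxtimes> Idn V (Ihom V a p')))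
        = uncurry_arr p' c' k' \<cdot> (Idn V x \<boxtimes> uncurry_arr a p' (Idn V (Ihom V a p'))) \<cdot> Asc V x (Ihom V a p') a"
      by (rule uncurry_Vcmp_self) (simp_all add: hom_iff)
    also have "s \<cdot> \<dots> = uncurry_arr p c k
        \<cdot> (Idn V x \<boxtimes> (t \<cdot> uncurry_arr a p' (Idn V (Ihom V a p')))) \<cdot> Asc V x (Ihom V a p') a"
      by (simp add: reassoc[OF nat])
    also have "t \<cdot> uncurry_arr a p' (Idn V (Ihom V a p')) = uncurry_arr a p (ihom_post a t)"
      using uncurry_ihom_post[OF a t, of "Idn V (Ihom V a p')"] by (simp add: hom_iff)
    also have "uncurry_arr p c k \<cdot> (Idn V x \<boxtimes> uncurry_arr a p (ihom_post a t)) \<cdot> Asc V x (Ihom V a p') a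
        = uncurry_arr a c ?r'"
      by (rule uncurry_Vcmp_self[symmetric]) (simp_all add: hom_iff)
    finally show "uncurry_arr a c ?l' = uncurry_arr a c ?r'" .
  qed (simp_all add: hom_iff)
  have "uncurry_arr x (Ihom V a c) ?l
      = ihom_post a s \<cdot> Vcmp self a p' c' \<cdot> Sym V (Ihom V a p') (Ihom V p' c') \<cdot> (Idn V (Ihom V a p') \<boxtimes> k')"
    by (subst uncurry_ihom_post[where b = "Ihom V a c'"]) (simp_all add: hom_iff)
  also have "\<dots> = (ihom_post a s \<cdot> Vcmp self a p' c' \<cdot> (k' \<boxtimes> Idn V (Ihom V a p'))) \<cdot> Sym V (Ihom V a p') x"
    by (subst sym_nat[of _ "Ihom V a p'" "Ihom V a p'" k' x]) (simp_all add: hom_iff)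
  also have "\<dots> = Vcmp self a p c \<cdot> (k \<boxtimes> ihom_post a t) \<cdot> Sym V (Ihom V a p') x"
    unfolding * by simp
  also have "(k \<boxtimes> ihom_post a t) \<cdot> Sym V (Ihom V a p') x
      = Sym V (Ihom V a p) (Ihom V p c) \<cdot> (ihom_post a t \<boxtimes> k)"
    by (rule sym_nat[symmetric]) (simp_all add: hom_iff)
  also have "Vcmp self a p c \<cdot> Sym V (Ihom V a p) (Ihom V p c) \<cdot> (ihom_post a t \<boxtimes> k)
      = uncurry_arr x (Ihom V a c) ?r"
    by (simp add: uncurry_arr_cmp)
  finally show "uncurry_arr x (Ihom V a c) ?l = uncurry_arr x (Ihom V a c) ?r" .
  show "?l \<in> hom V (Ihom V a p') (Ihom V x (Ihom V a c))"
    "?r \<in> hom V (Ihom V a p') (Ihom V x (Ihom V a c))" "x \<in> Obj V" "Ihom V a c \<in> Obj V"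
    by (simp_all add: hom_iff)
qed

text \<open>By \<open>power_comparison_nat\<close> the comparisons for L and E are two opposite
  sides of a square whose other sides are induced by \<theta> and hence invertible. If the one for E
  is invertible, so is the one for L.\<close>

lemma action_iso_preserves_powers:
  assumes C: "is_vcat C" and E: "is_vfunctor C self E" and \<theta>: "action_iso C L E \<theta>"
    and pow: "preserves_powers \<J> C self E"
  shows "preserves_powers \<J> C self L"
  unfolding preserves_powers_def
proof (intro ballI allI impI)
  fix x c p k
  assume x: "x \<in> \<J>" and k: "is_power C x c p k"
  have [simp]: "x \<in> Obj V" "c \<in> Vobj C" "p \<in> Vobj C" "k \<in> Arr V" "Dom V k = x" "Cod V k = Vhom C p c"
    using k by (simp_all add: is_power_def hom_iff)
  note [simp] = action_iso_typing[OF \<theta>] is_vfunctor_typing[OF E, simplified] C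
  have "is_power self x (Fobj E c) (Fobj E p) (Fhom E p c \<cdot> k)"
    using pow x k by (simp add: preserves_powers_def)
  then have iso: "is_iso V (power_comparison x (Fobj E c) (Fobj E p) (Fhom E p c \<cdot> k) a)"
    if "a \<in> Obj V" for a
    using that by (simp add: is_power_def)
  have nat: "\<theta> c \<cdot> uncurry_arr (Fobj L p) (Fobj L c) (Fhom L p c \<cdot> k)
      = uncurry_arr (Fobj E p) (Fobj E c) (Fhom E p c \<cdot> k) \<cdot> (Idn V x \<boxtimes> \<theta> p)"
    by (simp add: uncurry_arr_cmp reassoc[OF action_iso_nat[OF \<theta>]])
  have "is_iso V (power_comparison x (Fobj L c) (Fobj L p) (Fhom L p c \<cdot> k) a)"
    (is "is_iso V ?m") if [simp]: "a \<in> Obj V" for a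
  proof -
    let ?s = "ihom_post x (ihom_post a (\<theta> c))"
    have s [simp]: "is_iso V ?s"
      by (simp add: is_iso_ihom_post)
    have "?s \<cdot> ?m = power_comparison x (Fobj E c) (Fobj E p) (Fhom E p c \<cdot> k) a \<cdot> ihom_post a (\<theta> p)"
      by (rule power_comparison_nat) (simp_all add: hom_iff nat)
    then have "is_iso V (?s \<cdot> ?m)"
      using iso[OF that] by (simp add: is_iso_cmp is_iso_ihom_post)
    then have "is_iso V (inv_arr V ?s \<cdot> ?s \<cdot> ?m)"
      by (rule is_iso_cmp) simp_all
    then show ?thesis
      by simp
  qed
  then show "is_power self x (Fobj L c) (Fobj L p) (Fhom L p c \<cdot> k)"
    by (simp add: is_power_def hom_iff)
qed

end


section \<open>Homs out of the free algebra on the unit\<close>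

context symmetric_monoidal_closed
begin

text \<open>The canonical isomorphism [I, a] -> a. The free-forgetful adjunction at the unit yields
  values in [I, B I], and this brings them to B I.\<close>

definition unit_eval :: "'o \<Rightarrow> 'm"
  where "unit_eval a = Evl V \<I> a \<cdot> inv_arr V (Run V (Ihom V \<I> a))"

lemma unit_eval_typing [simp]:
  assumes "a \<in> Obj V"
  shows "unit_eval a \<in> Arr V" "Dom V (unit_eval a) = Ihom V \<I> a" "Cod V (unit_eval a) = a"
  using assms by (simp_all add: unit_eval_def)

lemma unit_eval_cmp:
  assumes "a \<in> Obj V" "f \<in> hom V x (Ihom V \<I> a)"
  shows "unit_eval a \<cdot> f = uncurry_arr \<I> a f \<cdot> inv_arr V (Run V x)"
proof -
  have "x \<in> Obj V"
    using assms Dom_in_Obj unfolding hom_iff by blast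
  then show ?thesis
    using assms inv_Run_nat[OF assms(2)] by (simp add: unit_eval_def uncurry_arr_def hom_iff)
qed

lemma is_iso_unit_eval [simp]:
  assumes [simp]: "a \<in> Obj V"
  shows "is_iso V (unit_eval a)"
proof (rule is_isoI)
  \<comment> \<open>The inverse is the transpose of the right unit constraint.\<close>
  let ?c = "curry_arr a \<I> a (Run V a)"
  show "unit_eval a \<in> hom V (Ihom V \<I> a) a" "?c \<in> hom V a (Ihom V \<I> a)"
    by (simp_all add: hom_iff)
  show "unit_eval a \<cdot> ?c = Idn V a"
    by (subst unit_eval_cmp[where x = a]) (simp_all add: hom_iff)
  show "?c \<cdot> unit_eval a = Idn V (Ihom V \<I> a)"
  proof (rule uncurry_arr_inject)
    have "uncurry_arr \<I> a (?c \<cdot> unit_eval a) = Run V a \<cdot> (unit_eval a \<boxtimes> Idn V \<I>)"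
      by (simp add: uncurry_arr_cmp)
    also have "\<dots> = unit_eval a \<cdot> Run V (Ihom V \<I> a)"
      by (rule run_nat) (simp add: hom_iff)
    also have "\<dots> = uncurry_arr \<I> a (Idn V (Ihom V \<I> a))"
      by (simp add: unit_eval_def uncurry_arr_def)
    finally show "uncurry_arr \<I> a (?c \<cdot> unit_eval a) = uncurry_arr \<I> a (Idn V (Ihom V \<I> a))" .
  qed (simp_all add: hom_iff)
qed

text \<open>Enriched naturality of [I, b] -> b in b, for generalized elements: postcomposition with
  g becomes the action of the transpose of g. The unit constraints match by
  \<open>Run_ten\<close>.\<close>

lemma unit_eval_Vcmp_self:
  assumes [simp]: "b \<in> Obj V" "c \<in> Obj V"
    and g: "g \<in> hom V x (Ihom V b c)" and f: "f \<in> hom V z (Ihom V \<I> b)"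
  shows "unit_eval c \<cdot> Vcmp self \<I> b c \<cdot> (g \<boxtimes> f) = uncurry_arr b c g \<cdot> (Idn V x \<boxtimes> (unit_eval b \<cdot> f))"
proof -
  have [simp]: "x \<in> Obj V" "z \<in> Obj V"
    using f g Dom_in_Obj unfolding hom_iff by blast+
  have [simp]: "g \<in> Arr V" "Dom V g = x" "Cod V g = Ihom V b c"
    "f \<in> Arr V" "Dom V f = z" "Cod V f = Ihom V \<I> b"
    using f g by (simp_all add: hom_iff)
  have "unit_eval c \<cdot> Vcmp self \<I> b c \<cdot> (g \<boxtimes> f)
      = uncurry_arr \<I> c (Vcmp self \<I> b c \<cdot> (g \<boxtimes> f)) \<cdot> inv_arr V (Run V (x \<otimes> z))"
    by (rule unit_eval_cmp) (simp_all add: hom_iff)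
  also have "uncurry_arr \<I> c (Vcmp self \<I> b c \<cdot> (g \<boxtimes> f))
      = uncurry_arr b c g \<cdot> (Idn V x \<boxtimes> uncurry_arr \<I> b f) \<cdot> Asc V x z \<I>"
    by (rule uncurry_Vcmp_self) (simp_all add: g f)
  also have "\<dots> \<cdot> inv_arr V (Run V (x \<otimes> z))
      = uncurry_arr b c g \<cdot> (Idn V x \<boxtimes> uncurry_arr \<I> b f) \<cdot> Asc V x z \<I> \<cdot> inv_arr V (Run V (x \<otimes> z))"
    by simp
  also have "Asc V x z \<I> \<cdot> inv_arr V (Run V (x \<otimes> z)) = Idn V x \<boxtimes> inv_arr V (Run V z)"
    by (rule iso_left_cancel[of "Idn V x \<boxtimes> Run V z"]) (simp_all add: reassoc[OF Run_ten])
  finally show ?thesis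
    by (simp add: unit_eval_cmp[OF _ f])
qed

text \<open>The common core of both halves. S is the theory over which the dualizer is an algebra, W
  the other theory; Y J is D with its S-variable fixed at J, and \<open>g K J J'\<close> is the
  action of D in the S-variable with the W-variable fixed at K. The algebra E is Y evaluated at I,
  that is, the face.\<close>

lemma hom_from_free_isomorphic:
  assumes S: "is_vcat S" and W: "is_vcat W" and I: "\<I> \<in> Vobj W"
    and endsS: "\<forall>A B. is_algebra \<J> S A \<and> is_algebra \<J> S B \<longrightarrow> (\<exists>e. is_nat_object S self A B e)"
    and endsW: "\<forall>A B. is_algebra \<J> W A \<and> is_algebra \<J> W B \<longrightarrow> (\<exists>e. is_nat_object W self A B e)"
    and Y: "\<And>J. J \<in> Vobj S \<Longrightarrow> is_algebra \<J> W (Y J)"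
    and g: "\<And>J J'. J \<in> Vobj S \<Longrightarrow> J' \<in> Vobj S
      \<Longrightarrow> nat_family W self (Y J) (Y J') (Vhom S J J') (\<lambda>K. g K J J')"
    and E: "is_algebra \<J> S E"
    and E_obj: "\<And>J. Fobj E J = Fobj (Y J) \<I>" and E_hom: "\<And>J J'. Fhom E J J' = g \<I> J J'"
    and adj: "is_left_adjoint self (Alg \<J> W) F (forget \<J> W)"
  shows "isomorphic (Alg \<J> S)
    (vfun_comp V (representable (Alg \<J> W) (Fobj F \<I>))
      \<lparr>Fobj = Y, Fhom = (\<lambda>J J'. nat_lift W self (Y J) (Y J') (Vhom S J J') (\<lambda>K. g K J J'))\<rparr>) E"
    (is "isomorphic _ ?L E")
proof -
  obtain \<phi> where adj: "is_vadjunction self (Alg \<J> W) F (forget \<J> W) \<phi>"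
    using adj by (auto simp: is_left_adjoint_def)
  let ?P = "Fobj F \<I>"
  have P: "is_algebra \<J> W ?P"
    using adj by (simp add: is_vadjunction_def is_vfunctor_def)
  note endsW' = endsW[rule_format, OF conjI]
  have E': "is_vfunctor S self E"
    using E by (simp add: is_algebra_def)
  \<comment> \<open>The forgetful functor evaluates at I, so on Y J it returns E J, and the
    adjunction isomorphism lands in [I, E J].\<close>
  have \<phi>: "\<phi> \<I> (Y J) \<in> hom V (nat_ob W self ?P (Y J)) (Ihom V \<I> (Fobj E J))" "is_iso V (\<phi> \<I> (Y J))"
    if "J \<in> Vobj S" for J
    using adj Y[OF that] by (simp_all add: is_vadjunction_def forget_def E_obj)
  have \<phi>_nat: "\<phi> \<I> (Y J') \<cdot> Vcmp (Alg \<J> W) ?P (Y J) (Y J')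
      = Vcmp self \<I> (Fobj E J) (Fobj E J') \<cdot> (nat_proj W self (Y J) (Y J') \<I> \<boxtimes> \<phi> \<I> (Y J))"
    if "J \<in> Vobj S" "J' \<in> Vobj S" for J J'
    using adj Y that by (simp add: is_vadjunction_def forget_def E_obj del: Alg_simps(4))
  have M: "Vcmp (Alg \<J> W) ?P (Y J) (Y J')
      \<in> hom V (nat_ob W self (Y J) (Y J') \<otimes> nat_ob W self ?P (Y J)) (nat_ob W self ?P (Y J'))"
    if "J \<in> Vobj S" "J' \<in> Vobj S" for J J'
    using Vcmp_Alg_props(1)[OF W endsW P Y Y] that .
  let ?l = "\<lambda>J J'. nat_lift W self (Y J) (Y J') (Vhom S J J') (\<lambda>K. g K J J')"
  \<comment> \<open>The link between dualizer and face: the lift defining the action of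
    \<open>?L\<close> has the action of E as its projection at I.\<close>
  have l: "?l J J' \<in> hom V (Vhom S J J') (nat_ob W self (Y J) (Y J'))"
    "nat_proj W self (Y J) (Y J') \<I> \<cdot> ?l J J' = Fhom E J J'"
    if "J \<in> Vobj S" "J' \<in> Vobj S" for J J'
    using nat_lift_props[OF endsW'[OF Y Y] g] that I by (simp_all add: E_hom)
  have proj: "nat_proj W self (Y J) (Y J') \<I>
      \<in> hom V (nat_ob W self (Y J) (Y J')) (Ihom V (Fobj E J) (Fobj E J'))"
    if "J \<in> Vobj S" "J' \<in> Vobj S" for J J'
    using nat_proj_family[OF endsW'[OF Y Y]] that I by (simp add: nat_family_def E_obj)
  note [simp] = is_vfunctor_typing[OF E', simplified] S
  have [simp]: "nat_ob W self ?P (Y J) \<in> Obj V" if "J \<in> Vobj S" for J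
    using \<phi>(1)[OF that] Dom_in_Obj unfolding hom_iff by metis
  have [simp]: "nat_ob W self (Y J) (Y J') \<in> Obj V" if "J \<in> Vobj S" "J' \<in> Vobj S" for J J'
    using l(1)[OF that] Cod_in_Obj unfolding hom_iff by metis
  have L_obj: "Fobj ?L J = nat_ob W self ?P (Y J)" for J
    by (simp add: vfun_comp_def representable_def)
  \<comment> \<open>A representable acts by the transpose of composition, so transposing back leaves
    composition in \<open>Alg \<J> W\<close> with the lift.\<close>
  have L_hom: "Fhom ?L J J' \<in> hom V (Vhom S J J') (Ihom V (Fobj ?L J) (Fobj ?L J'))"
    "action ?L J J' = Vcmp (Alg \<J> W) ?P (Y J) (Y J') \<cdot> (?l J J' \<boxtimes> Idn V (nat_ob W self ?P (Y J)))"
    if "J \<in> Vobj S" "J' \<in> Vobj S" for J J'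
    using that l(1)[OF that] M[OF that]
    by (simp_all add: vfun_comp_def representable_def hom_iff uncurry_arr_cmp del: Alg_simps(4))
  let ?\<theta> = "\<lambda>J. unit_eval (Fobj E J) \<cdot> \<phi> \<I> (Y J)"
  have nat: "?\<theta> J' \<cdot> action ?L J J' = action E J J' \<cdot> (Idn V (Vhom S J J') \<boxtimes> ?\<theta> J)"
    if [simp]: "J \<in> Vobj S" "J' \<in> Vobj S" for J J'
  proof -
    note t = l(1)[OF that] M[OF that] \<phi>[OF that(1)] \<phi>[OF that(2)] proj[OF that]
    have "?\<theta> J' \<cdot> action ?L J J' = unit_eval (Fobj E J')
        \<cdot> (\<phi> \<I> (Y J') \<cdot> Vcmp (Alg \<J> W) ?P (Y J) (Y J')) \<cdot> (?l J J' \<boxtimes> Idn V (nat_ob W self ?P (Y J)))"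
      using t by (simp add: L_hom hom_iff del: Alg_simps(4))
    \<comment> \<open>Naturality of the adjunction in the algebra variable trades composition of
      algebra maps for composition in \<open>self\<close> with the projection at I, which now meets
      the lift.\<close>
    also have "\<dots> = unit_eval (Fobj E J') \<cdot> Vcmp self \<I> (Fobj E J) (Fobj E J')
        \<cdot> ((nat_proj W self (Y J) (Y J') \<I> \<cdot> ?l J J') \<boxtimes> \<phi> \<I> (Y J))"
      unfolding \<phi>_nat[OF that] using t by (simp add: hom_iff)
    also have "\<dots> = unit_eval (Fobj E J') \<cdot> Vcmp self \<I> (Fobj E J) (Fobj E J') \<cdot> (Fhom E J J' \<boxtimes> \<phi> \<I> (Y J))"
      by (simp only: l(2)[OF that])
    also have "\<dots> = action E J J' \<cdot> (Idn V (Vhom S J J') \<boxtimes> ?\<theta> J)"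
      using t by (intro unit_eval_Vcmp_self) (simp_all add: hom_iff)
    finally show ?thesis .
  qed
  have \<theta>: "action_iso S ?L E ?\<theta>"
    unfolding action_iso_def using \<phi> L_hom(1) nat
    by (auto simp: L_obj hom_iff intro!: is_iso_cmp)
  have "is_algebra \<J> S ?L"
    using action_iso_vfunctor[OF S E' \<theta>] action_iso_preserves_powers[OF S E' \<theta>] E
    by (simp add: is_algebra_def)
  then show ?thesis
    by (rule action_iso_isomorphic[OF S endsS _ E \<theta>])
qed

end


section \<open>Functors of two variables\<close>

context symmetric_monoidal_closed
begin

text \<open>\<open>interchange_Run_Run\<close> solved for the inverse constraints, since
  \<open>fix_right\<close> inserts its identity through inverses of \<open>Run\<close>.\<close>

lemma interchange_inv_Run_Run:
  assumes [simp]: "a \<in> Obj V" "c \<in> Obj V"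
  shows "(Idn V (a \<otimes> c) \<boxtimes> Lun V \<I>) \<cdot> interchange a \<I> c \<I> \<cdot> (inv_arr V (Run V a) \<boxtimes> inv_arr V (Run V c))
    = inv_arr V (Run V (a \<otimes> c))"
proof (rule iso_left_cancel[of "Run V (a \<otimes> c)"])
  have "Run V (a \<otimes> c) \<cdot> (Idn V (a \<otimes> c) \<boxtimes> Lun V \<I>) \<cdot> interchange a \<I> c \<I>
        \<cdot> (inv_arr V (Run V a) \<boxtimes> inv_arr V (Run V c))
      = (Run V (a \<otimes> c) \<cdot> (Idn V (a \<otimes> c) \<boxtimes> Lun V \<I>) \<cdot> interchange a \<I> c \<I>)
        \<cdot> (inv_arr V (Run V a) \<boxtimes> inv_arr V (Run V c))"
    by simp
  then show "Run V (a \<otimes> c) \<cdot> (Idn V (a \<otimes> c) \<boxtimes> Lun V \<I>) \<cdot> interchange a \<I> c \<I>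
        \<cdot> (inv_arr V (Run V a) \<boxtimes> inv_arr V (Run V c)) = Run V (a \<otimes> c) \<cdot> inv_arr V (Run V (a \<otimes> c))"
    unfolding interchange_Run_Run[OF assms] by simp
qed simp_all

lemma interchange_inv_Lun_Lun:
  assumes [simp]: "b \<in> Obj V" "d \<in> Obj V"
  shows "(Lun V \<I> \<boxtimes> Idn V (b \<otimes> d)) \<cdot> interchange \<I> b \<I> d \<cdot> (inv_arr V (Lun V b) \<boxtimes> inv_arr V (Lun V d))
    = inv_arr V (Lun V (b \<otimes> d))"
proof (rule iso_left_cancel[of "Lun V (b \<otimes> d)"])
  have "Lun V (b \<otimes> d) \<cdot> (Lun V \<I> \<boxtimes> Idn V (b \<otimes> d)) \<cdot> interchange \<I> b \<I> d
        \<cdot> (inv_arr V (Lun V b) \<boxtimes> inv_arr V (Lun V d))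
      = (Lun V (b \<otimes> d) \<cdot> (Lun V \<I> \<boxtimes> Idn V (b \<otimes> d)) \<cdot> interchange \<I> b \<I> d)
        \<cdot> (inv_arr V (Lun V b) \<boxtimes> inv_arr V (Lun V d))"
    by simp
  then show "Lun V (b \<otimes> d) \<cdot> (Lun V \<I> \<boxtimes> Idn V (b \<otimes> d)) \<cdot> interchange \<I> b \<I> d
        \<cdot> (inv_arr V (Lun V b) \<boxtimes> inv_arr V (Lun V d)) = Lun V (b \<otimes> d) \<cdot> inv_arr V (Lun V (b \<otimes> d))"
    unfolding interchange_Lun_Lun[OF assms] by simp
qed simp_all

lemma vtensor_simps [simp]:
  "Vobj (vtensor T U) = Vobj T \<times> Vobj U"
  "Vhom (vtensor T U) (J, K) (J', K') = Vhom T J J' \<otimes> Vhom U K K'"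
  "Vid (vtensor T U) (J, K) = (Vid T J \<boxtimes> Vid U K) \<cdot> inv_arr V (Lun V \<I>)"
  "Vcmp (vtensor T U) (J, K) (J', K') (J'', K'')
    = (Vcmp T J J' J'' \<boxtimes> Vcmp U K K' K'')
      \<cdot> interchange (Vhom T J' J'') (Vhom U K' K'') (Vhom T J J') (Vhom U K K')"
  by (simp_all add: vtensor_def)

lemma Vcmp_Vid:
  assumes "is_vcat C" "A \<in> Vobj C" "B \<in> Vobj C"
  shows "Vcmp C A B B \<cdot> (Vid C B \<boxtimes> Idn V (Vhom C A B)) = Lun V (Vhom C A B)"
    "Vcmp C A A B \<cdot> (Idn V (Vhom C A B) \<boxtimes> Vid C A) = Run V (Vhom C A B)"
  using assms unfolding is_vcat_def by blast+

text \<open>Describes what happens in the fixed variable when two arrows of the other variable are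
  composed: an identity meets itself.\<close>

lemma Vcmp_Vid_Vid:
  assumes C: "is_vcat C" and A: "A \<in> Vobj C"
  shows "Vcmp C A A A \<cdot> (Vid C A \<boxtimes> Vid C A) = Vid C A \<cdot> Lun V \<I>"
proof -
  have "Vcmp C A A A \<cdot> (Vid C A \<boxtimes> Vid C A)
      = (Vcmp C A A A \<cdot> (Vid C A \<boxtimes> Idn V (Vhom C A A))) \<cdot> (Idn V \<I> \<boxtimes> Vid C A)"
    using C A by simp
  also have "\<dots> = Vid C A \<cdot> Lun V \<I>"
    unfolding Vcmp_Vid(1)[OF C A A] by (rule lun_nat) (simp add: hom_iff C A)
  finally show ?thesis .
qed

lemma fix_simps [simp]:
  "Fobj (fix_right T U D K) J = Fobj D (J, K)" "Fobj (fix_left T U D J) K = Fobj D (J, K)"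
  "Fhom (fix_right T U D K) J J' = Fhom D (J, K) (J', K)
    \<cdot> (Idn V (Vhom T J J') \<boxtimes> Vid U K) \<cdot> inv_arr V (Run V (Vhom T J J'))"
  "Fhom (fix_left T U D J) K K' = Fhom D (J, K) (J, K')
    \<cdot> (Vid T J \<boxtimes> Idn V (Vhom U K K')) \<cdot> inv_arr V (Lun V (Vhom U K K'))"
  by (simp_all add: fix_right_def fix_left_def)

lemma bifunctor_typing:
  assumes "is_vfunctor (vtensor T U) self D" "J \<in> Vobj T" "K \<in> Vobj U"
  shows "Fobj D (J, K) \<in> Obj V"
    "J' \<in> Vobj T \<Longrightarrow> K' \<in> Vobj U \<Longrightarrow> Fhom D (J, K) (J', K') \<in> Arr V"
    "J' \<in> Vobj T \<Longrightarrow> K' \<in> Vobj U \<Longrightarrow> Dom V (Fhom D (J, K) (J', K')) = Vhom T J J' \<otimes> Vhom U K K'"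
    "J' \<in> Vobj T \<Longrightarrow> K' \<in> Vobj U
      \<Longrightarrow> Cod V (Fhom D (J, K) (J', K')) = Ihom V (Fobj D (J, K)) (Fobj D (J', K'))"
  using is_vfunctor_typing[OF assms(1), of "(J, K)"] assms(2,3) by simp_all

text \<open>Functoriality of D on generalized arrows that are tensors, with naturality carrying the
  interchange past their components. The partial functors and their compatibility are the cases in
  which one arrow of each pair is an identity.\<close>

lemma bifunctor_cmp:
  assumes T: "is_vcat T" and U: "is_vcat U" and D: "is_vfunctor (vtensor T U) self D"
    and [simp]: "J \<in> Vobj T" "J' \<in> Vobj T" "J'' \<in> Vobj T" "K \<in> Vobj U" "K' \<in> Vobj U" "K'' \<in> Vobj U"
    and p: "p \<in> hom V y (Vhom T J' J'')" and q: "q \<in> hom V z (Vhom U K' K'')"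
    and r: "r \<in> hom V w (Vhom T J J')" and s: "s \<in> hom V v (Vhom U K K')"
  shows "Vcmp self (Fobj D (J, K)) (Fobj D (J', K')) (Fobj D (J'', K''))
      \<cdot> ((Fhom D (J', K') (J'', K'') \<cdot> (p \<boxtimes> q)) \<boxtimes> (Fhom D (J, K) (J', K') \<cdot> (r \<boxtimes> s)))
    = Fhom D (J, K) (J'', K'')
      \<cdot> ((Vcmp T J J' J'' \<cdot> (p \<boxtimes> r)) \<boxtimes> (Vcmp U K K' K'' \<cdot> (q \<boxtimes> s))) \<cdot> interchange y z w v"
proof -
  note [simp] = T U bifunctor_typing[OF D]
  have [simp]: "y \<in> Obj V" "z \<in> Obj V" "w \<in> Obj V" "v \<in> Obj V"
    using p q r s Dom_in_Obj unfolding hom_iff by blast+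
  have [simp]: "p \<in> Arr V" "Dom V p = y" "Cod V p = Vhom T J' J''"
    "q \<in> Arr V" "Dom V q = z" "Cod V q = Vhom U K' K''"
    "r \<in> Arr V" "Dom V r = w" "Cod V r = Vhom T J J'"
    "s \<in> Arr V" "Dom V s = v" "Cod V s = Vhom U K K'"
    using p q r s by (simp_all add: hom_iff)
  have cmp: "Vcmp self (Fobj D (J, K)) (Fobj D (J', K')) (Fobj D (J'', K''))
        \<cdot> (Fhom D (J', K') (J'', K'') \<boxtimes> Fhom D (J, K) (J', K'))
      = Fhom D (J, K) (J'', K'') \<cdot> (Vcmp T J J' J'' \<boxtimes> Vcmp U K K' K'')
        \<cdot> interchange (Vhom T J' J'') (Vhom U K' K'') (Vhom T J J') (Vhom U K K')"
    using D unfolding is_vfunctor_def by simp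
  have "Vcmp self (Fobj D (J, K)) (Fobj D (J', K')) (Fobj D (J'', K''))
      \<cdot> ((Fhom D (J', K') (J'', K'') \<cdot> (p \<boxtimes> q)) \<boxtimes> (Fhom D (J, K) (J', K') \<cdot> (r \<boxtimes> s)))
    = (Vcmp self (Fobj D (J, K)) (Fobj D (J', K')) (Fobj D (J'', K''))
        \<cdot> (Fhom D (J', K') (J'', K'') \<boxtimes> Fhom D (J, K) (J', K'))) \<cdot> ((p \<boxtimes> q) \<boxtimes> (r \<boxtimes> s))"
    by simp
  also have "\<dots> = Fhom D (J, K) (J'', K'') \<cdot> (Vcmp T J J' J'' \<boxtimes> Vcmp U K K' K'')
      \<cdot> interchange (Vhom T J' J'') (Vhom U K' K'') (Vhom T J J') (Vhom U K K') \<cdot> ((p \<boxtimes> q) \<boxtimes> (r \<boxtimes> s))"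
    unfolding cmp by simp
  also have "\<dots> = Fhom D (J, K) (J'', K'')
      \<cdot> ((Vcmp T J J' J'' \<cdot> (p \<boxtimes> r)) \<boxtimes> (Vcmp U K K' K'' \<cdot> (q \<boxtimes> s))) \<cdot> interchange y z w v"
    unfolding interchange_nat[OF p q r s] by simp
  finally show ?thesis .
qed

text \<open>In \<open>bifunctor_cmp\<close> the composite in the fixed variable collapses by
  \<open>Vcmp_Vid_Vid\<close>, and the interchange by
  \<open>interchange_inv_Run_Run\<close>.\<close>

lemma fix_right_vfunctor:
  assumes T: "is_vcat T" and U: "is_vcat U" and D: "is_vfunctor (vtensor T U) self D"
    and K [simp]: "K \<in> Vobj U"
  shows "is_vfunctor T self (fix_right T U D K)"
proof -
  note [simp] = T U bifunctor_typing[OF D]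
  let ?R = "\<lambda>J J'. Fhom (fix_right T U D K) J J'"
  have "?R J J \<cdot> Vid T J = Vid self (Fobj D (J, K))" if [simp]: "J \<in> Vobj T" for J
  proof -
    have "?R J J \<cdot> Vid T J
        = Fhom D (J, K) (J, K) \<cdot> (Idn V (Vhom T J J) \<boxtimes> Vid U K) \<cdot> (Vid T J \<boxtimes> Idn V \<I>) \<cdot> inv_arr V (Run V \<I>)"
      using inv_Run_nat[of "Vid T J" \<I> "Vhom T J J"] by (simp add: hom_iff)
    \<comment> \<open>The identity of the tensor product is defined through
      \<open>Lun V \<I>\<close> but \<open>fix_right\<close> goes through \<open>Run V \<I>\<close>;
      the two constraints agree.\<close>
    also have "\<dots> = Fhom D (J, K) (J, K) \<cdot> Vid (vtensor T U) (J, K)"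
      by (simp add: Lun_Unit)
    also have "\<dots> = Vid self (Fobj D (J, K))"
      using D unfolding is_vfunctor_def by (simp del: vtensor_simps(3))
    finally show ?thesis .
  qed
  moreover have "?R J J'' \<cdot> Vcmp T J J' J''
      = Vcmp self (Fobj D (J, K)) (Fobj D (J', K)) (Fobj D (J'', K)) \<cdot> (?R J' J'' \<boxtimes> ?R J J')"
    if [simp]: "J \<in> Vobj T" "J' \<in> Vobj T" "J'' \<in> Vobj T" for J J' J''
  proof -
    let ?a = "Vhom T J' J''" and ?c = "Vhom T J J'"
    let ?RR = "inv_arr V (Run V ?a) \<boxtimes> inv_arr V (Run V ?c)"
    let ?M = "Vcmp self (Fobj D (J, K)) (Fobj D (J', K)) (Fobj D (J'', K))"
    have "?M \<cdot> (?R J' J'' \<boxtimes> ?R J J')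
        = (?M \<cdot> ((Fhom D (J', K) (J'', K) \<cdot> (Idn V ?a \<boxtimes> Vid U K))
            \<boxtimes> (Fhom D (J, K) (J', K) \<cdot> (Idn V ?c \<boxtimes> Vid U K)))) \<cdot> ?RR"
      by simp
    also have "\<dots> = (Fhom D (J, K) (J'', K) \<cdot> ((Vcmp T J J' J'' \<cdot> (Idn V ?a \<boxtimes> Idn V ?c))
          \<boxtimes> (Vcmp U K K K \<cdot> (Vid U K \<boxtimes> Vid U K))) \<cdot> interchange ?a \<I> ?c \<I>) \<cdot> ?RR"
      by (subst bifunctor_cmp[OF T U D, where y = ?a and z = \<I> and w = ?c and v = \<I>])
        (simp_all add: hom_iff)
    also have "\<dots> = Fhom D (J, K) (J'', K) \<cdot> (Vcmp T J J' J'' \<boxtimes> Vid U K)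
        \<cdot> (Idn V (?a \<otimes> ?c) \<boxtimes> Lun V \<I>) \<cdot> interchange ?a \<I> ?c \<I> \<cdot> ?RR"
      by (simp add: Vcmp_Vid_Vid[OF U K])
    also have "\<dots> = Fhom D (J, K) (J'', K) \<cdot> (Idn V (Vhom T J J'') \<boxtimes> Vid U K)
        \<cdot> (Vcmp T J J' J'' \<boxtimes> Idn V \<I>) \<cdot> inv_arr V (Run V (?a \<otimes> ?c))"
      by (subst interchange_inv_Run_Run) simp_all
    also have "\<dots> = ?R J J'' \<cdot> Vcmp T J J' J''"
      by (subst inv_Run_nat[of "Vcmp T J J' J''" _ "Vhom T J J''"]) (simp_all add: hom_iff)
    finally show ?thesis
      by (rule sym)
  qed
  ultimately show ?thesis
    by (simp add: is_vfunctor_def hom_iff)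
qed

lemma fix_left_vfunctor:
  assumes T: "is_vcat T" and U: "is_vcat U" and D: "is_vfunctor (vtensor T U) self D"
    and J [simp]: "J \<in> Vobj T"
  shows "is_vfunctor U self (fix_left T U D J)"
proof -
  note [simp] = T U bifunctor_typing[OF D]
  let ?R = "\<lambda>K K'. Fhom (fix_left T U D J) K K'"
  have "?R K K \<cdot> Vid U K = Vid self (Fobj D (J, K))" if [simp]: "K \<in> Vobj U" for K
  proof -
    have "?R K K \<cdot> Vid U K
        = Fhom D (J, K) (J, K) \<cdot> (Vid T J \<boxtimes> Idn V (Vhom U K K)) \<cdot> (Idn V \<I> \<boxtimes> Vid U K) \<cdot> inv_arr V (Lun V \<I>)"
      using inv_Lun_nat[of "Vid U K" \<I> "Vhom U K K"] by (simp add: hom_iff)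
    also have "\<dots> = Fhom D (J, K) (J, K) \<cdot> Vid (vtensor T U) (J, K)"
      by simp
    also have "\<dots> = Vid self (Fobj D (J, K))"
      using D unfolding is_vfunctor_def by (simp del: vtensor_simps(3))
    finally show ?thesis .
  qed
  moreover have "?R K K'' \<cdot> Vcmp U K K' K''
      = Vcmp self (Fobj D (J, K)) (Fobj D (J, K')) (Fobj D (J, K'')) \<cdot> (?R K' K'' \<boxtimes> ?R K K')"
    if [simp]: "K \<in> Vobj U" "K' \<in> Vobj U" "K'' \<in> Vobj U" for K K' K''
  proof -
    let ?b = "Vhom U K' K''" and ?d = "Vhom U K K'"
    let ?LL = "inv_arr V (Lun V ?b) \<boxtimes> inv_arr V (Lun V ?d)"
    let ?M = "Vcmp self (Fobj D (J, K)) (Fobj D (J, K')) (Fobj D (J, K''))"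
    have "?M \<cdot> (?R K' K'' \<boxtimes> ?R K K')
        = (?M \<cdot> ((Fhom D (J, K') (J, K'') \<cdot> (Vid T J \<boxtimes> Idn V ?b))
            \<boxtimes> (Fhom D (J, K) (J, K') \<cdot> (Vid T J \<boxtimes> Idn V ?d)))) \<cdot> ?LL"
      by simp
    also have "\<dots> = (Fhom D (J, K) (J, K'') \<cdot> ((Vcmp T J J J \<cdot> (Vid T J \<boxtimes> Vid T J))
          \<boxtimes> (Vcmp U K K' K'' \<cdot> (Idn V ?b \<boxtimes> Idn V ?d))) \<cdot> interchange \<I> ?b \<I> ?d) \<cdot> ?LL"
      by (subst bifunctor_cmp[OF T U D, where y = \<I> and z = ?b and w = \<I> and v = ?d])
        (simp_all add: hom_iff)
    also have "\<dots> = Fhom D (J, K) (J, K'') \<cdot> (Vid T J \<boxtimes> Vcmp U K K' K'')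
        \<cdot> (Lun V \<I> \<boxtimes> Idn V (?b \<otimes> ?d)) \<cdot> interchange \<I> ?b \<I> ?d \<cdot> ?LL"
      by (simp add: Vcmp_Vid_Vid[OF T J])
    also have "\<dots> = Fhom D (J, K) (J, K'') \<cdot> (Vid T J \<boxtimes> Idn V (Vhom U K K''))
        \<cdot> (Idn V \<I> \<boxtimes> Vcmp U K K' K'') \<cdot> inv_arr V (Lun V (?b \<otimes> ?d))"
      by (subst interchange_inv_Lun_Lun) simp_all
    also have "\<dots> = ?R K K'' \<cdot> Vcmp U K K' K''"
      by (subst inv_Lun_nat[of "Vcmp U K K' K''" _ "Vhom U K K''"]) (simp_all add: hom_iff)
    finally show ?thesis
      by (rule sym)
  qed
  ultimately show ?thesis
    by (simp add: is_vfunctor_def hom_iff)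
qed

text \<open>A pair of arrows factors as one in each variable, in either order. The identities vanish
  by the unit laws of T and U, and the interchange becomes trivial in the first order and a symmetry
  in the second.\<close>

lemma fix_right_fix_left_cmp:
  assumes T: "is_vcat T" and U: "is_vcat U" and D: "is_vfunctor (vtensor T U) self D"
    and [simp]: "J \<in> Vobj T" "J' \<in> Vobj T" "K \<in> Vobj U" "K' \<in> Vobj U"
  shows "Vcmp self (Fobj D (J, K)) (Fobj D (J, K')) (Fobj D (J', K'))
      \<cdot> (Fhom (fix_right T U D K') J J' \<boxtimes> Fhom (fix_left T U D J) K K') = Fhom D (J, K) (J', K')"
    "Vcmp self (Fobj D (J, K)) (Fobj D (J', K)) (Fobj D (J', K'))
      \<cdot> (Fhom (fix_left T U D J') K K' \<boxtimes> Fhom (fix_right T U D K) J J')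
      = Fhom D (J, K) (J', K') \<cdot> Sym V (Vhom U K K') (Vhom T J J')"
proof -
  note [simp] = T U bifunctor_typing[OF D]
  let ?a = "Vhom T J J'" and ?b = "Vhom U K K'"
  let ?M = "Vcmp self (Fobj D (J, K)) (Fobj D (J, K')) (Fobj D (J', K'))"
  let ?M' = "Vcmp self (Fobj D (J, K)) (Fobj D (J', K)) (Fobj D (J', K'))"
  let ?RL = "inv_arr V (Run V ?a) \<boxtimes> inv_arr V (Lun V ?b)"
  let ?LR = "inv_arr V (Lun V ?b) \<boxtimes> inv_arr V (Run V ?a)"
  have "?M \<cdot> (Fhom (fix_right T U D K') J J' \<boxtimes> Fhom (fix_left T U D J) K K')
      = (?M \<cdot> ((Fhom D (J, K') (J', K') \<cdot> (Idn V ?a \<boxtimes> Vid U K'))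
          \<boxtimes> (Fhom D (J, K) (J, K') \<cdot> (Vid T J \<boxtimes> Idn V ?b)))) \<cdot> ?RL"
    by simp
  also have "\<dots> = (Fhom D (J, K) (J', K') \<cdot> ((Vcmp T J J J' \<cdot> (Idn V ?a \<boxtimes> Vid T J))
        \<boxtimes> (Vcmp U K K' K' \<cdot> (Vid U K' \<boxtimes> Idn V ?b))) \<cdot> interchange ?a \<I> \<I> ?b) \<cdot> ?RL"
    by (subst bifunctor_cmp[OF T U D, where y = ?a and z = \<I> and w = \<I> and v = ?b])
      (simp_all add: hom_iff)
  also have "\<dots> = Fhom D (J, K) (J', K') \<cdot> ((Run V ?a \<boxtimes> Lun V ?b) \<cdot> interchange ?a \<I> \<I> ?b) \<cdot> ?RL"
    by (simp add: Vcmp_Vid)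
  also have "\<dots> = Fhom D (J, K) (J', K')"
    by (subst interchange_Run_Lun) simp_all
  finally show "?M \<cdot> (Fhom (fix_right T U D K') J J' \<boxtimes> Fhom (fix_left T U D J) K K')
    = Fhom D (J, K) (J', K')" .
  have "?M' \<cdot> (Fhom (fix_left T U D J') K K' \<boxtimes> Fhom (fix_right T U D K) J J')
      = (?M' \<cdot> ((Fhom D (J', K) (J', K') \<cdot> (Vid T J' \<boxtimes> Idn V ?b))
          \<boxtimes> (Fhom D (J, K) (J', K) \<cdot> (Idn V ?a \<boxtimes> Vid U K)))) \<cdot> ?LR"
    by simp
  also have "\<dots> = (Fhom D (J, K) (J', K') \<cdot> ((Vcmp T J J' J' \<cdot> (Vid T J' \<boxtimes> Idn V ?a))
        \<boxtimes> (Vcmp U K K K' \<cdot> (Idn V ?b \<boxtimes> Vid U K))) \<cdot> interchange \<I> ?b ?a \<I>) \<cdot> ?LR"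
    by (subst bifunctor_cmp[OF T U D, where y = \<I> and z = ?b and w = ?a and v = \<I>])
      (simp_all add: hom_iff)
  also have "\<dots> = Fhom D (J, K) (J', K') \<cdot> ((Lun V ?a \<boxtimes> Run V ?b) \<cdot> interchange \<I> ?b ?a \<I>) \<cdot> ?LR"
    by (simp add: Vcmp_Vid)
  also have "\<dots> = Fhom D (J, K) (J', K') \<cdot> Sym V ?b ?a"
    by (subst interchange_Lun_Run) simp_all
  finally show "?M' \<cdot> (Fhom (fix_left T U D J') K K' \<boxtimes> Fhom (fix_right T U D K) J J')
    = Fhom D (J, K) (J', K') \<cdot> Sym V ?b ?a" .
qed

text \<open>Both sides of naturality are factorizations of the same arrow of D, so equating them is
  the claim. It gives the lifts in \<open>left_transpose\<close> their value.\<close>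

lemma fix_right_nat_family:
  assumes T: "is_vcat T" and U: "is_vcat U" and D: "is_vfunctor (vtensor T U) self D"
    and [simp]: "J \<in> Vobj T" "J' \<in> Vobj T"
  shows "nat_family U self (fix_left T U D J) (fix_left T U D J') (Vhom T J J')
    (\<lambda>K. Fhom (fix_right T U D K) J J')"
proof -
  note [simp] = is_vfunctor_typing[OF fix_right_vfunctor[OF T U D], simplified fix_simps(1,2) self_simps] T U
    bifunctor_typing[OF D]
  have "Vcmp self (Fobj D (J, K)) (Fobj D (J', K)) (Fobj D (J', K'))
        \<cdot> (Fhom (fix_left T U D J') K K' \<boxtimes> Fhom (fix_right T U D K) J J')
      = (Vcmp self (Fobj D (J, K)) (Fobj D (J, K')) (Fobj D (J', K'))
        \<cdot> (Fhom (fix_right T U D K') J J' \<boxtimes> Fhom (fix_left T U D J) K K')) \<cdot> Sym V (Vhom U K K') (Vhom T J J')"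
    if "K \<in> Vobj U" "K' \<in> Vobj U" for K K'
    using that by (simp only: fix_right_fix_left_cmp[OF T U D] assms)
  then show ?thesis
    by (simp add: nat_family_def hom_iff)
qed

text \<open>The same two factorizations read in the opposite direction, using that the symmetry is
  an involution; this serves \<open>right_transpose\<close>.\<close>

lemma fix_left_nat_family:
  assumes T: "is_vcat T" and U: "is_vcat U" and D: "is_vfunctor (vtensor T U) self D"
    and [simp]: "K \<in> Vobj U" "K' \<in> Vobj U"
  shows "nat_family T self (fix_right T U D K) (fix_right T U D K') (Vhom U K K')
    (\<lambda>J. Fhom (fix_left T U D J) K K')"
proof -
  note [simp] = T U bifunctor_typing[OF D]
  have "Vcmp self (Fobj D (J, K)) (Fobj D (J, K')) (Fobj D (J', K'))
        \<cdot> (Fhom (fix_right T U D K') J J' \<boxtimes> Fhom (fix_left T U D J) K K')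
      = (Vcmp self (Fobj D (J, K)) (Fobj D (J', K)) (Fobj D (J', K'))
        \<cdot> (Fhom (fix_left T U D J') K K' \<boxtimes> Fhom (fix_right T U D K) J J')) \<cdot> Sym V (Vhom T J J') (Vhom U K K')"
    if [simp]: "J \<in> Vobj T" "J' \<in> Vobj T" for J J'
    unfolding fix_right_fix_left_cmp[OF T U D \<open>J \<in> Vobj T\<close> \<open>J' \<in> Vobj T\<close> \<open>K \<in> Vobj U\<close> \<open>K' \<in> Vobj U\<close>]
    by simp
  then show ?thesis
    by (simp add: nat_family_def hom_iff)
qed

end

theorem proposition5p14:
  fixes V :: "('o, 'm) smcc" and \<J> :: "'o set"
    and T U :: "('o, 'o, 'm) vcat" and \<tau> \<upsilon> :: "('o, 'o, 'm) vfun"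
    and D :: "('o \<times> 'o, 'o, 'm) vfun"
  assumes "symmetric_monoidal_closed V"
    and "has_finite_limits V"
    and "symmetric_monoidal_closed.system_of_arities V \<J>"
    and "symmetric_monoidal_closed.amenable V \<J>"
    and "symmetric_monoidal_closed.is_bifold_algebra V \<J> T \<tau> U \<upsilon> D"
  shows "let \<D> = symmetric_monoidal_closed.Dualn V \<J> T U D;
             \<V> = symmetric_monoidal_closed.self V
         in (\<forall>Fr. symmetric_monoidal_closed.is_left_adjoint V \<V> (Rcat \<D>) Fr (Rfun \<D>)
               \<longrightarrow> symmetric_monoidal_closed.isomorphic V (Lcat \<D>)
                     (symmetric_monoidal_closed.left_dualizer V \<D> Fr)
                     (symmetric_monoidal_closed.left_face V T U D)) \<and>
            (\<forall>Fl. symmetric_monoidal_closed.is_left_adjoint V \<V> (Lcat \<D>) Fl (Lfun \<D>)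
               \<longrightarrow> symmetric_monoidal_closed.isomorphic V (Rcat \<D>)
                     (symmetric_monoidal_closed.right_dualizer V \<D> Fl)
                     (symmetric_monoidal_closed.right_face V T U D))"
proof -
  interpret symmetric_monoidal_closed V
    by fact
  have theories: "is_theory \<J> T \<tau>" "is_theory \<J> U \<upsilon>" and D: "is_bialgebra \<J> T U D"
    using assms(5) by (simp_all add: is_bifold_algebra_def)
  then have T: "is_vcat T" "\<I>\<^bsub>V\<^esub> \<in> Vobj T" and U: "is_vcat U" "\<I>\<^bsub>V\<^esub> \<in> Vobj U"
    using assms(3) by (simp_all add: is_theory_def system_of_arities_def)
  have endsT: "\<forall>A B. is_algebra \<J> T A \<and> is_algebra \<J> T B \<longrightarrow> (\<exists>e. is_nat_object T self A B e)"
    and endsU: "\<forall>A B. is_algebra \<J> U A \<and> is_algebra \<J> U B \<longrightarrow> (\<exists>e. is_nat_object U self A B e)"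
    using assms(4) theories unfolding amenable_def by blast+
  have D': "is_vfunctor (vtensor T U) self D"
    using D by (simp add: is_bialgebra_def)
  have left: "is_algebra \<J> U (fix_left T U D J)" if "J \<in> Vobj T" for J
    using D fix_left_vfunctor[OF T(1) U(1) D' that] that by (simp add: is_algebra_def is_bialgebra_def)
  have right: "is_algebra \<J> T (fix_right T U D K)" if "K \<in> Vobj U" for K
    using D fix_right_vfunctor[OF T(1) U(1) D' that] that by (simp add: is_algebra_def is_bialgebra_def)
  have "isomorphic (Alg \<J> T) (left_dualizer (Dualn \<J> T U D) Fr) (left_face T U D)"
    if "is_left_adjoint self (Alg \<J> U) Fr (forget \<J> U)" for Fr
  proof -
    have "isomorphic (Alg \<J> T)
      (vfun_comp V (representable (Alg \<J> U) (Fobj Fr \<I>\<^bsub>V\<^esub>)) (left_transpose T U D)) (fix_right T U D \<I>\<^bsub>V\<^esub>)"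
      \<comment> \<open>Here Y J = D(J,-) and g is the action of D(-,K), so the conditions on the
        face hold by definition. The hom parts of the partial functors stay folded so that the
        naturality lemma matches.\<close>
      unfolding left_transpose_def
      by (rule hom_from_free_isomorphic[OF T(1) U endsT endsU left _ right[OF U(2)] _ _ that])
        (simp_all add: fix_right_nat_family[OF T(1) U(1) D'] del: fix_simps(3,4))
    \<comment> \<open>The object part of \<open>Hom_right\<close> is unchanged by
      \<open>vfun_op\<close>, so the dualizer is the representable of the free algebra composed with
      the transpose of D.\<close>
    then show ?thesis
      by (simp add: Dualn_def left_dualizer_def left_face_def Hom_right_def vfun_op_def hom_into_def)
  qed
  moreover have "isomorphic (Alg \<J> U) (right_dualizer (Dualn \<J> T U D) Fl) (right_face T U D)"
    if "is_left_adjoint self (Alg \<J> T) Fl (forget \<J> T)" for Fl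
  proof -
    \<comment> \<open>The same core statement with T and U exchanged: now Y K = D(-,K), evaluated at
      I in the first variable.\<close>
    have "isomorphic (Alg \<J> U)
      (vfun_comp V (representable (Alg \<J> T) (Fobj Fl \<I>\<^bsub>V\<^esub>)) (right_transpose T U D)) (fix_left T U D \<I>\<^bsub>V\<^esub>)"
      unfolding right_transpose_def
      by (rule hom_from_free_isomorphic[OF U(1) T endsU endsT right _ left[OF T(2)] _ _ that])
        (simp_all add: fix_left_nat_family[OF T(1) U(1) D'] del: fix_simps(3,4))
    then show ?thesis
      by (simp add: Dualn_def right_dualizer_def right_face_def Hom_left_def hom_into_def)
  qed
  ultimately show ?thesis
    by (simp add: Let_def Dualn_def)
qed

end
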